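(* There is a biholomorphic map $$(E\times E)/H\;\xrightarrow{\ \sim\ }\;\mathcal B/\sigma,$$ defined over the field $\mathbb Q(\mathrm i)$ of Gauss numbers.
   Context: The box variety is $\mathcal B=\mathrm{proj}(B\otimes_{\mathbb Q}\mathbb C)$, with $\mathbb Q$-structure $\mathrm{proj}(B)$, where $B=\mathbb Q[Z_1,Z_2,Z_3,W_1,W_2,W_3,C]$ (generators of degree one) has defining relations $W_1^2+W_2^2=Z_3^2$, $W_1^2+W_3^2=Z_2^2$, $W_2^2+W_3^2=Z_1^2$, $W_1^2+W_2^2+W_3^2=C^2$. $\sigma$ is the involution with $\sigma(Z_3)=-Z_3$ fixing the other generators; the quotient $\mathcal B/\sigma$ has the $\mathbb Q$-structure $\mathrm{proj}(B^\sigma)$. $E=\mathrm{proj}\,\mathbb Q[a,b,c,d]\subset\mathbb P^3_{\mathbb Q}$ is the elliptic curve over $\mathbb Q$ with defining relations $a^2=c^2+d^2$, $b^2=c^2-d^2$ (generators of degree one). $H\cong\mathbb Z/2\mathbb Z\times\mathbb Z/2\mathbb Z$ is the group of automorphisms of $E$ generated by $$\tau(a,b,c,d)=(a,-b,c,d),\qquad\rho(a,b,c,d)=(a,b,-c,-d),$$ and it acts diagonally on $E\times E$. *)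

theory Defs
  imports "HOL-Analysis.Analysis"
begin

section \<open>Spaces with functions\<close>

text \<open>A space with functions is a topological space with, for every open set, a collection of
  complex-valued functions on it.  Functions are total; \<open>sect X U\<close> is used for open \<open>U\<close> only and
  depends only on the values on \<open>U\<close>.  Reduced complex spaces (with their holomorphic functions) and
  varieties over a subfield \<open>K\<close> of the complex numbers (with complex points, \<open>K\<close>-Zariski topology
  and \<open>K\<close>-regular functions) are described in this way.  A biholomorphic map is an isomorphism of the
  holomorphic structures; a map is defined over \<open>K\<close> if it is a morphism of the \<open>K\<close>-structures.\<close>

record 'p fun_space =
  base :: "'p topology"
  sect :: "'p set \<Rightarrow> ('p \<Rightarrow> complex) set"

definition space_morphism :: "'p fun_space \<Rightarrow> 'q fun_space \<Rightarrow> ('p \<Rightarrow> 'q) \<Rightarrow> bool" where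
  "space_morphism X Y \<phi> \<longleftrightarrow>
     continuous_map (base X) (base Y) \<phi> \<and>
     (\<forall>V f. openin (base Y) V \<and> f \<in> sect Y V \<longrightarrow>
        f \<circ> \<phi> \<in> sect X {x \<in> topspace (base X). \<phi> x \<in> V})"

definition space_isomorphism :: "'p fun_space \<Rightarrow> 'q fun_space \<Rightarrow> ('p \<Rightarrow> 'q) \<Rightarrow> bool" where
  "space_isomorphism X Y \<phi> \<longleftrightarrow>
     space_morphism X Y \<phi> \<and>
     (\<exists>\<psi>. space_morphism Y X \<psi> \<and>
        (\<forall>x \<in> topspace (base X). \<psi> (\<phi> x) = x) \<and>
        (\<forall>y \<in> topspace (base Y). \<phi> (\<psi> y) = y))"

definition quotient_topology :: "'p topology \<Rightarrow> ('p \<Rightarrow> 'q) \<Rightarrow> 'q topology" where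
  "quotient_topology T \<pi> =
     topology (\<lambda>U. U \<subseteq> \<pi> ` topspace T \<and> openin T {x \<in> topspace T. \<pi> x \<in> U})"

lemma openin_quotient_topology:
  "openin (quotient_topology T \<pi>) U \<longleftrightarrow>
     U \<subseteq> \<pi> ` topspace T \<and> openin T {x \<in> topspace T. \<pi> x \<in> U}"
proof -
  have "istopology (\<lambda>U. U \<subseteq> \<pi> ` topspace T \<and> openin T {x \<in> topspace T. \<pi> x \<in> U})"
    unfolding istopology_def
  proof (intro conjI allI impI)
    fix S U
    assume S: "S \<subseteq> \<pi> ` topspace T \<and> openin T {x \<in> topspace T. \<pi> x \<in> S}"
      and U: "U \<subseteq> \<pi> ` topspace T \<and> openin T {x \<in> topspace T. \<pi> x \<in> U}"
    have eq: "{x \<in> topspace T. \<pi> x \<in> S \<inter> U} =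
        {x \<in> topspace T. \<pi> x \<in> S} \<inter> {x \<in> topspace T. \<pi> x \<in> U}"
      by auto
    show "S \<inter> U \<subseteq> \<pi> ` topspace T" using S by auto
    show "openin T {x \<in> topspace T. \<pi> x \<in> S \<inter> U}"
      unfolding eq using S U by auto
  next
    fix \<K>
    assume *: "\<forall>U\<in>\<K>. U \<subseteq> \<pi> ` topspace T \<and> openin T {x \<in> topspace T. \<pi> x \<in> U}"
    have eq: "{x \<in> topspace T. \<pi> x \<in> \<Union>\<K>} = (\<Union>U\<in>\<K>. {x \<in> topspace T. \<pi> x \<in> U})"
      by auto
    show "\<Union>\<K> \<subseteq> \<pi> ` topspace T" using * by auto
    show "openin T {x \<in> topspace T. \<pi> x \<in> \<Union>\<K>}"
      unfolding eq using * by auto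
  qed
  then show ?thesis by (simp add: quotient_topology_def topology_inverse')
qed

lemma topspace_quotient_topology:
  "topspace (quotient_topology T \<pi>) = \<pi> ` topspace T"
proof -
  have eq: "{x \<in> topspace T. \<pi> x \<in> \<pi> ` topspace T} = topspace T"
    by auto
  have "openin (quotient_topology T \<pi>) (\<pi> ` topspace T)"
    unfolding openin_quotient_topology eq by simp
  then show ?thesis
    by (metis openin_quotient_topology openin_subset openin_topspace subset_antisym)
qed

text \<open>A function on the quotient is admissible iff its pullback is: for a quotient by a group these
  are the invariant functions upstairs.\<close>

definition quotient_space :: "'p fun_space \<Rightarrow> ('p \<Rightarrow> 'q) \<Rightarrow> 'q fun_space" where
  "quotient_space X \<pi> =
     \<lparr>base = quotient_topology (base X) \<pi>,
      sect = (\<lambda>U. {f. f \<circ> \<pi> \<in> sect X {x \<in> topspace (base X). \<pi> x \<in> U}})\<rparr>"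


section \<open>Complex-analytic and algebraic structures\<close>

text \<open>Holomorphic functions of several variables: Frechet differentiability with a complex-linear
  derivative.\<close>

definition holomorphic_cvec :: "(complex^'n \<Rightarrow> complex) \<Rightarrow> (complex^'n) set \<Rightarrow> bool" where
  "holomorphic_cvec h W \<longleftrightarrow>
     (\<forall>w\<in>W. \<exists>c :: complex^'n. (h has_derivative (\<lambda>x. \<Sum>i\<in>UNIV. c $ i * x $ i)) (at w))"

text \<open>The reduced analytic structure on a locally closed analytic subset of affine space.\<close>

definition hol_affine :: "(complex^'n) set \<Rightarrow> (complex^'n) fun_space" where
  "hol_affine S =
     \<lparr>base = top_of_set S,
      sect = (\<lambda>U. {f. \<forall>v\<in>U. \<exists>W h. open W \<and> v \<in> W \<and> holomorphic_cvec h W \<and>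
                      (\<forall>w \<in> W \<inter> U. f w = h w)})\<rparr>"

text \<open>Polynomials with coefficients in a subfield \<open>K\<close> of the complex numbers, as functions.\<close>

inductive_set poly_fun :: "complex set \<Rightarrow> (complex^'n \<Rightarrow> complex) set" for K :: "complex set" where
  const: "c \<in> K \<Longrightarrow> (\<lambda>v. c) \<in> poly_fun K"
| coord: "(\<lambda>v. v $ i) \<in> poly_fun K"
| add: "F \<in> poly_fun K \<Longrightarrow> G \<in> poly_fun K \<Longrightarrow> (\<lambda>v. F v + G v) \<in> poly_fun K"
| mult: "F \<in> poly_fun K \<Longrightarrow> G \<in> poly_fun K \<Longrightarrow> (\<lambda>v. F v * G v) \<in> poly_fun K"

definition forms :: "complex set \<Rightarrow> nat \<Rightarrow> (complex^'n \<Rightarrow> complex) set" where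
  "forms K d = {F \<in> poly_fun K. \<forall>s v. F (s *s v) = s ^ d * F v}"

text \<open>Homogeneous coordinates on a product of two projective spaces.\<close>

definition join :: "complex^'n::finite \<Rightarrow> complex^'m::finite \<Rightarrow> complex^('n + 'm)" where
  "join x y = (\<chi> i. case i of Inl j \<Rightarrow> x $ j | Inr k \<Rightarrow> y $ k)"

definition left :: "complex^('n::finite + 'm::finite) \<Rightarrow> complex^'n" where
  "left v = (\<chi> j. v $ Inl j)"

definition right :: "complex^('n::finite + 'm::finite) \<Rightarrow> complex^'m" where
  "right v = (\<chi> k. v $ Inr k)"

definition biforms :: "complex set \<Rightarrow> nat \<times> nat \<Rightarrow> (complex^('n::finite + 'm::finite) \<Rightarrow> complex) set" where
  "biforms K = (\<lambda>(d, e). {F \<in> poly_fun K. \<forall>s t x y.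
     F (join (s *s x) (t *s y)) = s ^ d * t ^ e * F (join x y)})"

text \<open>The points with homogeneous coordinates in \<open>S\<close> are given by \<open>q\<close>, and \<open>A w\<close> is the set of
  forms of weight \<open>w\<close>.  The topology is generated by the non-vanishing loci of forms, and the regular
  functions are locally quotients of two forms of equal weight, as usual for \<open>proj\<close> of a
  graded (or bigraded) ring.\<close>

definition alg_space ::
    "(complex^'n) set \<Rightarrow> (complex^'n \<Rightarrow> 'p) \<Rightarrow> ('w \<Rightarrow> (complex^'n \<Rightarrow> complex) set) \<Rightarrow> 'p fun_space" where
  "alg_space S q A =
     (let T = topology_generated_by {q ` {v \<in> S. F v \<noteq> 0} | F w. F \<in> A w} in
      \<lparr>base = T,
       sect = (\<lambda>U. {f. \<forall>p\<in>U. \<exists>N w. \<exists>F \<in> A w. \<exists>G \<in> A w.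
                 openin T N \<and> p \<in> N \<and> N \<subseteq> U \<and>
                 (\<forall>v\<in>S. q v \<in> N \<longrightarrow> G v \<noteq> 0 \<and> f (q v) = F v / G v)})\<rparr>)"

text \<open>A point of projective space is a one-dimensional subspace.  Linear maps act on points by taking
  images.\<close>

definition proj_point :: "complex^'n \<Rightarrow> (complex^'n) set" where
  "proj_point v = vec.span {v}"

inductive_set group_generated :: "('a \<Rightarrow> 'a) set \<Rightarrow> ('a \<Rightarrow> 'a) set" for A where
  unit: "id \<in> group_generated A"
| gen: "g \<in> A \<Longrightarrow> g \<in> group_generated A"
| comp: "g \<in> group_generated A \<Longrightarrow> h \<in> group_generated A \<Longrightarrow> g \<circ> h \<in> group_generated A"
| inverse: "g \<in> group_generated A \<Longrightarrow> inv g \<in> group_generated A"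

definition gauss_rationals :: "complex set" where
  "gauss_rationals = {z. Re z \<in> \<rat> \<and> Im z \<in> \<rat>}"


section \<open>The box variety and its quotient\<close>

text \<open>Homogeneous coordinates are numbered in the order Z1, Z2, Z3, W1, W2, W3, C.\<close>

definition box_cone :: "(complex^7) set" where
  "box_cone = {v. v \<noteq> 0 \<and>
     (v$4)^2 + (v$5)^2 = (v$3)^2 \<and>
     (v$4)^2 + (v$6)^2 = (v$2)^2 \<and>
     (v$5)^2 + (v$6)^2 = (v$1)^2 \<and>
     (v$4)^2 + (v$5)^2 + (v$6)^2 = (v$7)^2}"

definition box_sigma :: "complex^7 \<Rightarrow> complex^7" where
  "box_sigma v = (\<chi> i. if i = 3 then - v $ i else v $ i)"

definition hol_box :: "(complex^7) set fun_space" where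
  "hol_box = quotient_space (hol_affine box_cone) proj_point"

definition sigma_orbit :: "(complex^7) set \<Rightarrow> (complex^7) set set" where
  "sigma_orbit p = {g ` p | g. g \<in> group_generated {box_sigma}}"

definition hol_box_quotient :: "(complex^7) set set fun_space" where
  "hol_box_quotient = quotient_space hol_box sigma_orbit"

text \<open>The structure of \<open>proj\<close> of the ring of \<open>\<sigma>\<close>-invariants, with scalars extended from the rationals
  to \<open>K\<close>.  Elements of the coordinate ring of the box variety are represented by polynomials, and
  invariance is required in the coordinate ring, that is, on the cone.\<close>

definition alg_box_quotient :: "complex set \<Rightarrow> (complex^7) set set fun_space" where
  "alg_box_quotient K =
     alg_space box_cone (\<lambda>v. sigma_orbit (proj_point v))
       (\<lambda>d. {F \<in> forms K d. \<forall>v\<in>box_cone. F (box_sigma v) = F v})"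


section \<open>The elliptic curve and the quotient of its square\<close>

text \<open>Homogeneous coordinates are numbered in the order a, b, c, d.\<close>

definition E_cone :: "(complex^4) set" where
  "E_cone = {v. v \<noteq> 0 \<and> (v$1)^2 = (v$3)^2 + (v$4)^2 \<and> (v$2)^2 = (v$3)^2 - (v$4)^2}"

definition E_tau :: "complex^4 \<Rightarrow> complex^4" where
  "E_tau v = (\<chi> i. if i = 2 then - v $ i else v $ i)"

definition E_rho :: "complex^4 \<Rightarrow> complex^4" where
  "E_rho v = (\<chi> i. if i = 3 \<or> i = 4 then - v $ i else v $ i)"

definition EE_cone :: "(complex^(4 + 4)) set" where
  "EE_cone = {join x y | x y. x \<in> E_cone \<and> y \<in> E_cone}"

definition EE_point :: "complex^(4 + 4) \<Rightarrow> (complex^4) set \<times> (complex^4) set" where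
  "EE_point v = (proj_point (left v), proj_point (right v))"

definition hol_EE :: "((complex^4) set \<times> (complex^4) set) fun_space" where
  "hol_EE = quotient_space (hol_affine EE_cone) EE_point"

definition alg_EE :: "complex set \<Rightarrow> ((complex^4) set \<times> (complex^4) set) fun_space" where
  "alg_EE K = alg_space EE_cone EE_point (biforms K)"

definition H_orbit ::
    "(complex^4) set \<times> (complex^4) set \<Rightarrow> ((complex^4) set \<times> (complex^4) set) set" where
  "H_orbit = (\<lambda>(p, p'). {(g ` p, g ` p') | g. g \<in> group_generated {E_tau, E_rho}})"

definition hol_EE_quotient :: "((complex^4) set \<times> (complex^4) set) set fun_space" where
  "hol_EE_quotient = quotient_space hol_EE H_orbit"

definition alg_EE_quotient :: "complex set \<Rightarrow> ((complex^4) set \<times> (complex^4) set) set fun_space" where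
  "alg_EE_quotient K = quotient_space (alg_EE K) H_orbit"


text \<open>The two groups are the expected ones of order two and four.\<close>

lemma group_generated_sigma: "group_generated {box_sigma} = {id, box_sigma}"
proof -
  have s: "box_sigma (box_sigma v) = v" for v
    by (simp add: box_sigma_def vec_eq_iff)
  have i: "inv box_sigma = box_sigma" "inv (id :: complex^7 \<Rightarrow> _) = id"
    by (rule inv_unique_comp; simp add: s fun_eq_iff)+
  have "g \<in> {id, box_sigma}" if "g \<in> group_generated {box_sigma}" for g
    using that
  proof induction
    case (comp g h)
    then show ?case by (elim insertE emptyE; simp add: s fun_eq_iff)
  next
    case (inverse g)
    then show ?case using i by (elim insertE emptyE) simp_all
  qed auto
  then show ?thesis by (auto intro: group_generated.intros)
qed

lemma group_generated_H:
  "group_generated {E_tau, E_rho} = {id, E_tau, E_rho, E_tau \<circ> E_rho}"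
proof -
  have c: "E_tau (E_tau v) = v" "E_rho (E_rho v) = v" "E_rho (E_tau v) = E_tau (E_rho v)" for v
    by (simp_all add: E_tau_def E_rho_def vec_eq_iff)
  have i: "inv E_tau = E_tau" "inv E_rho = E_rho" "inv (E_tau \<circ> E_rho) = E_tau \<circ> E_rho"
    "inv (id :: complex^4 \<Rightarrow> _) = id"
    by (rule inv_unique_comp; simp add: c fun_eq_iff)+
  have "g \<in> {id, E_tau, E_rho, E_tau \<circ> E_rho}" if "g \<in> group_generated {E_tau, E_rho}" for g
    using that
  proof induction
    case (comp g h)
    then show ?case by (elim insertE emptyE; simp add: c fun_eq_iff)
  next
    case (inverse g)
    then show ?case using i by (elim insertE emptyE; simp only: insert_iff simp_thms)
  qed auto
  then show ?thesis
    by (auto simp del: comp_apply intro: group_generated.intros)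
qed

end

theory Submission
  imports Defs "HOL-Complex_Analysis.Cauchy_Integral_Formula"
begin

text \<open>In terms of \<open>((a, b, c, d), (a', b', c', d')) \<in> E \<times> E\<close> the map is
  \<open>Z\<^sub>1 = cc' + dd'\<close>, \<open>Z\<^sub>2 = cc' - dd'\<close>, \<open>W\<^sub>1 = cd' - dc'\<close>, \<open>W\<^sub>2 = cd' + dc'\<close>, \<open>W\<^sub>3 = bb'\<close>, \<open>C = aa'\<close>,
  with \<open>Z\<^sub>3\<close> determined up to sign by \<open>Z\<^sub>3\<^sup>2 = W\<^sub>1\<^sup>2 + W\<^sub>2\<^sup>2\<close>.  Conversely, the first four coordinates
  determine the rank one tensor \<open>(c, d) \<otimes> (c', d')\<close>, hence both factors up to scalars; then \<open>a\<^sup>2, a'\<^sup>2, aa'\<close>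
  and \<open>b\<^sup>2, b'\<^sup>2, bb'\<close> are known, which determines \<open>(a, a')\<close> and \<open>(b, b')\<close> up to a common sign each.
  These two signs account exactly for the group \<open>H\<close>.

  The inverse is holomorphic also at the singular points because a function that is invariant under
  \<open>(a, a') \<mapsto> (-a, -a')\<close> is a holomorphic function of \<open>a\<^sup>2, aa', a'\<^sup>2\<close>, and likewise for \<open>b\<close>.
  Forms on the box variety that are invariant under \<open>\<sigma>\<close> are even in \<open>Z\<^sub>3\<close>, so they pull back to
  polynomials.\<close>

section \<open>Holomorphic functions of several variables\<close>

text \<open>The relations give \<open>Z1^2 - Z2^2 = W2^2 - W1^2\<close>, that is
  \<open>(Z1 + Z2) (Z1 - Z2) = (W2 + W1) (W2 - W1)\<close>. The halves of these four linear forms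
  are thus the entries of a 2 x 2 matrix of determinant zero, and this matrix is the tensor.
  Moreover \<open>C^2 = Z1^2 + W1^2\<close> and \<open>W3^2 = Z1^2 - W2^2\<close> factor on it as
  \<open>(c^2 + d^2) (c'^2 + d'^2)\<close> and \<open>(c^2 - d^2) (c'^2 - d'^2)\<close>, which is
  where the equations of \<open>E\<close> come from. The obstacle is that neither direction comes
  with a continuous map between the cones: \<open>Z3\<close>, and conversely
  \<open>a, b, a', b'\<close>, are square roots of functions with zeros. Both maps are therefore
  obtained from one correspondence \<open>over\<close> between the cones; it suffices that nearby
  points have nearby partners and that germs of functions on orbits can be transferred. A function
  on a cone is locally the restriction of an ambient holomorphic germ, which need not be invariant
  even if the restriction is. It is averaged over those sign changes that fix the base point, and
  only then rewritten in terms of squares.\<close>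

definition cdiff :: "(complex^'n \<Rightarrow> complex) \<Rightarrow> complex^'n \<Rightarrow> bool" where
  "cdiff h w \<longleftrightarrow> (\<exists>D. (h has_derivative D) (at w) \<and> (\<forall>s x. D (s *s x) = s * D x))"

lemma cdiffI:
  "(h has_derivative D) (at w) \<Longrightarrow> (\<And>s x. D (s *s x) = s * D x) \<Longrightarrow> cdiff h w"
  unfolding cdiff_def by blast

text \<open>The coefficients are the values of the derivative on the standard basis. The
  coordinate-free form \<open>cdiff\<close> makes closure under sums, products and composition
  immediate; this lemma returns to the form used by \<open>holomorphic_cvec\<close>.\<close>

lemma cdiff_iff_coefficients:
  fixes h :: "complex^'n \<Rightarrow> complex"
  shows "cdiff h w \<longleftrightarrow> (\<exists>c :: complex^'n. (h has_derivative (\<lambda>x. \<Sum>i\<in>UNIV. c $ i * x $ i)) (at w))"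
proof
  assume "cdiff h w"
  then obtain D where D: "(h has_derivative D) (at w)" "\<And>s x. D (s *s x) = s * D x"
    unfolding cdiff_def by blast
  interpret D: bounded_linear D
    using D(1) by (rule has_derivative_bounded_linear)
  have "D x = (\<Sum>i\<in>UNIV. (\<chi> i. D (axis i 1)) $ i * x $ i)" for x
  proof -
    have "x = (\<Sum>i\<in>UNIV. x $ i *s axis i 1)"
      by (simp add: vec_eq_iff axis_def if_distrib [of "\<lambda>a. _ * a"] cong: if_cong)
    then have "D x = D (\<Sum>i\<in>UNIV. x $ i *s axis i 1)" by simp
    also have "\<dots> = (\<Sum>i\<in>UNIV. x $ i * D (axis i 1))"
      by (simp add: D.sum D(2))
    finally show ?thesis by (simp add: mult.commute)
  qed
  then have "D = (\<lambda>x. \<Sum>i\<in>UNIV. (\<chi> i. D (axis i 1)) $ i * x $ i)" by blast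
  with D(1) show "\<exists>c :: complex^'n. (h has_derivative (\<lambda>x. \<Sum>i\<in>UNIV. c $ i * x $ i)) (at w)"
    by metis
next
  assume "\<exists>c :: complex^'n. (h has_derivative (\<lambda>x. \<Sum>i\<in>UNIV. c $ i * x $ i)) (at w)"
  then show "cdiff h w"
    by (auto intro!: cdiffI simp: sum_distrib_left mult_ac)
qed

lemma holomorphic_cvec_iff_cdiff: "holomorphic_cvec h W \<longleftrightarrow> (\<forall>w\<in>W. cdiff h w)"
  unfolding holomorphic_cvec_def cdiff_iff_coefficients ..

lemma cdiff_const: "cdiff (\<lambda>w. c) w"
  by (rule cdiffI [where D = "\<lambda>x. 0"]) auto

lemma cdiff_coord: "cdiff (\<lambda>w. w $ i) w"
  by (rule cdiffI [where D = "\<lambda>x. x $ i"])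
    (auto intro!: bounded_linear_imp_has_derivative bounded_linear_vec_nth)

lemma cdiff_add: "cdiff f w \<Longrightarrow> cdiff g w \<Longrightarrow> cdiff (\<lambda>w. f w + g w) w"
  unfolding cdiff_def
  by (elim exE conjE, rule exI, rule conjI, erule (1) has_derivative_add)
    (simp add: algebra_simps)

lemma cdiff_mult: "cdiff f w \<Longrightarrow> cdiff g w \<Longrightarrow> cdiff (\<lambda>w. f w * g w) w"
  unfolding cdiff_def
  by (elim exE conjE, rule exI, rule conjI, erule (1) has_derivative_mult)
    (simp add: algebra_simps)

lemma cdiff_compose_field:
  assumes "cdiff f w" "(\<phi> has_field_derivative d) (at (f w))"
  shows "cdiff (\<lambda>w. \<phi> (f w)) w"
proof -
  obtain D where D: "(f has_derivative D) (at w)" "\<And>s x. D (s *s x) = s * D x"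
    using assms(1) unfolding cdiff_def by blast
  have "((\<lambda>w. \<phi> (f w)) has_derivative (\<lambda>x. d * D x)) (at w)"
    using has_derivative_compose [OF D(1), of \<phi> "(*) d"] assms(2)
    by (simp add: has_field_derivative_def)
  then show ?thesis by (rule cdiffI) (simp add: D(2))
qed

lemma has_derivative_vecI:
  fixes g :: "'a::real_normed_vector \<Rightarrow> complex^'n"
  assumes "\<And>j. ((\<lambda>w. g w $ j) has_derivative (\<lambda>x. D x $ j)) (at w)"
  shows "(g has_derivative D) (at w)"
proof -
  have ax: "bounded_linear (axis j :: complex \<Rightarrow> complex^'n)" for j
    by (rule bounded_linearI' [OF _ _]) (auto simp: axis_def vec_eq_iff)
  have s: "x = (\<Sum>j\<in>UNIV. axis j (x $ j))" for x :: "complex^'n"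
    by (simp add: vec_eq_iff axis_def)
  have "((\<lambda>w. \<Sum>j\<in>UNIV. axis j (g w $ j)) has_derivative (\<lambda>x. \<Sum>j\<in>UNIV. axis j (D x $ j))) (at w)"
    by (intro has_derivative_sum bounded_linear.has_derivative [OF ax] assms)
  then show ?thesis
    by (simp flip: s)
qed

lemma cdiff_compose:
  fixes g :: "complex^'m \<Rightarrow> complex^'n"
  assumes "cdiff h (g w)" "\<And>j. cdiff (\<lambda>w. g w $ j) w"
  shows "cdiff (\<lambda>w. h (g w)) w"
proof -
  obtain Dh where Dh: "(h has_derivative Dh) (at (g w))" "\<And>s x. Dh (s *s x) = s * Dh x"
    using assms(1) unfolding cdiff_def by blast
  have "\<forall>j. \<exists>D. ((\<lambda>w. g w $ j) has_derivative D) (at w) \<and> (\<forall>s x. D (s *s x) = s * D x)"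
    using assms(2) unfolding cdiff_def by blast
  then obtain D where D: "\<And>j. ((\<lambda>w. g w $ j) has_derivative D j) (at w)"
      "\<And>j s x. D j (s *s x) = s * D j x"
    by metis
  have "(g has_derivative (\<lambda>x. \<chi> j. D j x)) (at w)"
    by (rule has_derivative_vecI) (simp add: D(1))
  then have "((\<lambda>w. h (g w)) has_derivative (\<lambda>x. Dh (\<chi> j. D j x))) (at w)"
    by (rule has_derivative_compose) (rule Dh(1))
  then show ?thesis
  proof (rule cdiffI)
    fix s x
    have "(\<chi> j. D j (s *s x)) = s *s (\<chi> j. D j x)"
      by (simp add: vec_eq_iff D(2))
    then show "Dh (\<chi> j. D j (s *s x)) = s * Dh (\<chi> j. D j x)"
      by (simp add: Dh(2))
  qed
qed

lemma cdiff_imp_isCont: "cdiff h w \<Longrightarrow> isCont h w"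
  unfolding cdiff_def using has_derivative_continuous by blast

text \<open>An eventual property of the full neighbourhood filter, base point included, lets
  finitely many germs be combined without naming and intersecting open sets.\<close>

definition hol_at :: "(complex^'n \<Rightarrow> complex) \<Rightarrow> complex^'n \<Rightarrow> bool" where
  "hol_at h w \<longleftrightarrow> eventually (cdiff h) (nhds w)"

lemma hol_at_iff_open: "hol_at h w \<longleftrightarrow> (\<exists>W. open W \<and> w \<in> W \<and> holomorphic_cvec h W)"
  unfolding hol_at_def eventually_nhds holomorphic_cvec_iff_cdiff by blast

lemma hol_at_const: "hol_at (\<lambda>w. c) w"
  unfolding hol_at_def by (intro always_eventually allI cdiff_const)

lemma hol_at_coord: "hol_at (\<lambda>w. w $ i) w"
  unfolding hol_at_def by (intro always_eventually allI cdiff_coord)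

lemma hol_at_add: "hol_at f w \<Longrightarrow> hol_at g w \<Longrightarrow> hol_at (\<lambda>w. f w + g w) w"
  unfolding hol_at_def by (erule (1) eventually_elim2) (rule cdiff_add)

lemma hol_at_mult: "hol_at f w \<Longrightarrow> hol_at g w \<Longrightarrow> hol_at (\<lambda>w. f w * g w) w"
  unfolding hol_at_def by (erule (1) eventually_elim2) (rule cdiff_mult)

lemma hol_at_minus: "hol_at f w \<Longrightarrow> hol_at (\<lambda>w. - f w) w"
  using hol_at_mult [OF hol_at_const [of "-1"]] by fastforce

lemma hol_at_diff: "hol_at f w \<Longrightarrow> hol_at g w \<Longrightarrow> hol_at (\<lambda>w. f w - g w) w"
  using hol_at_add [OF _ hol_at_minus] by fastforce

lemma hol_at_power: "hol_at f w \<Longrightarrow> hol_at (\<lambda>w. f w ^ n) w"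
  by (induction n) (simp_all add: hol_at_const hol_at_mult)

lemma hol_at_imp_isCont: "hol_at h w \<Longrightarrow> isCont h w"
  unfolding hol_at_def by (drule eventually_nhds_x_imp_x) (rule cdiff_imp_isCont)

lemma isCont_vecI:
  fixes g :: "'a::t2_space \<Rightarrow> complex^'n"
  shows "(\<And>j. isCont (\<lambda>w. g w $ j) w) \<Longrightarrow> isCont g w"
  unfolding isCont_def by (rule vec_tendstoI)

lemma eventually_nhds_isCont:
  assumes "isCont g w" "eventually P (nhds (g w))"
  shows "eventually (\<lambda>w. P (g w)) (nhds w)"
  using assms
  by (metis (mono_tags, lifting) eventually_compose_filterlim isCont_def tendsto_at_iff_tendsto_nhds)

lemma hol_at_compose_field:
  assumes "hol_at f w" "\<phi> holomorphic_on U" "open U" "f w \<in> U"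
  shows "hol_at (\<lambda>w. \<phi> (f w)) w"
proof -
  have "eventually (\<lambda>z. z \<in> U) (nhds (f w))"
    using assms(3,4) by (rule eventually_nhds_in_open)
  then have "eventually (\<lambda>w. f w \<in> U) (nhds w)"
    by (rule eventually_nhds_isCont [OF hol_at_imp_isCont [OF assms(1)]])
  with assms(1) show ?thesis
    unfolding hol_at_def
  proof (rule eventually_elim2)
    fix w assume "cdiff f w" "f w \<in> U"
    then show "cdiff (\<lambda>w. \<phi> (f w)) w"
      using cdiff_compose_field holomorphic_derivI [OF assms(2,3)] by blast
  qed
qed

lemma hol_at_divide:
  assumes "hol_at f w" "hol_at g w" "g w \<noteq> 0"
  shows "hol_at (\<lambda>w. f w / g w) w"
proof -
  have "hol_at (\<lambda>w. inverse (g w)) w"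
    by (rule hol_at_compose_field [where U = "- {0}"])
      (use assms in \<open>auto intro!: holomorphic_intros\<close>)
  then show ?thesis
    using hol_at_mult [OF assms(1)] by (simp add: divide_inverse)
qed

lemma hol_at_compose:
  fixes g :: "complex^'m \<Rightarrow> complex^'n"
  assumes "hol_at h (g w)" "\<And>j. hol_at (\<lambda>w. g w $ j) w"
  shows "hol_at (\<lambda>w. h (g w)) w"
proof -
  have "isCont g w"
    by (intro isCont_vecI hol_at_imp_isCont assms(2))
  then have "eventually (\<lambda>w. cdiff h (g w)) (nhds w)"
    using assms(1) unfolding hol_at_def by (rule eventually_nhds_isCont)
  moreover have "eventually (\<lambda>w. \<forall>j. cdiff (\<lambda>w. g w $ j) w) (nhds w)"
    using assms(2) unfolding hol_at_def by (simp add: eventually_all_finite)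
  ultimately show ?thesis
    unfolding hol_at_def by eventually_elim (auto intro: cdiff_compose)
qed

lemmas hol_at_intros = hol_at_const hol_at_coord hol_at_add hol_at_mult hol_at_minus hol_at_diff
  hol_at_power hol_at_divide

section \<open>Cauchy's formula in one coordinate, and integrals depending holomorphically on
  parameters\<close>

lemma vec_derivative_coefficient:
  fixes h :: "complex^'n \<Rightarrow> complex" and c :: "complex^'n"
  assumes "(h has_derivative (\<lambda>x. \<Sum>i\<in>UNIV. c $ i * x $ i)) (at w)"
  shows "((\<lambda>\<zeta>. h (w + axis j \<zeta>)) has_field_derivative c $ j) (at 0)"
proof -
  have "((\<lambda>\<zeta>. w + axis j \<zeta>) has_derivative (\<lambda>\<zeta>. axis j \<zeta>)) (at (0::complex))"
  proof (rule has_derivative_vecI)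
    show "((\<lambda>\<zeta>. (w + axis j \<zeta>) $ k) has_derivative (\<lambda>\<zeta>. axis j \<zeta> $ k)) (at (0::complex))" for k
      by (cases "k = j") (auto simp: axis_def intro!: derivative_eq_intros)
  qed
  moreover have "(h has_derivative (\<lambda>x. \<Sum>i\<in>UNIV. c $ i * x $ i)) (at (w + axis j 0))"
    using assms by (simp add: axis_def vec_lambda_eta zero_vec_def [symmetric] cong: if_cong)
  ultimately have "((\<lambda>\<zeta>. h (w + axis j \<zeta>)) has_derivative
      (\<lambda>\<zeta>. \<Sum>i\<in>UNIV. c $ i * axis j \<zeta> $ i)) (at 0)"
    by (rule has_derivative_compose)
  moreover have "(\<Sum>i\<in>UNIV. c $ i * axis j \<zeta> $ i) = c $ j * \<zeta>" for \<zeta>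
    by (simp add: axis_def if_distrib [of "\<lambda>a. _ * a"] cong: if_cong)
  ultimately show ?thesis
    by (simp add: has_field_derivative_def)
qed

lemma circlepath_0: "circlepath 0 r t = of_real r * exp (2 * of_real pi * \<i> * of_real t)"
  by (simp add: circlepath)

lemma contour_integral_circlepath_0:
  "contour_integral (circlepath 0 r) f =
     2 * of_real pi * \<i> * integral {0..1} (\<lambda>t. f (circlepath 0 r t) * circlepath 0 r t)"
proof -
  have "contour_integral (circlepath 0 r) f =
      integral {0..1} (\<lambda>t. 2 * of_real pi * \<i> * (f (circlepath 0 r t) * circlepath 0 r t))"
    unfolding contour_integral_integral vector_derivative_circlepath circlepath_0
    by (simp add: mult_ac)
  then show ?thesis by simp
qed

lemma norm_circlepath_0: "r \<ge> 0 \<Longrightarrow> norm (circlepath 0 r t) = r"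
  by (simp add: circlepath_0 norm_mult)

lemma continuous_on_axis [continuous_intros]:
  fixes f :: "'a::topological_space \<Rightarrow> complex"
  shows "continuous_on S f \<Longrightarrow> continuous_on S (\<lambda>x. axis j (f x) :: complex^'n)"
  unfolding axis_def
proof (rule continuous_on_vec_lambda)
  show "continuous_on S f \<Longrightarrow> continuous_on S (\<lambda>x. if i = j then f x else 0)" for i
    by (cases "i = j") auto
qed

lemma continuous_on_circlepath_0 [continuous_intros]:
  assumes "continuous_on S f"
  shows "continuous_on S (\<lambda>x. circlepath 0 r (f x))"
  unfolding circlepath_0 by (intro continuous_intros assms)

lemma cdiff_axis_holomorphic:
  fixes K :: "complex^'n \<Rightarrow> complex"
  assumes "\<And>\<zeta>. \<zeta> \<in> S \<Longrightarrow> cdiff K (w + axis j \<zeta>)"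
  shows "(\<lambda>\<zeta>. K (w + axis j \<zeta>)) holomorphic_on S"
proof (rule holomorphic_onI)
  fix \<zeta> assume "\<zeta> \<in> S"
  with assms obtain c :: "complex^'n" where
    "(K has_derivative (\<lambda>x. \<Sum>i\<in>UNIV. c $ i * x $ i)) (at (w + axis j \<zeta>))"
    unfolding cdiff_iff_coefficients by blast
  then have "((\<lambda>\<xi>. K (w + axis j \<zeta> + axis j \<xi>)) has_field_derivative c $ j) (at 0)"
    by (rule vec_derivative_coefficient)
  moreover have "w + axis j \<zeta> + axis j \<xi> = w + axis j (\<zeta> + \<xi>)" for \<xi>
    by (simp add: vec_eq_iff axis_def)
  ultimately have "((\<lambda>\<xi>. K (w + axis j \<xi>)) has_field_derivative c $ j) (at \<zeta>)"
    using DERIV_shift [of "\<lambda>\<xi>. K (w + axis j \<xi>)" "c $ j" 0 \<zeta>] by (simp add: add_ac)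
  then show "(\<lambda>\<zeta>. K (w + axis j \<zeta>)) field_differentiable at \<zeta> within S"
    using field_differentiable_at_within field_differentiable_def by blast
qed

lemma norm_axis_complex [simp]: "norm (axis j (z::complex) :: complex^'n) = norm z"
  by (simp add: norm_vec_def L2_set_def axis_def if_distrib [of norm] if_distrib [of "\<lambda>a. a ^ 2"] cong: if_cong)

text \<open>Cauchy's formula for the first derivative of a slice along the axis \<open>j\<close>.
  Its use is that it expresses the derivative of \<open>K\<close> by values of \<open>K\<close>
  alone, so that continuity of \<open>K\<close> passes to its derivative.\<close>

lemma Cauchy_coefficient:
  fixes K :: "complex^'n \<Rightarrow> complex" and c :: "complex^'n"
  assumes "r > 0" "\<And>x. x \<in> cball w r \<Longrightarrow> cdiff K x"
    and c: "(K has_derivative (\<lambda>x. \<Sum>i\<in>UNIV. c $ i * x $ i)) (at w)"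
  shows "c $ j = integral {0..1} (\<lambda>u. K (w + axis j (circlepath 0 r u)) / circlepath 0 r u)"
proof -
  let ?f = "\<lambda>\<zeta>. K (w + axis j \<zeta>)"
  have hol: "?f holomorphic_on cball 0 r"
    by (rule cdiff_axis_holomorphic) (auto intro!: assms(2) simp: dist_norm)
  have d: "(?f has_field_derivative (1 / (2 * of_real pi * \<i>) *
      contour_integral (circlepath 0 r) (\<lambda>u. ?f u / (u - 0)^2))) (at 0)"
    by (rule Cauchy_derivative_integral_circlepath)
      (use \<open>r > 0\<close> hol in \<open>auto intro: holomorphic_on_imp_continuous_on holomorphic_on_subset\<close>)
  have "c $ j = 1 / (2 * of_real pi * \<i>) * contour_integral (circlepath 0 r) (\<lambda>u. ?f u / (u - 0)^2)"
    using vec_derivative_coefficient [OF c] d by (rule DERIV_unique)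
  \<comment> \<open>The exponential parametrization turns the differential into 2 pi i times the
    point of the circle times \<open>du\<close>: the constant cancels and one power of the
    denominator disappears.\<close>
  also have "\<dots> = integral {0..1} (\<lambda>u. ?f (circlepath 0 r u) / (circlepath 0 r u)^2 * circlepath 0 r u)"
    unfolding contour_integral_circlepath_0 by simp
  also have "\<dots> = integral {0..1} (\<lambda>u. ?f (circlepath 0 r u) / circlepath 0 r u)"
    by (intro integral_cong) (simp add: power2_eq_square)
  finally show ?thesis .
qed

text \<open>Differentiation under the integral sign needs a derivative that is jointly continuous in
  \<open>w\<close> and \<open>t\<close>, while only \<open>K\<close> is assumed to be so.
  \<open>Cauchy_coefficient\<close> writes the partial derivatives as integrals of \<open>K\<close>
  over circles, and these are jointly continuous.\<close>

lemma holomorphic_cvec_integral: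
  fixes K :: "complex^'n \<Rightarrow> real \<Rightarrow> complex"
  assumes "open U" and cont: "continuous_on (U \<times> {0..1}) (\<lambda>(w, t). K w t)"
    and hol: "\<And>t. t \<in> {0..1} \<Longrightarrow> holomorphic_cvec (\<lambda>w. K w t) U"
  shows "holomorphic_cvec (\<lambda>w. integral {0..1} (K w)) U"
  unfolding holomorphic_cvec_iff_cdiff
proof
  fix w0 assume "w0 \<in> U"
  with \<open>open U\<close> obtain e where e: "e > 0" "cball w0 e \<subseteq> U"
    by (meson open_contains_cball)
  \<comment> \<open>Circles of radius \<open>r\<close> about any point of \<open>ball w0 r\<close>
    then stay inside \<open>cball w0 e\<close>, hence inside \<open>U\<close>.\<close>
  define r where "r = e / 2"
  have r: "r > 0" using e by (simp add: r_def)
  have sub: "cball w r \<subseteq> U" if "w \<in> ball w0 r" for w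
  proof -
    have "x \<in> cball w0 e" if "x \<in> cball w r" for x
      using that \<open>w \<in> ball w0 r\<close> dist_triangle [of w0 x w] by (simp add: r_def)
    with e show ?thesis by blast
  qed
  define c where "c w t j = integral {0..1} (\<lambda>u. K (w + axis j (circlepath 0 r u)) t / circlepath 0 r u)"
    for w t j
  \<comment> \<open>The derivative is packaged as a bounded operator because
    \<open>leibniz_rule\<close> integrates an operator-valued function.\<close>
  define Dx where "Dx w t = (\<Sum>j\<in>UNIV. blinfun_mult_right (c w t j) o\<^sub>L Blinfun (\<lambda>x::complex^'n. x $ j))"
    for w t
  have Dx: "blinfun_apply (Dx w t) x = (\<Sum>j\<in>UNIV. c w t j * x $ j)" for w t x
    by (simp add: Dx_def blinfun.sum_left bounded_linear_Blinfun_apply bounded_linear_vec_nth)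
  have ccont: "continuous_on (ball w0 r \<times> {0..1}) (\<lambda>p. c (fst p) (snd p) j)" for j
  proof -
    have "continuous_on ((ball w0 r \<times> {0..1}) \<times> {0..1::real})
        (\<lambda>q. (\<lambda>(w, t). K w t) (fst (fst q) + axis j (circlepath 0 r (snd q)), snd (fst q)))"
    proof (rule continuous_on_compose2 [OF cont])
      show "continuous_on ((ball w0 r \<times> {0..1}) \<times> {0..1::real})
          (\<lambda>q. (fst (fst q) + axis j (circlepath 0 r (snd q)), snd (fst q)))"
        by (intro continuous_intros)
      show "(\<lambda>q. (fst (fst q) + axis j (circlepath 0 r (snd q)), snd (fst q))) `
          ((ball w0 r \<times> {0..1}) \<times> {0..1}) \<subseteq> U \<times> {0..1}"
        using r sub by (force simp: norm_circlepath_0 dist_norm)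
    qed
    then have "continuous_on ((ball w0 r \<times> {0..1}) \<times> cbox 0 (1::real))
        (\<lambda>(p, u). K (fst p + axis j (circlepath 0 r u)) (snd p) / circlepath 0 r u)"
      unfolding case_prod_unfold cbox_interval
      by (intro continuous_intros) (use r in \<open>auto simp: circlepath_0\<close>)
    from integral_continuous_on_param [OF this] show ?thesis
      by (simp add: c_def cbox_interval)
  qed
  have der: "((\<lambda>w. K w t) has_derivative blinfun_apply (Dx w t)) (at w)"
    if "w \<in> ball w0 r" "t \<in> {0..1}" for w t
  proof -
    have k: "cdiff (\<lambda>w. K w t) x" if "x \<in> cball w r" for x
      using hol [OF \<open>t \<in> _\<close>] sub [OF \<open>w \<in> _\<close>] that unfolding holomorphic_cvec_iff_cdiff by blast
    then have "cdiff (\<lambda>w. K w t) w" using r by simp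
    then obtain b :: "complex^'n" where
      b: "((\<lambda>w. K w t) has_derivative (\<lambda>x. \<Sum>i\<in>UNIV. b $ i * x $ i)) (at w)"
      unfolding cdiff_iff_coefficients by blast
    have "b $ j = c w t j" for j
      unfolding c_def using r k b by (rule Cauchy_coefficient)
    then have "blinfun_apply (Dx w t) = (\<lambda>x. \<Sum>i\<in>UNIV. b $ i * x $ i)"
      by (simp add: fun_eq_iff Dx)
    with b show ?thesis by simp
  qed
  have Dcont: "continuous_on (ball w0 r \<times> {0..1}) (\<lambda>(w, t). Dx w t)"
    unfolding Dx_def case_prod_unfold by (intro continuous_intros ccont)
  have Dint: "(\<lambda>t. Dx w0 t) integrable_on {0..1}"
  proof (rule integrable_continuous_interval)
    have "continuous_on {0..1} (\<lambda>t. (w0, t))"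
      by (intro continuous_intros)
    moreover have "(\<lambda>t. (w0, t)) ` {0..1} \<subseteq> ball w0 r \<times> {0..1}"
      using r by auto
    ultimately show "continuous_on {0..1} (\<lambda>t. Dx w0 t)"
      using continuous_on_compose2 [OF Dcont] by fastforce
  qed
  have "((\<lambda>w. integral (cbox 0 1) (K w)) has_derivative blinfun_apply (integral (cbox 0 1) (Dx w0)))
      (at w0 within ball w0 r)"
  proof (rule leibniz_rule)
    fix w and t :: real
    assume "w \<in> ball w0 r" "t \<in> cbox 0 1"
    then show "((\<lambda>w. K w t) has_derivative blinfun_apply (Dx w t)) (at w within ball w0 r)"
      unfolding cbox_interval by (rule has_derivative_at_withinI [OF der])
  next
    fix w assume w: "w \<in> ball w0 r"
    have "continuous_on {0..1} (\<lambda>t. (w, t))"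
      by (intro continuous_intros)
    moreover have "(\<lambda>t. (w, t)) ` {0..1} \<subseteq> U \<times> {0..1}"
      using r sub [OF w] by (auto simp: subset_iff)
    ultimately have "continuous_on {0..1} (K w)"
      using continuous_on_compose2 [OF cont] by fastforce
    then show "K w integrable_on cbox 0 1"
      unfolding cbox_interval by (rule integrable_continuous_interval)
  next
    show "continuous_on (ball w0 r \<times> cbox 0 1) (\<lambda>(w, t). Dx w t)"
      using Dcont by (simp only: cbox_interval)
    show "w0 \<in> ball w0 r" using r by simp
  qed (rule convex_ball)
  then have "((\<lambda>w. integral {0..1} (K w)) has_derivative blinfun_apply (integral {0..1} (Dx w0))) (at w0)"
    using r unfolding cbox_interval by (simp add: at_within_open [of w0 "ball w0 r"])
  then show "cdiff (\<lambda>w. integral {0..1} (K w)) w0"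
  proof (rule cdiffI)
    fix s x
    have "(\<Sum>j\<in>UNIV. c w0 t j * (s *s x) $ j) = s * (\<Sum>j\<in>UNIV. c w0 t j * x $ j)" for t
      by (simp add: sum_distrib_left mult_ac)
    then show "blinfun_apply (integral {0..1} (Dx w0)) (s *s x) = s * blinfun_apply (integral {0..1} (Dx w0)) x"
      unfolding blinfun_apply_integral [OF Dint] Dx
      by simp
  qed
qed

section \<open>Functions of squares\<close>

lemma hol_at_iff_holomorphic_cvec:
  "open W \<Longrightarrow> holomorphic_cvec h W \<longleftrightarrow> (\<forall>w\<in>W. hol_at h w)"
  unfolding hol_at_iff_open holomorphic_cvec_iff_cdiff by blast

definition upd :: "complex^'n \<Rightarrow> 'n \<Rightarrow> complex \<Rightarrow> complex^'n" where
  "upd w i t = (\<chi> k. if k = i then t else w $ k)"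

lemma upd_nth: "upd w i t $ k = (if k = i then t else w $ k)"
  by (simp add: upd_def)

lemma upd_0_add_axis: "upd w i 0 + axis i t = upd w i t"
  by (simp add: vec_eq_iff upd_nth axis_def)

lemma upd_same [simp]: "upd w i (w $ i) = w"
  by (simp add: vec_eq_iff upd_nth)

lemma upd_upd [simp]: "upd (upd w i s) i t = upd w i t"
  by (simp add: vec_eq_iff upd_nth)

text \<open>Emptying the slot \<open>i\<close> cannot increase the distance to \<open>w0\<close>,
  which vanishes there; filling it with \<open>t\<close> costs at most
  \<open>norm t\<close>.\<close>

lemma dist_upd_le:
  assumes "w0 $ i = 0"
  shows "dist w0 (upd w i t) \<le> dist w0 w + norm t"
proof -
  have "norm (upd (w - w0) i 0) \<le> norm (w - w0)"
    unfolding norm_vec_def by (rule L2_set_mono) (simp_all add: upd_nth)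
  moreover have "upd w i t - w0 = upd (w - w0) i 0 + axis i t"
    using assms by (simp add: vec_eq_iff upd_nth axis_def)
  ultimately have "norm (upd w i t - w0) \<le> norm (w - w0) + norm t"
    by (metis add_mono_thms_linordered_semiring(3) norm_axis_complex norm_triangle_le)
  then show ?thesis by (simp add: dist_norm norm_minus_commute)
qed

lemma continuous_on_upd:
  fixes f :: "'a::topological_space \<Rightarrow> complex^'n"
  assumes "continuous_on S f" "continuous_on S g"
  shows "continuous_on S (\<lambda>x. upd (f x) i (g x))"
  unfolding upd_def
proof (rule continuous_on_vec_lambda)
  show "continuous_on S (\<lambda>x. if k = i then g x else f x $ k)" for k
    using assms by (cases "k = i") (auto intro!: continuous_intros)
qed

lemma hol_at_upd:
  fixes f :: "complex^'m \<Rightarrow> complex^'n"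
  assumes "\<And>k. hol_at (\<lambda>w. f w $ k) w" "hol_at g w"
  shows "hol_at (\<lambda>w. upd (f w) i (g w) $ k) w"
  using assms by (cases "k = i") (simp_all add: upd_nth)

text \<open>Both coefficients in the division by a square have this shape, with \<open>m\<close> a
  power of the point on the circle. Inside the integral the slot \<open>i\<close> of
  \<open>w\<close> stands for the squared variable, while the argument of \<open>h\<close> has that
  slot replaced by the circle point.\<close>

lemma hol_at_Cauchy_kernel_integral:
  fixes h :: "complex^'n \<Rightarrow> complex"
  assumes r: "r > 0" and w0: "w0 $ i = 0"
    and hol: "\<And>x. x \<in> ball w0 (2 * r) \<Longrightarrow> hol_at h x"
    and m: "continuous_on {0..1} m"
  shows "hol_at (\<lambda>w. integral {0..1}
      (\<lambda>t. h (upd w i (circlepath 0 r t)) * m t / ((circlepath 0 r t)^2 - w $ i))) w0"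
proof -
  define K where "K w t = h (upd w i (circlepath 0 r t)) * m t / ((circlepath 0 r t)^2 - w $ i)" for w t
  \<comment> \<open>The ball keeps the arguments of \<open>h\<close> within distance
    \<open>2 * r\<close> of \<open>w0\<close>. The bound \<open>r^2\<close> keeps the denominator
    away from zero, since the square of a point on the circle has modulus exactly
    \<open>r^2\<close>.\<close>
  define U where "U = ball w0 r \<inter> {w. norm (w $ i) < r^2}"
  have "open U"
    unfolding U_def by (intro open_Int open_ball open_Collect_less continuous_intros)
  have "w0 \<in> U" using r w0 by (simp add: U_def)
  have ne: "(circlepath 0 r t)^2 - w $ i \<noteq> 0" if "w \<in> U" for w t
  proof
    assume "(circlepath 0 r t)^2 - w $ i = 0"
    then have "norm (w $ i) = r^2"
      using r by (metis eq_iff_diff_eq_0 less_imp_le norm_circlepath_0 norm_power)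
    with that show False by (simp add: U_def)
  qed
  have sub: "upd w i (circlepath 0 r t) \<in> ball w0 (2 * r)" if "w \<in> U" for w t
    using that dist_upd_le [OF w0, of w "circlepath 0 r t"] r
    by (simp add: U_def norm_circlepath_0)
  have hcont: "continuous_on (ball w0 (2 * r)) h"
    using hol hol_at_imp_isCont continuous_at_imp_continuous_on by blast
  have "holomorphic_cvec (\<lambda>w. integral {0..1} (K w)) U"
  proof (rule holomorphic_cvec_integral [OF \<open>open U\<close>])
    have mc: "continuous_on (U \<times> {0..1}) (\<lambda>p. m (snd p))"
      by (rule continuous_on_compose2 [OF m]) (auto intro!: continuous_intros)
    have hc: "continuous_on (U \<times> {0..1}) (\<lambda>p. h (upd (fst p) i (circlepath 0 r (snd p))))"
      by (rule continuous_on_compose2 [OF hcont])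
        (use sub in \<open>auto intro!: continuous_on_upd continuous_intros\<close>)
    show "continuous_on (U \<times> {0..1}) (\<lambda>(w, t). K w t)"
      unfolding K_def case_prod_unfold
      by (intro continuous_intros mc hc) (use ne in auto)
  next
    fix t :: real
    show "holomorphic_cvec (\<lambda>w. K w t) U"
      unfolding hol_at_iff_holomorphic_cvec [OF \<open>open U\<close>] K_def
    proof (intro ballI hol_at_intros)
      fix w assume w: "w \<in> U"
      show "hol_at (\<lambda>w. h (upd w i (circlepath 0 r t))) w"
        by (rule hol_at_compose) (intro hol hol_at_upd hol_at_intros sub [OF w])+
      show "(circlepath 0 r t)^2 - w $ i \<noteq> 0"
        by (rule ne [OF w])
    qed
  qed
  then show ?thesis
    using \<open>w0 \<in> U\<close> unfolding hol_at_iff_holomorphic_cvec [OF \<open>open U\<close>] K_def by blast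
qed

section \<open>Square roots, sign changes and even germs\<close>

lemma local_sqrt:
  assumes "z0 \<noteq> 0"
  obtains s U where "open U" "z0^2 \<in> U" "s holomorphic_on U" "s (z0^2) = (z0::complex)"
    "\<forall>\<^sub>F z in nhds z0. s (z^2) = z"
proof
  let ?U = "(\<lambda>t. t / z0^2) -` (- \<real>\<^sub>\<le>\<^sub>0)"
  \<comment> \<open>Dividing by \<open>z0^2\<close> moves the base point to 1, away from the branch
    cut of \<open>csqrt\<close>; the factor \<open>z0\<close> restores the wanted root. It inverts
    squaring wherever \<open>z / z0\<close> has positive real part.\<close>
  let ?s = "\<lambda>t. z0 * csqrt (t / z0^2)"
  show "open ?U"
    by (rule open_vimage) (auto intro!: continuous_intros open_Compl closed_nonpos_Reals_complex simp: assms)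
  show "z0^2 \<in> ?U" using assms by simp
  show "?s holomorphic_on ?U"
    by (intro holomorphic_intros) (use assms in auto)
  show "?s (z0^2) = z0" using assms by simp
  have "isCont (\<lambda>z. Re (z / z0)) z0"
    by (intro isCont_Re isCont_divide continuous_ident continuous_const assms)
  then have "\<forall>\<^sub>F z in nhds z0. Re (z / z0) \<in> {0<..}"
    by (rule eventually_nhds_isCont) (rule eventually_nhds_in_open, use assms in auto)
  then show "\<forall>\<^sub>F z in nhds z0. ?s (z^2) = z"
  proof eventually_elim
    case (elim z)
    then have "csqrt ((z / z0)^2) = z / z0"
      by (intro csqrt_square) auto
    with assms show ?case by (simp add: power_divide)
  qed
qed

text \<open>The square stays in the slot of the coordinate, so functions of the coordinate and
  functions of its square live on the same space.\<close>

definition sq :: "'n \<Rightarrow> complex^'n \<Rightarrow> complex^'n" where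
  "sq i w = upd w i ((w $ i)^2)"

definition neg :: "'n \<Rightarrow> complex^'n \<Rightarrow> complex^'n" where
  "neg i w = upd w i (- w $ i)"

lemma sq_nth: "sq i w $ k = (if k = i then (w $ i)^2 else w $ k)"
  by (simp add: sq_def upd_nth)

lemma neg_nth: "neg i w $ k = (if k = i then - w $ i else w $ k)"
  by (simp add: neg_def upd_nth)

lemma hol_at_nth_sq: "hol_at (\<lambda>w. sq i w $ k) w"
  unfolding sq_def by (intro hol_at_upd hol_at_intros)

lemma hol_at_nth_neg: "hol_at (\<lambda>w. neg i w $ k) w"
  unfolding neg_def by (intro hol_at_upd hol_at_intros)

lemma eventually_nhds_sq: "eventually P (nhds (sq i w)) \<Longrightarrow> \<forall>\<^sub>F w in nhds w. P (sq i w)"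
  by (rule eventually_nhds_isCont) (intro isCont_vecI hol_at_imp_isCont hol_at_nth_sq)

lemma eventually_nhds_neg: "eventually P (nhds (neg i w)) \<Longrightarrow> \<forall>\<^sub>F w in nhds w. P (neg i w)"
  by (rule eventually_nhds_isCont) (intro isCont_vecI hol_at_imp_isCont hol_at_nth_neg)

text \<open>Division of \<open>h\<close> by \<open>z\<^sup>2 - t\<close> in the coordinate \<open>z = w $ i\<close>.  At \<open>z = 0\<close> the remainder is the
  Cauchy integral of \<open>h\<close> against \<open>(\<zeta> + z) / (\<zeta>\<^sup>2 - t)\<close>, which is \<open>1 / (\<zeta> - z)\<close> for \<open>t = z\<^sup>2\<close>.\<close>

lemma square_division:
  fixes h :: "complex^'n \<Rightarrow> complex"
  assumes h: "hol_at h w0"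
  obtains A B where "hol_at A (sq i w0)" "hol_at B (sq i w0)"
    "\<forall>\<^sub>F w in nhds w0. h w = A (sq i w) + w $ i * B (sq i w)"
    "w0 $ i \<noteq> 0 \<longrightarrow> B = (\<lambda>w. 0)"
proof (cases "w0 $ i = 0")
  \<comment> \<open>Away from zero the coordinate is itself a holomorphic function of its square, so
    substituting the local root into \<open>h\<close> leaves no odd part.\<close>
  case False
  then obtain s U where s: "open U" "(w0 $ i)^2 \<in> U" "s holomorphic_on U" "s ((w0 $ i)^2) = w0 $ i"
      "\<forall>\<^sub>F z in nhds (w0 $ i). s (z^2) = z"
    by (rule local_sqrt)
  have "hol_at (\<lambda>w. h (upd w i (s (w $ i)))) (sq i w0)"
  proof (rule hol_at_compose)
    show "hol_at h (upd (sq i w0) i (s (sq i w0 $ i)))"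
      using h by (simp add: sq_def upd_nth s(4))
    show "hol_at (\<lambda>w. upd w i (s (w $ i)) $ k) (sq i w0)" for k
      by (intro hol_at_upd hol_at_intros hol_at_compose_field [OF _ s(3,1)])
        (simp add: sq_nth s(2))
  qed
  moreover have "\<forall>\<^sub>F w in nhds w0. s ((w $ i)^2) = w $ i"
    by (rule eventually_nhds_isCont [where g = "\<lambda>w. w $ i" and P = "\<lambda>z. s (z^2) = z"])
      (simp_all add: s(5))
  then have "\<forall>\<^sub>F w in nhds w0. h w = h (upd (sq i w) i (s (sq i w $ i))) + w $ i * 0"
    by eventually_elim (simp add: sq_def upd_nth)
  ultimately show thesis
    by (intro that [of "\<lambda>w. h (upd w i (s (w $ i)))" "\<lambda>w. 0"] hol_at_const impI refl)
next
  case True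
  obtain W where W: "open W" "w0 \<in> W" "holomorphic_cvec h W"
    using h unfolding hol_at_iff_open by blast
  then obtain e where e: "e > 0" "ball w0 e \<subseteq> W"
    unfolding open_contains_ball by blast
  define r where "r = e / 2"
  have r: "r > 0" and hol: "\<And>x. x \<in> ball w0 (2 * r) \<Longrightarrow> hol_at h x"
    using e W(3) unfolding hol_at_iff_holomorphic_cvec [OF W(1)] by (auto simp: r_def)
  define \<gamma> where "\<gamma> = circlepath 0 r"
  have \<gamma>: "norm (\<gamma> t) = r" "\<gamma> t \<noteq> 0" "continuous_on {0..1} \<gamma>" for t
    using r by (auto simp: \<gamma>_def norm_circlepath_0 intro!: continuous_intros) (simp add: circlepath_0)
  \<comment> \<open>The numerator \<open>\<zeta> + z\<close> of the kernel is split into its two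
    terms. Parametrizing the circle contributes one more factor \<open>\<gamma> t\<close>, hence the
    square here and the first power in \<open>B\<close>.\<close>
  define A where "A w = integral {0..1} (\<lambda>t. h (upd w i (\<gamma> t)) * (\<gamma> t)^2 / ((\<gamma> t)^2 - w $ i))" for w
  define B where "B w = integral {0..1} (\<lambda>t. h (upd w i (\<gamma> t)) * \<gamma> t / ((\<gamma> t)^2 - w $ i))" for w
  have "sq i w0 = w0" using True by (simp add: sq_def vec_eq_iff upd_nth)
  have A: "hol_at A w0"
    unfolding A_def \<gamma>_def
    by (rule hol_at_Cauchy_kernel_integral [OF r True hol, where m = "\<lambda>t. (circlepath 0 r t)^2"])
      (auto intro!: continuous_intros)
  have B: "hol_at B w0"
    unfolding B_def \<gamma>_def
    by (rule hol_at_Cauchy_kernel_integral [OF r True hol, where m = "\<lambda>t. circlepath 0 r t"])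
      (auto intro!: continuous_intros)
  have "\<forall>\<^sub>F w in nhds w0. w \<in> ball w0 r \<and> w $ i \<in> ball 0 r"
  proof (rule eventually_conj)
    have "isCont (\<lambda>w. w $ i) w0" by (intro continuous_intros)
    then show "\<forall>\<^sub>F w in nhds w0. w $ i \<in> ball 0 r"
      by (rule eventually_nhds_isCont) (rule eventually_nhds_in_open, use r True in auto)
  qed (rule eventually_nhds_in_open, use r in auto)
  then have "\<forall>\<^sub>F w in nhds w0. h w = A (sq i w) + w $ i * B (sq i w)"
  proof eventually_elim
    case (elim w)
    have in_ball: "upd w i \<zeta> \<in> ball w0 (2 * r)" if "\<zeta> \<in> cball 0 r" for \<zeta>
      using that elim dist_upd_le [OF True, of w \<zeta>] r by simp
    define f where "f \<zeta> = h (upd w i \<zeta>)" for \<zeta>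
    have f_hol: "f holomorphic_on cball 0 r"
    proof -
      have "cdiff h (upd w i 0 + axis i \<zeta>)" if "\<zeta> \<in> cball 0 r" for \<zeta>
        using hol [OF in_ball [OF that]] eventually_nhds_x_imp_x
        unfolding hol_at_def upd_0_add_axis by blast
      from cdiff_axis_holomorphic [of "cball 0 r", OF this] show ?thesis
        by (simp add: f_def [abs_def] upd_0_add_axis)
    qed
    then have f_cont: "continuous_on {0..1} (\<lambda>t. f (\<gamma> t))"
      by (intro continuous_on_compose2 [OF holomorphic_on_imp_continuous_on \<gamma>(3)])
        (auto simp: \<gamma>(1))
    have ne: "(\<gamma> t)^2 - (w $ i)^2 \<noteq> 0" "\<gamma> t - w $ i \<noteq> 0" for t
      using elim \<gamma>(1) [of t] by (auto simp: power2_eq_iff)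
    have "((\<lambda>u. f u / (u - w $ i)) has_contour_integral (2 * of_real pi * \<i> * f (w $ i))) (circlepath 0 r)"
      by (rule Cauchy_integral_circlepath)
        (use f_hol elim in \<open>auto intro: holomorphic_on_imp_continuous_on holomorphic_on_subset\<close>)
    then have "h w = integral {0..1} (\<lambda>t. f (\<gamma> t) / (\<gamma> t - w $ i) * \<gamma> t)"
      using contour_integral_circlepath_0 [of r "\<lambda>u. f u / (u - w $ i)"]
      by (simp add: contour_integral_unique f_def \<gamma>_def)
    also have "\<dots> = integral {0..1} (\<lambda>t. f (\<gamma> t) * (\<gamma> t)^2 / ((\<gamma> t)^2 - (w $ i)^2) +
        w $ i * (f (\<gamma> t) * \<gamma> t / ((\<gamma> t)^2 - (w $ i)^2)))"
    proof (intro integral_cong)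
      fix t
      have "\<gamma> t + w $ i \<noteq> 0" using ne(1) [of t] by (auto simp: power2_eq_iff add_eq_0_iff)
      then have "f (\<gamma> t) / (\<gamma> t - w $ i) * \<gamma> t =
          f (\<gamma> t) * \<gamma> t * (\<gamma> t + w $ i) / ((\<gamma> t - w $ i) * (\<gamma> t + w $ i))" by simp
      also have "(\<gamma> t - w $ i) * (\<gamma> t + w $ i) = (\<gamma> t)^2 - (w $ i)^2"
        by (simp add: algebra_simps power2_eq_square)
      also have "f (\<gamma> t) * \<gamma> t * (\<gamma> t + w $ i) / ((\<gamma> t)^2 - (w $ i)^2) =
          f (\<gamma> t) * (\<gamma> t)^2 / ((\<gamma> t)^2 - (w $ i)^2) +
          w $ i * (f (\<gamma> t) * \<gamma> t / ((\<gamma> t)^2 - (w $ i)^2))"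
        by (simp add: add_divide_distrib distrib_left power2_eq_square mult_ac)
      finally show "f (\<gamma> t) / (\<gamma> t - w $ i) * \<gamma> t = \<dots>" .
    qed
    also have "\<dots> = integral {0..1} (\<lambda>t. f (\<gamma> t) * (\<gamma> t)^2 / ((\<gamma> t)^2 - (w $ i)^2)) +
        integral {0..1} (\<lambda>t. w $ i * (f (\<gamma> t) * \<gamma> t / ((\<gamma> t)^2 - (w $ i)^2)))"
      by (intro integral_add integrable_continuous_interval continuous_intros f_cont \<gamma>(3))
        (use ne in auto)
    also have "\<dots> = A (sq i w) + w $ i * B (sq i w)"
      unfolding integral_mult_right by (simp add: A_def B_def sq_def upd_nth f_def)
    finally show ?case .
  qed
  then show thesis
    using A B True by (intro that [of A B]) (simp_all add: \<open>sq i w0 = w0\<close>)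
qed

text \<open>On the fixed locus, comparing the division at \<open>w\<close> and at
  \<open>neg i w\<close> kills the odd part; elsewhere \<open>square_division\<close> already
  returns an odd part equal to zero.\<close>

lemma even_division:
  fixes h :: "complex^'n \<Rightarrow> complex"
  assumes h: "hol_at h w0" and even: "w0 $ i = 0 \<Longrightarrow> \<forall>\<^sub>F w in nhds w0. h (neg i w) = h w"
  obtains A where "hol_at A (sq i w0)" "\<forall>\<^sub>F w in nhds w0. h w = A (sq i w)"
proof -
  obtain A B where AB: "hol_at A (sq i w0)" "hol_at B (sq i w0)"
    "\<forall>\<^sub>F w in nhds w0. h w = A (sq i w) + w $ i * B (sq i w)"
    "w0 $ i \<noteq> 0 \<longrightarrow> B = (\<lambda>w. 0)"
    by (rule square_division [OF h, where i = i])
  have "\<forall>\<^sub>F w in nhds w0. h w = A (sq i w)"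
  proof (cases "w0 $ i = 0")
    case True
    then have "neg i w0 = w0" by (simp add: neg_def vec_eq_iff upd_nth)
    with AB(3) have "\<forall>\<^sub>F w in nhds w0. h (neg i w) = A (sq i (neg i w)) + neg i w $ i * B (sq i (neg i w))"
      using eventually_nhds_neg [of _ i w0] by simp
    with AB(3) even [OF True] show ?thesis
    proof eventually_elim
      case (elim w)
      have "sq i (neg i w) = sq i w" by (simp add: sq_def neg_def vec_eq_iff upd_nth)
      with elim show ?case by (simp add: neg_nth)
    qed
  qed (use AB(3,4) in simp)
  with AB(1) show thesis by (rule that)
qed

text \<open>Dividing in both coordinates leaves coefficients of \<open>1\<close>,
  \<open>w $ i\<close>, \<open>w $ j\<close> and their product. If one coordinate is nonzero at
  \<open>w0\<close>, it is a root of its own square and the two odd terms can be absorbed into the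
  others. If both vanish, evenness removes the odd terms.\<close>

lemma even_pair_division:
  fixes F :: "complex^'n \<Rightarrow> complex"
  assumes F: "hol_at F w0" and "i \<noteq> j"
    and even: "w0 $ i = 0 \<Longrightarrow> w0 $ j = 0 \<Longrightarrow> \<forall>\<^sub>F w in nhds w0. F (neg j (neg i w)) = F w"
  obtains A B where "hol_at A (sq j (sq i w0))" "hol_at B (sq j (sq i w0))"
    "\<forall>\<^sub>F w in nhds w0. F w = A (sq j (sq i w)) + w $ i * w $ j * B (sq j (sq i w))"
proof -
  obtain P Q where PQ: "hol_at P (sq i w0)" "hol_at Q (sq i w0)"
    "\<forall>\<^sub>F w in nhds w0. F w = P (sq i w) + w $ i * Q (sq i w)"
    by (rule square_division [OF F, where i = i])
  obtain P0 P1 where P: "hol_at P0 (sq j (sq i w0))" "hol_at P1 (sq j (sq i w0))"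
    "\<forall>\<^sub>F w in nhds (sq i w0). P w = P0 (sq j w) + w $ j * P1 (sq j w)"
    by (rule square_division [OF PQ(1), where i = j])
  obtain Q0 Q1 where Q: "hol_at Q0 (sq j (sq i w0))" "hol_at Q1 (sq j (sq i w0))"
    "\<forall>\<^sub>F w in nhds (sq i w0). Q w = Q0 (sq j w) + w $ j * Q1 (sq j w)"
    by (rule square_division [OF PQ(2), where i = j])
  let ?z = "\<lambda>w. sq j (sq i w)"
  have eq: "\<forall>\<^sub>F w in nhds w0. F w = P0 (?z w) + w $ j * P1 (?z w) + w $ i * Q0 (?z w) + w $ i * w $ j * Q1 (?z w)"
    using PQ(3) eventually_nhds_sq [OF P(3)] eventually_nhds_sq [OF Q(3)]
    by eventually_elim (use \<open>i \<noteq> j\<close> in \<open>simp add: sq_nth algebra_simps\<close>)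
  \<comment> \<open>A coordinate that does not vanish at \<open>w0\<close> is recovered near
    \<open>w0\<close> from its square by a local branch of the root.\<close>
  have root: "\<exists>s. hol_at (\<lambda>z. s (z $ k)) (?z w0) \<and> s (?z w0 $ k) \<noteq> 0 \<and>
      (\<forall>\<^sub>F w in nhds w0. s (?z w $ k) = w $ k \<and> w $ k \<noteq> 0)" if k: "k = i \<or> k = j" "w0 $ k \<noteq> 0" for k
  proof -
    obtain s U where s: "open U" "(w0 $ k)^2 \<in> U" "s holomorphic_on U" "s ((w0 $ k)^2) = w0 $ k"
        "\<forall>\<^sub>F z in nhds (w0 $ k). s (z^2) = z"
      by (rule local_sqrt [OF k(2)])
    have zk: "?z w $ k = (w $ k)^2" for w
      using k(1) \<open>i \<noteq> j\<close> by (auto simp: sq_nth)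
    have "hol_at (\<lambda>z. s (z $ k)) (?z w0)"
      by (rule hol_at_compose_field [OF hol_at_coord s(3,1)]) (simp add: zk s(2))
    moreover have "\<forall>\<^sub>F w in nhds w0. s ((w $ k)^2) = w $ k"
      by (rule eventually_nhds_isCont [where g = "\<lambda>w. w $ k" and P = "\<lambda>z. s (z^2) = z"])
        (simp_all add: s(5))
    moreover have "\<forall>\<^sub>F w in nhds w0. w $ k \<noteq> 0"
      by (rule eventually_nhds_isCont [where g = "\<lambda>w. w $ k" and P = "\<lambda>z. z \<noteq> 0"])
        (use t1_space_nhds [OF k(2)] in simp_all)
    ultimately show ?thesis
      using k(2) by (intro exI [of _ s]) (simp add: zk s(4) eventually_conj)
  qed
  show thesis
  proof (cases "w0 $ i = 0")
    case False
    then obtain s where s: "hol_at (\<lambda>z. s (z $ i)) (?z w0)" "s (?z w0 $ i) \<noteq> 0"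
      "\<forall>\<^sub>F w in nhds w0. s (?z w $ i) = w $ i \<and> w $ i \<noteq> 0"
      using root by blast
    show thesis
    \<comment> \<open>With \<open>s\<close> the root for the coordinate \<open>i\<close>, the linear
      terms are rewritten by \<open>w $ i = s\<close> and
      \<open>w $ j = w $ i * w $ j / s\<close>.\<close>
    proof (rule that [of "\<lambda>z. P0 z + s (z $ i) * Q0 z" "\<lambda>z. P1 z / s (z $ i) + Q1 z"])
      show "\<forall>\<^sub>F w in nhds w0. F w = P0 (?z w) + s (?z w $ i) * Q0 (?z w) +
          w $ i * w $ j * (P1 (?z w) / s (?z w $ i) + Q1 (?z w))"
        using eq s(3) by eventually_elim (simp add: field_simps)
    qed (intro hol_at_intros P Q s)+
  next
    case i: True
    show thesis
    proof (cases "w0 $ j = 0")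
      case False
      then obtain s where s: "hol_at (\<lambda>z. s (z $ j)) (?z w0)" "s (?z w0 $ j) \<noteq> 0"
        "\<forall>\<^sub>F w in nhds w0. s (?z w $ j) = w $ j \<and> w $ j \<noteq> 0"
        using root by blast
      show thesis
      proof (rule that [of "\<lambda>z. P0 z + s (z $ j) * P1 z" "\<lambda>z. Q0 z / s (z $ j) + Q1 z"])
        show "\<forall>\<^sub>F w in nhds w0. F w = P0 (?z w) + s (?z w $ j) * P1 (?z w) +
            w $ i * w $ j * (Q0 (?z w) / s (?z w $ j) + Q1 (?z w))"
          using eq s(3) by eventually_elim (simp add: field_simps)
      qed (intro hol_at_intros P Q s)+
    next
      case j: True
      let ?n = "\<lambda>w. neg j (neg i w)"
      have "?n w0 = w0" using i j by (auto simp: vec_eq_iff neg_nth)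
      have z: "?z (?n w) = ?z w" "?n w $ i = - w $ i" "?n w $ j = - w $ j" for w
        using \<open>i \<noteq> j\<close> by (auto simp: vec_eq_iff neg_nth sq_nth)
      have "\<forall>\<^sub>F w in nhds w0. F (?n w) = P0 (?z w) - w $ j * P1 (?z w) - w $ i * Q0 (?z w) + w $ i * w $ j * Q1 (?z w)"
        using eventually_nhds_neg [OF eventually_nhds_neg [of _ j "neg i w0"]] eq
        unfolding \<open>?n w0 = w0\<close> by (force simp: z elim: eventually_mono)
      with eq even [OF i j] have "\<forall>\<^sub>F w in nhds w0. F w = P0 (?z w) + w $ i * w $ j * Q1 (?z w)"
      proof eventually_elim
        case (elim w)
        then have "2 * F w = 2 * (P0 (?z w) + w $ i * w $ j * Q1 (?z w))" by (simp add: algebra_simps)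
        then show ?case unfolding mult_cancel_left by simp
      qed
      then show thesis by (rule that [OF P(1) Q(2)])
    qed
  qed
qed

section \<open>Morphisms between quotients\<close>

lemma quotient_topology_quotient_topology:
  "quotient_topology (quotient_topology T \<pi>) \<rho> = quotient_topology T (\<rho> \<circ> \<pi>)"
proof -
  have "{x \<in> topspace T. \<pi> x \<in> {y \<in> \<pi> ` topspace T. \<rho> y \<in> U}} = {x \<in> topspace T. (\<rho> \<circ> \<pi>) x \<in> U}" for U
    by auto
  moreover have "{y \<in> \<pi> ` topspace T. \<rho> y \<in> U} \<subseteq> \<pi> ` topspace T" for U
    by auto
  ultimately show ?thesis
    by (simp add: topology_eq openin_quotient_topology topspace_quotient_topology image_comp)
qed

text \<open>Merges the passage to projective points and the passage to group orbits into a single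
  map on the cone, so that all germs can be taken in affine space.\<close>

lemma quotient_space_quotient_space:
  "quotient_space (quotient_space X \<pi>) \<rho> = quotient_space X (\<rho> \<circ> \<pi>)"
proof -
  have "{x \<in> topspace (base X). \<pi> x \<in> {y \<in> \<pi> ` topspace (base X). \<rho> y \<in> U}} =
      {x \<in> topspace (base X). (\<rho> \<circ> \<pi>) x \<in> U}" for U
    by auto
  then show ?thesis
    by (simp add: quotient_space_def quotient_topology_quotient_topology topspace_quotient_topology comp_assoc)
qed

lemma base_hol_affine: "base (hol_affine S) = top_of_set S"
  by (simp add: hol_affine_def)

lemma openin_subspace_iff_eventually:
  "openin (top_of_set S) U \<longleftrightarrow> U \<subseteq> S \<and> (\<forall>x\<in>U. \<forall>\<^sub>F y in nhds x. y \<in> S \<longrightarrow> y \<in> U)"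
proof
  assume "openin (top_of_set S) U"
  then obtain W where "open W" "U = S \<inter> W"
    by (auto simp: openin_open)
  then show "U \<subseteq> S \<and> (\<forall>x\<in>U. \<forall>\<^sub>F y in nhds x. y \<in> S \<longrightarrow> y \<in> U)"
    by (auto simp: eventually_nhds)
next
  assume *: "U \<subseteq> S \<and> (\<forall>x\<in>U. \<forall>\<^sub>F y in nhds x. y \<in> S \<longrightarrow> y \<in> U)"
  show "openin (top_of_set S) U"
  proof (subst openin_subopen, intro ballI)
    fix x assume "x \<in> U"
    with * obtain W where "open W" "x \<in> W" "\<forall>y\<in>W. y \<in> S \<longrightarrow> y \<in> U"
      unfolding eventually_nhds by blast
    with * \<open>x \<in> U\<close> show "\<exists>V. openin (top_of_set S) V \<and> x \<in> V \<and> V \<subseteq> U"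
      by (intro exI [of _ "S \<inter> W"]) (auto intro: openin_open_Int)
  qed
qed

lemma sect_hol_affine:
  "f \<in> sect (hol_affine S) U \<longleftrightarrow>
     (\<forall>v\<in>U. \<exists>h. hol_at h v \<and> (\<forall>\<^sub>F w in nhds v. w \<in> U \<longrightarrow> f w = h w))" (is "?l \<longleftrightarrow> ?r")
proof
  assume l: ?l
  show ?r
  proof
    fix v assume "v \<in> U"
    with l obtain W h where "open W" "v \<in> W" "holomorphic_cvec h W" "\<forall>w\<in>W \<inter> U. f w = h w"
      unfolding hol_affine_def by auto
    then show "\<exists>h. hol_at h v \<and> (\<forall>\<^sub>F w in nhds v. w \<in> U \<longrightarrow> f w = h w)"
      unfolding hol_at_iff_open eventually_nhds by blast
  qed
next
  assume r: ?r
  have "\<exists>W h. open W \<and> v \<in> W \<and> holomorphic_cvec h W \<and> (\<forall>w\<in>W \<inter> U. f w = h w)" if "v \<in> U" for v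
  proof -
    obtain h where h: "hol_at h v" "\<forall>\<^sub>F w in nhds v. w \<in> U \<longrightarrow> f w = h w"
      using r \<open>v \<in> U\<close> by blast
    then have "\<forall>\<^sub>F w in nhds v. cdiff h w \<and> (w \<in> U \<longrightarrow> f w = h w)"
      unfolding hol_at_def by (rule eventually_conj)
    then show ?thesis
      unfolding eventually_nhds holomorphic_cvec_iff_cdiff by blast
  qed
  then show ?l by (simp add: hol_affine_def)
qed

text \<open>\<open>L\<close> relates representatives of a point and of its image.  It need not have a continuous
  selection, which matters because the maps below involve square roots.\<close>

lemma space_morphism_hol_quotients:
  fixes S :: "(complex^'n) set" and T :: "(complex^'m) set"
  assumes L: "\<And>x y. x \<in> S \<Longrightarrow> y \<in> T \<Longrightarrow> L x y \<Longrightarrow> \<phi> (\<pi> x) = \<rho> y"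
    and germ: "\<And>x0. x0 \<in> S \<Longrightarrow> \<exists>y0\<in>T. L x0 y0 \<and>
      (\<forall>P. (\<forall>\<^sub>F y in nhds y0. P y) \<longrightarrow> (\<forall>\<^sub>F x in nhds x0. x \<in> S \<longrightarrow> (\<exists>y\<in>T. L x y \<and> P y))) \<and>
      (\<forall>h f. hol_at h y0 \<longrightarrow> (\<forall>\<^sub>F y in nhds y0. y \<in> T \<longrightarrow> f (\<rho> y) = h y) \<longrightarrow>
        (\<exists>k. hol_at k x0 \<and> (\<forall>\<^sub>F x in nhds x0. x \<in> S \<longrightarrow> f (\<phi> (\<pi> x)) = k x)))"
  shows "space_morphism (quotient_space (hol_affine S) \<pi>) (quotient_space (hol_affine T) \<rho>) \<phi>"
proof -
  let ?X = "quotient_space (hol_affine S) \<pi>" and ?Y = "quotient_space (hol_affine T) \<rho>"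
  have X: "base ?X = quotient_topology (top_of_set S) \<pi>" and Y: "base ?Y = quotient_topology (top_of_set T) \<rho>"
    by (simp_all add: quotient_space_def base_hol_affine)
  have topX: "topspace (base ?X) = \<pi> ` S"
    by (simp add: X topspace_quotient_topology)
  have topY: "topspace (base ?Y) = \<rho> ` T"
    by (simp add: Y topspace_quotient_topology)
  \<comment> \<open>Representatives near \<open>y0\<close> lie over \<open>V\<close>. Nearby
    \<open>x\<close> have at least one partner \<open>y\<close> among them, and \<open>L\<close>
    determines the image of \<open>x\<close> from any partner, so no continuous choice of
    \<open>y\<close> is involved.\<close>
  have preim: "\<forall>\<^sub>F x in nhds x0. x \<in> S \<longrightarrow> \<phi> (\<pi> x) \<in> V"
    if V: "openin (base ?Y) V" and x0: "x0 \<in> S" "\<phi> (\<pi> x0) \<in> V" for V x0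
  proof -
    obtain y0 where y0: "y0 \<in> T" "L x0 y0"
      "\<And>P. (\<forall>\<^sub>F y in nhds y0. P y) \<Longrightarrow> (\<forall>\<^sub>F x in nhds x0. x \<in> S \<longrightarrow> (\<exists>y\<in>T. L x y \<and> P y))"
      using germ [OF x0(1)] by blast
    have "\<forall>\<^sub>F y in nhds y0. y \<in> T \<longrightarrow> \<rho> y \<in> V"
      using V x0 y0(1) L [OF x0(1) y0(1,2)]
      unfolding Y openin_quotient_topology openin_subspace_iff_eventually by simp
    from y0(3) [OF this] show ?thesis
      by eventually_elim (use L in metis)
  qed
  have pre_eq: "{x \<in> S. \<pi> x \<in> {p \<in> \<pi> ` S. \<phi> p \<in> V}} = {x \<in> S. \<phi> (\<pi> x) \<in> V}" for V
    by auto
  have pre_eq': "{x \<in> S. \<pi> x \<in> \<pi> ` S \<and> \<phi> (\<pi> x) \<in> V} = {x \<in> S. \<phi> (\<pi> x) \<in> V}" for V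
    by auto
  have "continuous_map (base ?X) (base ?Y) \<phi>"
    unfolding continuous_map_def topX topY
  proof (intro conjI allI impI)
    show "\<phi> \<in> \<pi> ` S \<rightarrow> \<rho> ` T"
      using germ L by (force simp: Pi_iff)
    fix V assume "openin (base ?Y) V"
    then show "openin (base ?X) {p \<in> \<pi> ` S. \<phi> p \<in> V}"
      unfolding X openin_quotient_topology topspace_euclidean_subtopology pre_eq
      unfolding openin_subspace_iff_eventually
      using preim by (auto elim: eventually_mono)
  qed
  moreover have "f \<circ> \<phi> \<in> sect ?X {p \<in> topspace (base ?X). \<phi> p \<in> V}"
    if V: "openin (base ?Y) V" and f: "f \<in> sect ?Y V" for V f
  proof -
    have "f \<circ> \<phi> \<circ> \<pi> \<in> sect (hol_affine S) {x \<in> S. \<phi> (\<pi> x) \<in> V}"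
      unfolding sect_hol_affine
    proof
      fix x0 assume "x0 \<in> {x \<in> S. \<phi> (\<pi> x) \<in> V}"
      then have x0: "x0 \<in> S" "\<phi> (\<pi> x0) \<in> V" by auto
      then obtain y0 where y0: "y0 \<in> T" "L x0 y0"
        "\<And>h. hol_at h y0 \<Longrightarrow> (\<forall>\<^sub>F y in nhds y0. y \<in> T \<longrightarrow> f (\<rho> y) = h y) \<Longrightarrow>
          (\<exists>k. hol_at k x0 \<and> (\<forall>\<^sub>F x in nhds x0. x \<in> S \<longrightarrow> f (\<phi> (\<pi> x)) = k x))"
        using germ [OF x0(1)] by blast
      have "y0 \<in> {y \<in> T. \<rho> y \<in> V}"
        using x0 y0 L by auto
      moreover have "f \<circ> \<rho> \<in> sect (hol_affine T) {y \<in> T. \<rho> y \<in> V}"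
        using f by (simp add: quotient_space_def base_hol_affine)
      ultimately obtain h where h: "hol_at h y0"
        "\<forall>\<^sub>F y in nhds y0. y \<in> {y \<in> T. \<rho> y \<in> V} \<longrightarrow> (f \<circ> \<rho>) y = h y"
        unfolding sect_hol_affine by blast
      have "\<forall>\<^sub>F y in nhds y0. y \<in> T \<longrightarrow> \<rho> y \<in> V"
        using V x0 y0(1) L [OF x0(1) y0(1,2)]
        unfolding Y openin_quotient_topology openin_subspace_iff_eventually by simp
      with h(2) have "\<forall>\<^sub>F y in nhds y0. y \<in> T \<longrightarrow> f (\<rho> y) = h y"
        by eventually_elim simp
      from y0(3) [OF h(1) this] obtain k where k: "hol_at k x0"
        "\<forall>\<^sub>F x in nhds x0. x \<in> S \<longrightarrow> f (\<phi> (\<pi> x)) = k x" by blast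
      from k(2) have "\<forall>\<^sub>F x in nhds x0. x \<in> {x \<in> S. \<phi> (\<pi> x) \<in> V} \<longrightarrow> (f \<circ> \<phi> \<circ> \<pi>) x = k x"
        by eventually_elim simp
      with k(1) show "\<exists>k. hol_at k x0 \<and>
          (\<forall>\<^sub>F x in nhds x0. x \<in> {x \<in> S. \<phi> (\<pi> x) \<in> V} \<longrightarrow> (f \<circ> \<phi> \<circ> \<pi>) x = k x)"
        by blast
    qed
    then show ?thesis
      by (simp add: quotient_space_def base_hol_affine topspace_quotient_topology pre_eq')
  qed
  ultimately show ?thesis
    unfolding space_morphism_def by blast
qed

section \<open>Orbits\<close>

lemma proj_point_eq: "proj_point v = range (\<lambda>k. k *s v)"
  by (simp add: proj_point_def vec.span_singleton)

lemma mem_proj_point: "v \<in> proj_point v"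
  unfolding proj_point_def by (simp add: vec.span_base)

lemma proj_point_scale: "s \<noteq> 0 \<Longrightarrow> proj_point (s *s v) = proj_point v"
proof -
  assume "s \<noteq> 0"
  then have "range (\<lambda>k. k * s) = UNIV"
    by (intro surjI [of _ "\<lambda>k. k / s"]) simp
  moreover have "range (\<lambda>k. k *s (s *s v)) = (\<lambda>k. k *s v) ` range (\<lambda>k. k * s)"
    by (simp add: image_comp comp_def)
  ultimately show ?thesis by (simp add: proj_point_eq)
qed

lemma proj_point_eqD:
  assumes "proj_point v = proj_point w"
  shows "\<exists>s. s \<noteq> 0 \<and> w = s *s v"
proof (cases "w = 0")
  case True
  then have "v = 0" using assms mem_proj_point [of v] by (auto simp: proj_point_eq)
  with True show ?thesis by (intro exI [of _ 1]) auto
next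
  case False
  obtain s where "w = s *s v"
    using assms mem_proj_point [of w] by (auto simp: proj_point_eq)
  with False show ?thesis by (intro exI [of _ s]) auto
qed

lemma image_proj_point:
  assumes "\<And>s x. g (s *s x) = s *s g x"
  shows "g ` proj_point v = proj_point (g v)"
  by (auto simp: proj_point_eq image_iff assms)

definition box_orbit :: "complex^7 \<Rightarrow> (complex^7) set set" where
  "box_orbit v = sigma_orbit (proj_point v)"

lemma box_orbit_eq: "box_orbit v = {proj_point v, proj_point (box_sigma v)}"
proof -
  have "box_sigma ` proj_point v = proj_point (box_sigma v)"
    by (rule image_proj_point) (simp add: vec_eq_iff box_sigma_def)
  then show ?thesis
    unfolding box_orbit_def sigma_orbit_def group_generated_sigma Setcompr_eq_image by simp
qed

lemma box_sigma_box_sigma [simp]: "box_sigma (box_sigma v) = v"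
  by (simp add: box_sigma_def vec_eq_iff)

lemma box_orbit_eq_iff:
  "box_orbit v = box_orbit w \<longleftrightarrow> (\<exists>s. s \<noteq> 0 \<and> (w = s *s v \<or> w = s *s box_sigma v))"
proof
  assume "box_orbit v = box_orbit w"
  then have "proj_point v = proj_point w \<or> proj_point (box_sigma v) = proj_point w"
    unfolding box_orbit_eq by auto
  then show "\<exists>s. s \<noteq> 0 \<and> (w = s *s v \<or> w = s *s box_sigma v)"
    by (blast dest: proj_point_eqD)
next
  assume "\<exists>s. s \<noteq> 0 \<and> (w = s *s v \<or> w = s *s box_sigma v)"
  then obtain s where s: "s \<noteq> 0" "w = s *s v \<or> w = s *s box_sigma v" by blast
  have "box_sigma (s *s x) = s *s box_sigma x" for x
    by (simp add: vec_eq_iff box_sigma_def)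
  with s show "box_orbit v = box_orbit w"
    by (auto simp: box_orbit_eq proj_point_scale)
qed

definition EE_orbit :: "complex^(4 + 4) \<Rightarrow> ((complex^4) set \<times> (complex^4) set) set" where
  "EE_orbit w = H_orbit (EE_point w)"

lemma EE_orbit_eq:
  "EE_orbit w = (\<lambda>g. (proj_point (g (left w)), proj_point (g (right w)))) ` {id, E_tau, E_rho, E_tau \<circ> E_rho}"
proof -
  have "g ` proj_point x = proj_point (g x)" if "g \<in> {id, E_tau, E_rho, E_tau \<circ> E_rho}" for g x
    by (rule image_proj_point) (use that in \<open>auto simp: vec_eq_iff E_tau_def E_rho_def\<close>)
  then show ?thesis
    by (simp only: EE_orbit_def H_orbit_def EE_point_def group_generated_H Setcompr_eq_image
        prod.case cong: image_cong)
qed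

text \<open>Projectively \<open>E_rho\<close> is \<open>(-a, -b, c, d)\<close>. After rescaling so
  that \<open>c\<close> and \<open>d\<close> keep their signs, \<open>H\<close> becomes the group of
  independent signs on \<open>a\<close> and \<open>b\<close>, shared by the two factors, while the
  scalars of the factors are unrelated. The witnesses \<open>-s\<close> and \<open>-t\<close> below
  perform this rescaling.\<close>

lemma EE_orbit_eq_iff:
  "EE_orbit v = EE_orbit w \<longleftrightarrow> (\<exists>s t \<epsilon> \<eta>. s \<noteq> 0 \<and> t \<noteq> 0 \<and> \<epsilon> \<in> {1, -1} \<and> \<eta> \<in> {1, -1} \<and>
     left w = (\<chi> i. (if i = 1 then \<epsilon> else if i = 2 then \<eta> else 1) * s * left v $ i) \<and>
     right w = (\<chi> i. (if i = 1 then \<epsilon> else if i = 2 then \<eta> else 1) * t * right v $ i))"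
    (is "?l \<longleftrightarrow> (\<exists>s t \<epsilon> \<eta>. ?r s t \<epsilon> \<eta>)")
proof
  assume ?l
  have "(proj_point (left w), proj_point (right w)) \<in> EE_orbit w"
    by (auto simp: EE_orbit_eq)
  with \<open>?l\<close> have "(proj_point (left w), proj_point (right w)) \<in> EE_orbit v"
    by simp
  then obtain g where g: "g \<in> {id, E_tau, E_rho, E_tau \<circ> E_rho}"
      "proj_point (g (left v)) = proj_point (left w)" "proj_point (g (right v)) = proj_point (right w)"
    unfolding EE_orbit_eq [of v] by (elim imageE) simp
  obtain s t where st: "s \<noteq> 0" "left w = s *s g (left v)" "t \<noteq> 0" "right w = t *s g (right v)"
    using proj_point_eqD [OF g(2)] proj_point_eqD [OF g(3)] by blast
  consider "g = id" | "g = E_tau" | "g = E_rho" | "g = E_tau \<circ> E_rho"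
    using g(1) by auto
  then show "\<exists>s t \<epsilon> \<eta>. ?r s t \<epsilon> \<eta>"
  proof cases
    case 1
    with st show ?thesis
      by (intro exI [of _ s] exI [of _ t] exI [of _ 1]) (simp add: vec_eq_iff forall_4)
  next
    case 2
    with st show ?thesis
      by (intro exI [of _ s] exI [of _ t] exI [of _ 1] exI [of _ "-1"]) (simp add: vec_eq_iff forall_4 E_tau_def)
  next
    case 3
    with st show ?thesis
      by (intro exI [of _ "-s"] exI [of _ "-t"] exI [of _ "-1"]) (simp add: vec_eq_iff forall_4 E_rho_def)
  next
    case 4
    with st show ?thesis
      by (intro exI [of _ "-s"] exI [of _ "-t"] exI [of _ "-1"] exI [of _ 1])
        (simp add: vec_eq_iff forall_4 E_tau_def E_rho_def)
  qed
next
  assume "\<exists>s t \<epsilon> \<eta>. ?r s t \<epsilon> \<eta>"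
  then obtain s t \<epsilon> \<eta> where r: "?r s t \<epsilon> \<eta>" by blast
  have "\<exists>g s t. g \<in> {id, E_tau, E_rho, E_tau \<circ> E_rho} \<and> s \<noteq> 0 \<and> t \<noteq> 0 \<and>
      left w = s *s g (left v) \<and> right w = t *s g (right v)"
  proof -
    consider "\<epsilon> = 1" "\<eta> = 1" | "\<epsilon> = 1" "\<eta> = -1" | "\<epsilon> = -1" "\<eta> = -1" | "\<epsilon> = -1" "\<eta> = 1"
      using r by auto
    then show ?thesis
    proof cases
      case 1
      with r show ?thesis
        by (intro exI [of _ id] exI [of _ s] exI [of _ t]) (auto simp: vec_eq_iff forall_4)
    next
      case 2
      with r show ?thesis
        by (intro exI [of _ E_tau] exI [of _ s] exI [of _ t]) (auto simp: vec_eq_iff forall_4 E_tau_def)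
    next
      case 3
      with r show ?thesis
        by (intro exI [of _ E_rho] exI [of _ "-s"] exI [of _ "-t"]) (auto simp: vec_eq_iff forall_4 E_rho_def)
    next
      case 4
      with r show ?thesis
        by (intro exI [of _ "E_tau \<circ> E_rho"] exI [of _ "-s"] exI [of _ "-t"])
          (auto simp: vec_eq_iff forall_4 E_rho_def E_tau_def)
    qed
  qed
  then obtain g s t where g: "g \<in> {id, E_tau, E_rho, E_tau \<circ> E_rho}" "s \<noteq> 0" "t \<noteq> 0"
      "left w = s *s g (left v)" "right w = t *s g (right v)" by blast
  have lin: "h (s *s x) = s *s h x" if "h \<in> {id, E_tau, E_rho, E_tau \<circ> E_rho}" for h x and s :: complex
    using that by (auto simp: vec_eq_iff E_tau_def E_rho_def)
  have c: "E_tau (E_tau v) = v" "E_rho (E_rho v) = v" "E_rho (E_tau v) = E_tau (E_rho v)" for v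
    by (simp_all add: E_tau_def E_rho_def vec_eq_iff)
  have "EE_orbit w = (\<lambda>h. (proj_point (h (g (left v))), proj_point (h (g (right v))))) `
      {id, E_tau, E_rho, E_tau \<circ> E_rho}"
    unfolding EE_orbit_eq g(4,5)
    by (rule image_cong) (simp_all only: lin proj_point_scale g(2,3) not_False_eq_True)
  \<comment> \<open>Composition with \<open>g\<close> only permutes the four elements of
    \<open>H\<close>, which are commuting involutions.\<close>
  also have "\<dots> = EE_orbit v"
    unfolding EE_orbit_eq using g(1)
    by (elim insertE emptyE) (simp_all add: c insert_commute)
  finally show ?l ..
qed

section \<open>The map from the square of the elliptic curve\<close>

lemma exhaust_7:
  fixes x :: 7
  shows "x = 1 \<or> x = 2 \<or> x = 3 \<or> x = 4 \<or> x = 5 \<or> x = 6 \<or> x = 7"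
proof (induct x)
  case (of_int z)
  then have "z = 0 \<or> z = 1 \<or> z = 2 \<or> z = 3 \<or> z = 4 \<or> z = 5 \<or> z = 6" by fastforce
  then show ?case by auto
qed

lemma forall_7: "(\<forall>i::7. P i) \<longleftrightarrow> P 1 \<and> P 2 \<and> P 3 \<and> P 4 \<and> P 5 \<and> P 6 \<and> P 7"
  by (metis exhaust_7)

text \<open>The coordinate Z3 is determined up to sign by the point of \<open>E \<times> E\<close>: it is a square root
  of \<open>radicand\<close>.\<close>

definition lift :: "complex^(4 + 4) \<Rightarrow> complex \<Rightarrow> complex^7" where
  "lift w z = (\<chi> i.
     if i = 1 then w $ Inl 3 * w $ Inr 3 + w $ Inl 4 * w $ Inr 4
     else if i = 2 then w $ Inl 3 * w $ Inr 3 - w $ Inl 4 * w $ Inr 4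
     else if i = 3 then z
     else if i = 4 then w $ Inl 3 * w $ Inr 4 - w $ Inl 4 * w $ Inr 3
     else if i = 5 then w $ Inl 3 * w $ Inr 4 + w $ Inl 4 * w $ Inr 3
     else if i = 6 then w $ Inl 2 * w $ Inr 2
     else w $ Inl 1 * w $ Inr 1)"

lemma lift_nth [simp]:
  "lift w z $ 1 = w $ Inl 3 * w $ Inr 3 + w $ Inl 4 * w $ Inr 4"
  "lift w z $ 2 = w $ Inl 3 * w $ Inr 3 - w $ Inl 4 * w $ Inr 4"
  "lift w z $ 3 = z"
  "lift w z $ 4 = w $ Inl 3 * w $ Inr 4 - w $ Inl 4 * w $ Inr 3"
  "lift w z $ 5 = w $ Inl 3 * w $ Inr 4 + w $ Inl 4 * w $ Inr 3"
  "lift w z $ 6 = w $ Inl 2 * w $ Inr 2"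
  "lift w z $ 7 = w $ Inl 1 * w $ Inr 1"
  by (simp_all add: lift_def)

definition radicand :: "complex^(4 + 4) \<Rightarrow> complex" where
  "radicand w = (w $ Inl 3 * w $ Inr 4 - w $ Inl 4 * w $ Inr 3)^2 +
     (w $ Inl 3 * w $ Inr 4 + w $ Inl 4 * w $ Inr 3)^2"

text \<open>A relation rather than a map because \<open>Z3\<close> has no continuous choice:
  \<open>Z3\<close> is left free here, and membership in \<open>box_cone\<close> fixes it up to
  sign.\<close>

definition over :: "complex^(4 + 4) \<Rightarrow> complex^7 \<Rightarrow> bool" where
  "over w v \<longleftrightarrow> v = lift w (v $ 3)"

lemma over_lift [simp]: "over w (lift w z)"
  by (simp add: over_def)

lemma sq_lift: "sq 3 (lift w z) = lift w (z^2)"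
  by (simp add: vec_eq_iff sq_nth lift_def)

lemma left_nth [simp]: "left w $ i = w $ Inl i"
  by (simp add: left_def)

lemma right_nth [simp]: "right w $ i = w $ Inr i"
  by (simp add: right_def)

lemma join_nth [simp]: "join x y $ Inl i = x $ i" "join x y $ Inr j = y $ j"
  by (simp_all add: join_def)

lemma vec_sum_eq_iff: "v = w \<longleftrightarrow> (\<forall>i. v $ Inl i = w $ Inl i) \<and> (\<forall>j. v $ Inr j = w $ Inr j)"
  by (metis sum.exhaust vec_eq_iff)

lemma join_left_right [simp]: "join (left w) (right w) = w"
  by (simp add: vec_sum_eq_iff)

lemma left_join [simp]: "left (join x y) = x"
  by (simp add: vec_eq_iff)

lemma right_join [simp]: "right (join x y) = y"
  by (simp add: vec_eq_iff)

lemma EE_cone_iff: "w \<in> EE_cone \<longleftrightarrow> left w \<in> E_cone \<and> right w \<in> E_cone"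
  unfolding EE_cone_def by (auto) (metis join_left_right)

lemma E_cone_cd_nonzero: "x \<in> E_cone \<Longrightarrow> x $ 3 \<noteq> 0 \<or> x $ 4 \<noteq> 0"
  by (auto simp: E_cone_def vec_eq_iff forall_4)

lemma E_cone_iff:
  "x \<in> E_cone \<longleftrightarrow> (x $ 3 \<noteq> 0 \<or> x $ 4 \<noteq> 0) \<and> (x $ 1)^2 = (x $ 3)^2 + (x $ 4)^2 \<and> (x $ 2)^2 = (x $ 3)^2 - (x $ 4)^2"
  using E_cone_cd_nonzero [of x] by (auto simp: E_cone_def)

lemma EE_cone_coordinates:
  "w \<in> EE_cone \<longleftrightarrow> (w $ Inl 3 \<noteq> 0 \<or> w $ Inl 4 \<noteq> 0) \<and> (w $ Inr 3 \<noteq> 0 \<or> w $ Inr 4 \<noteq> 0) \<and>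
     (w $ Inl 1)^2 = (w $ Inl 3)^2 + (w $ Inl 4)^2 \<and> (w $ Inl 2)^2 = (w $ Inl 3)^2 - (w $ Inl 4)^2 \<and>
     (w $ Inr 1)^2 = (w $ Inr 3)^2 + (w $ Inr 4)^2 \<and> (w $ Inr 2)^2 = (w $ Inr 3)^2 - (w $ Inr 4)^2"
  unfolding EE_cone_iff E_cone_iff by auto

text \<open>Applied to \<open>Z1, Z2\<close> and to \<open>W2, W1\<close>, it recovers the four
  entries \<open>cc', dd'\<close> and \<open>cd', dc'\<close> of the tensor up to the common factor
  \<open>m\<close>.\<close>

lemma sum_difference_proportional:
  fixes x :: complex
  assumes "x + y = m * (a + b)" "x - y = m * (a - b)"
  shows "x = m * a" "y = m * b"
proof -
  have "2 * x = (x + y) + (x - y)" "2 * y = (x + y) - (x - y)" by simp_all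
  then have "2 * x = 2 * (m * a)" "2 * y = 2 * (m * b)"
    unfolding assms by (simp_all add: algebra_simps)
  then show "x = m * a" "y = m * b" by simp_all
qed

text \<open>Once the squares of \<open>aa'\<close> and \<open>bb'\<close> are expressed by
  \<open>c, d, c', d'\<close>, the three relations without \<open>Z3\<close> are identities. Only
  the relation for \<open>Z3\<close> remains, and its other side is \<open>radicand\<close>.\<close>

lemma lift_in_box_cone:
  assumes "w \<in> EE_cone"
  shows "lift w z \<in> box_cone \<longleftrightarrow> z^2 = radicand w"
proof -
  note w = assms [unfolded EE_cone_coordinates]
  have "lift w z \<noteq> 0"
  proof
    assume "lift w z = 0"
    then have "lift w z $ i = 0" for i by simp
    \<comment> \<open>Zero is written with the factor \<open>m = 0\<close> to fit
      \<open>sum_difference_proportional\<close>; all entries of the tensor then vanish, although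
      both factors are nonzero.\<close>
    then have "lift w z $ i = 0 * (0 + 0)" "lift w z $ i = 0 * (0 - 0)" for i by simp_all
    note sum_difference_proportional [OF this(1) [of 1, unfolded lift_nth] this(2) [of 2, unfolded lift_nth]]
      sum_difference_proportional [OF this(1) [of 5, unfolded lift_nth] this(2) [of 4, unfolded lift_nth]]
    then have "w $ Inl 3 * w $ Inr 3 = 0" "w $ Inl 4 * w $ Inr 4 = 0"
      "w $ Inl 3 * w $ Inr 4 = 0" "w $ Inl 4 * w $ Inr 3 = 0"
      by simp_all
    with w show False by auto
  qed
  moreover have "(w $ Inl 1 * w $ Inr 1)^2 = ((w $ Inl 3)^2 + (w $ Inl 4)^2) * ((w $ Inr 3)^2 + (w $ Inr 4)^2)"
    "(w $ Inl 2 * w $ Inr 2)^2 = ((w $ Inl 3)^2 - (w $ Inl 4)^2) * ((w $ Inr 3)^2 - (w $ Inr 4)^2)"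
    using w by (simp_all add: power_mult_distrib)
  ultimately show ?thesis
    unfolding box_cone_def radicand_def
    by (auto simp: algebra_simps power2_eq_square)
qed

lemma box_cone_over:
  assumes "w \<in> EE_cone" "v \<in> box_cone" "over w v"
  shows "(v $ 3)^2 = radicand w"
  using assms lift_in_box_cone unfolding over_def by metis

lemma box_sigma_nth: "box_sigma v $ i = (if i = 3 then - v $ i else v $ i)"
  by (simp add: box_sigma_def)

lemma box_sigma_eq_neg: "box_sigma v = neg 3 v"
  by (simp add: vec_eq_iff box_sigma_nth neg_nth)

lemma box_sigma_in_box_cone: "v \<in> box_cone \<Longrightarrow> box_sigma v \<in> box_cone"
  by (auto simp: box_cone_def box_sigma_nth) (metis box_sigma_box_sigma box_sigma_nth vec_eq_iff zero_index neg_0_equal_iff_equal)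

section \<open>Fibres of the correspondence\<close>

lemma rank_one_factors_unique_aux:
  fixes c :: complex
  assumes "c \<noteq> 0" "c' \<noteq> 0 \<or> d' \<noteq> 0" "m \<noteq> 0"
    and "C * C' = m * (c * c')" "C * D' = m * (c * d')" "D * C' = m * (d * c')" "D * D' = m * (d * d')"
  shows "\<exists>s t. s \<noteq> 0 \<and> t \<noteq> 0 \<and> m = s * t \<and> C = s * c \<and> D = s * d \<and> C' = t * c' \<and> D' = t * d'"
proof -
  have "C \<noteq> 0" using assms by auto
  define s where "s = C / c"
  define t where "t = m / s"
  have st: "s \<noteq> 0" "t \<noteq> 0" "m = s * t" "C = s * c"
    using \<open>C \<noteq> 0\<close> assms(1,3) by (auto simp: s_def t_def)
  have C': "C' = t * c'"
    using assms(4) st assms(1) by (simp add: mult_ac)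
  have D': "D' = t * d'"
    using assms(5) st assms(1) by (simp add: mult_ac)
  have "D = s * d"
    using assms(2,6,7) st(1,2) unfolding C' D' st(3) by auto
  with st C' D' show ?thesis by blast
qed

text \<open>Proportional nonzero tensors of rank one have proportional factors. A nonzero entry of
  the first factor fixes \<open>s\<close> as a quotient and then \<open>t = m / s\<close>;
  exchanging the two rows covers the other case.\<close>

lemma rank_one_factors_unique:
  fixes c :: complex
  assumes "c \<noteq> 0 \<or> d \<noteq> 0" "c' \<noteq> 0 \<or> d' \<noteq> 0" "m \<noteq> 0"
    and "C * C' = m * (c * c')" "C * D' = m * (c * d')" "D * C' = m * (d * c')" "D * D' = m * (d * d')"
  shows "\<exists>s t. s \<noteq> 0 \<and> t \<noteq> 0 \<and> m = s * t \<and> C = s * c \<and> D = s * d \<and> C' = t * c' \<and> D' = t * d'"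
  using assms(1)
proof
  assume "c \<noteq> 0"
  then show ?thesis
    by (rule rank_one_factors_unique_aux) (fact assms)+
next
  assume "d \<noteq> 0"
  then have "\<exists>s t. s \<noteq> 0 \<and> t \<noteq> 0 \<and> m = s * t \<and> D = s * d \<and> C = s * c \<and> C' = t * c' \<and> D' = t * d'"
    by (rule rank_one_factors_unique_aux) (fact assms)+
  then show ?thesis by blast
qed

text \<open>The squares leave a sign for each root, and the product forbids opposite signs. If one
  of the roots is zero, its sign is free and can be matched to the other.\<close>

lemma common_sign:
  fixes x :: complex
  assumes "X^2 = s^2 * x^2" "Y^2 = t^2 * y^2" "X * Y = s * t * (x * y)" "s \<noteq> 0" "t \<noteq> 0"
  obtains \<epsilon> where "\<epsilon> \<in> {1, -1}" "X = \<epsilon> * s * x" "Y = \<epsilon> * t * y"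
proof -
  have X: "X = s * x \<or> X = - (s * x)" and Y: "Y = t * y \<or> Y = - (t * y)"
    using assms(1,2) by (simp_all add: power2_eq_iff flip: power_mult_distrib)
  show thesis
  proof (cases "x = 0 \<or> y = 0")
    case True
    then show thesis
      using X Y that [of 1] that [of "-1"] by auto
  next
    case False
    then have "X * Y \<noteq> - (s * t * (x * y))"
      using assms(3-5) by simp
    with X Y show thesis
      using that [of 1] that [of "-1"] by auto
  qed
qed

text \<open>Read from left to right this makes the map well defined on orbits, and from right to
  left the inverse map.\<close>

lemma orbit_eq_iff_over:
  assumes w: "w1 \<in> EE_cone" "w2 \<in> EE_cone" and v: "v1 \<in> box_cone" "v2 \<in> box_cone"
    and over: "over w1 v1" "over w2 v2"
  shows "EE_orbit w1 = EE_orbit w2 \<longleftrightarrow> box_orbit v1 = box_orbit v2"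
proof
  assume "EE_orbit w1 = EE_orbit w2"
  then obtain s t \<epsilon> \<eta> where st: "s \<noteq> 0" "t \<noteq> 0" "\<epsilon> \<in> {1, -1}" "\<eta> \<in> {1, -1}"
      and l: "left w2 = (\<chi> i. (if i = 1 then \<epsilon> else if i = 2 then \<eta> else 1) * s * left w1 $ i)"
      and r: "right w2 = (\<chi> i. (if i = 1 then \<epsilon> else if i = 2 then \<eta> else 1) * t * right w1 $ i)"
    unfolding EE_orbit_eq_iff by blast
  have l': "w2 $ Inl i = (if i = 1 then \<epsilon> else if i = 2 then \<eta> else 1) * s * w1 $ Inl i" for i
    using arg_cong [OF l, of "\<lambda>x. x $ i"] by simp
  have r': "w2 $ Inr i = (if i = 1 then \<epsilon> else if i = 2 then \<eta> else 1) * t * w1 $ Inr i" for i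
    using arg_cong [OF r, of "\<lambda>x. x $ i"] by simp
  have "radicand w2 = (s * t)^2 * radicand w1"
    unfolding radicand_def by (simp add: l' r' power2_eq_square algebra_simps)
  then have "(v2 $ 3)^2 = (s * t * v1 $ 3)^2"
    using box_cone_over w v over by (simp add: power_mult_distrib)
  \<comment> \<open>The signs enter only squared, through \<open>aa'\<close> and \<open>bb'\<close>,
    so \<open>lift\<close> sees nothing but the scalar \<open>s * t\<close>.\<close>
  moreover have lift: "lift w2 (s * t * z) = (s * t) *s lift w1 z" for z
    using st(3,4) by (auto simp: vec_eq_iff forall_7 l' r' algebra_simps)
  ultimately have "v2 = (s * t) *s v1 \<or> v2 = (s * t) *s box_sigma v1"
  proof -
    assume "(v2 $ 3)^2 = (s * t * v1 $ 3)^2"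
    then consider "v2 $ 3 = s * t * v1 $ 3" | "v2 $ 3 = s * t * (- v1 $ 3)"
      by (auto simp: power2_eq_iff)
    then show ?thesis
    proof cases
      case 1
      then show ?thesis using over lift unfolding over_def by metis
    next
      case 2
      have "box_sigma v1 = lift w1 (- v1 $ 3)"
        using over(1) unfolding over_def
        by (auto simp: vec_eq_iff box_sigma_nth forall_7)
      with 2 show ?thesis using over(2) lift unfolding over_def by metis
    qed
  qed
  with st(1,2) show "box_orbit v1 = box_orbit v2"
    unfolding box_orbit_eq_iff by (metis no_zero_divisors)
next
  assume "box_orbit v1 = box_orbit v2"
  then obtain m where m: "m \<noteq> 0" "v2 = m *s v1 \<or> v2 = m *s box_sigma v1"
    unfolding box_orbit_eq_iff by blast
  have nth: "lift w2 (v2 $ 3) $ i = m * lift w1 (v1 $ 3) $ i" if "i \<noteq> 3" for i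
  proof -
    have "v2 $ i = m * v1 $ i" using m(2) that by (auto simp: box_sigma_nth)
    with over show ?thesis unfolding over_def by metis
  qed
  note w1 = w(1) [unfolded EE_cone_coordinates] and w2 = w(2) [unfolded EE_cone_coordinates]
  have n: "lift w2 (v2 $ 3) $ 1 = m * lift w1 (v1 $ 3) $ 1" "lift w2 (v2 $ 3) $ 2 = m * lift w1 (v1 $ 3) $ 2"
    "lift w2 (v2 $ 3) $ 4 = m * lift w1 (v1 $ 3) $ 4" "lift w2 (v2 $ 3) $ 5 = m * lift w1 (v1 $ 3) $ 5"
    by (rule nth, simp)+
  have p: "w2 $ Inl 3 * w2 $ Inr 3 = m * (w1 $ Inl 3 * w1 $ Inr 3)"
    "w2 $ Inl 4 * w2 $ Inr 4 = m * (w1 $ Inl 4 * w1 $ Inr 4)"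
    using sum_difference_proportional [OF n(1) [unfolded lift_nth] n(2) [unfolded lift_nth]] by simp_all
  have q: "w2 $ Inl 3 * w2 $ Inr 4 = m * (w1 $ Inl 3 * w1 $ Inr 4)"
    "w2 $ Inl 4 * w2 $ Inr 3 = m * (w1 $ Inl 4 * w1 $ Inr 3)"
    using sum_difference_proportional [OF n(4) [unfolded lift_nth] n(3) [unfolded lift_nth]] by simp_all
  obtain s t where st: "s \<noteq> 0" "t \<noteq> 0" "m = s * t"
      and cd: "w2 $ Inl 3 = s * w1 $ Inl 3" "w2 $ Inl 4 = s * w1 $ Inl 4"
        "w2 $ Inr 3 = t * w1 $ Inr 3" "w2 $ Inr 4 = t * w1 $ Inr 4"
    using rank_one_factors_unique [OF _ _ m(1) p(1) q(1) q(2) p(2)] w1 by blast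
  have sq: "(w2 $ Inl 1)^2 = (w2 $ Inl 3)^2 + (w2 $ Inl 4)^2" "(w2 $ Inr 1)^2 = (w2 $ Inr 3)^2 + (w2 $ Inr 4)^2"
    "(w2 $ Inl 2)^2 = (w2 $ Inl 3)^2 - (w2 $ Inl 4)^2" "(w2 $ Inr 2)^2 = (w2 $ Inr 3)^2 - (w2 $ Inr 4)^2"
    "(w1 $ Inl 1)^2 = (w1 $ Inl 3)^2 + (w1 $ Inl 4)^2" "(w1 $ Inr 1)^2 = (w1 $ Inr 3)^2 + (w1 $ Inr 4)^2"
    "(w1 $ Inl 2)^2 = (w1 $ Inl 3)^2 - (w1 $ Inl 4)^2" "(w1 $ Inr 2)^2 = (w1 $ Inr 3)^2 - (w1 $ Inr 4)^2"
    using w1 w2 by blast+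
  have ab: "(w2 $ Inl 1)^2 = s^2 * (w1 $ Inl 1)^2" "(w2 $ Inr 1)^2 = t^2 * (w1 $ Inr 1)^2"
    "(w2 $ Inl 2)^2 = s^2 * (w1 $ Inl 2)^2" "(w2 $ Inr 2)^2 = t^2 * (w1 $ Inr 2)^2"
    unfolding sq cd by (simp_all add: algebra_simps power_mult_distrib)
  have prods: "w2 $ Inl 1 * w2 $ Inr 1 = s * t * (w1 $ Inl 1 * w1 $ Inr 1)"
    "w2 $ Inl 2 * w2 $ Inr 2 = s * t * (w1 $ Inl 2 * w1 $ Inr 2)"
    using nth [of 7] nth [of 6] by (simp_all add: st(3))
  obtain \<epsilon> where \<epsilon>: "\<epsilon> \<in> {1, -1}" "w2 $ Inl 1 = \<epsilon> * s * w1 $ Inl 1" "w2 $ Inr 1 = \<epsilon> * t * w1 $ Inr 1"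
    by (rule common_sign [OF ab(1,2) prods(1) st(1,2)])
  obtain \<eta> where \<eta>: "\<eta> \<in> {1, -1}" "w2 $ Inl 2 = \<eta> * s * w1 $ Inl 2" "w2 $ Inr 2 = \<eta> * t * w1 $ Inr 2"
    by (rule common_sign [OF ab(3,4) prods(2) st(1,2)])
  show "EE_orbit w1 = EE_orbit w2"
    unfolding EE_orbit_eq_iff
    by (intro exI [of _ s] exI [of _ t] exI [of _ \<epsilon>] exI [of _ \<eta>] conjI)
      (use st \<epsilon> \<eta> cd in \<open>simp_all add: vec_eq_iff forall_4\<close>)
qed

section \<open>Nearby partners on the box cone and holomorphy of the map\<close>

lemma ex_over_box:
  assumes "w \<in> EE_cone"
  shows "\<exists>v\<in>box_cone. over w v"
  using lift_in_box_cone [OF assms, of "csqrt (radicand w)"]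
  by (intro bexI [of _ "lift w (csqrt (radicand w))"]) auto

text \<open>Squaring is an open map: for any root \<open>y\<close> of \<open>t\<close>, the product
  of the distances from \<open>z0\<close> to \<open>y\<close> and to \<open>-y\<close> is the
  distance from \<open>t\<close> to \<open>z0^2\<close>, so it being below \<open>e^2\<close> forces
  one of them below \<open>e\<close>.\<close>

lemma near_root:
  fixes z0 :: complex
  assumes "eventually P (nhds z0)"
  shows "\<forall>\<^sub>F t in nhds (z0^2). \<exists>z. z^2 = t \<and> P z"
proof -
  obtain e where e: "e > 0" "\<And>z. dist z z0 < e \<Longrightarrow> P z"
    using assms unfolding eventually_nhds_metric by blast
  have "\<exists>z. z^2 = t \<and> P z" if "dist t (z0^2) < e^2" for t
  proof -
    define y where "y = csqrt t"
    have "norm (y - z0) * norm (y + z0) < e * e"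
      using that by (simp add: y_def dist_norm power2_eq_square algebra_simps flip: norm_mult)
        (metis power2_csqrt power2_eq_square)
    then have "norm (y - z0) < e \<or> norm (y + z0) < e"
      by (smt (verit, ccfv_threshold) mult_mono norm_ge_zero e(1))
    moreover have "norm (y + z0) = dist (- y) z0"
      by (simp add: dist_norm) (metis add.commute minus_add_distrib norm_minus_cancel uminus_add_conv_diff diff_conv_add_uminus)
    ultimately have "P y \<or> P (- y)"
      using e(2) by (auto simp: dist_norm)
    then show ?thesis
      by (metis y_def power2_csqrt power2_minus)
  qed
  with e(1) show ?thesis
    unfolding eventually_nhds_metric by (intro exI [of _ "e^2"]) auto
qed

text \<open>A neighbourhood contains a product of neighbourhoods, so that coordinates given by roots
  can be treated separately from those that vary continuously.\<close>

lemma eventually_nhds_vecD: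
  fixes w0 :: "complex^'n"
  assumes "eventually P (nhds w0)"
  shows "\<exists>Q. (\<forall>i. eventually (Q i) (nhds (w0 $ i))) \<and> (\<forall>w. (\<forall>i. Q i (w $ i)) \<longrightarrow> P w)"
proof -
  obtain S where S: "open S" "w0 \<in> S" "\<And>w. w \<in> S \<Longrightarrow> P w"
    using assms unfolding eventually_nhds by blast
  then obtain A where A: "\<And>i. open (A i) \<and> w0 $ i \<in> A i" "\<And>w. (\<forall>i. w $ i \<in> A i) \<Longrightarrow> w \<in> S"
    unfolding open_vec_def by metis
  show ?thesis
    by (rule exI [of _ "\<lambda>i x. x \<in> A i"]) (use A S(3) in \<open>auto intro: eventually_nhds_in_open\<close>)
qed

lemma hol_at_lift:
  assumes "hol_at g w"
  shows "hol_at (\<lambda>w. lift w (g w) $ i) w"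
proof -
  have "\<forall>i. hol_at (\<lambda>w. lift w (g w) $ i) w"
    unfolding forall_7 by (simp add: hol_at_intros assms)
  then show ?thesis by blast
qed

lemma hol_at_radicand: "hol_at radicand w"
proof -
  have "hol_at (\<lambda>w. radicand w) w"
    unfolding radicand_def by (intro hol_at_intros)
  then show ?thesis .
qed

text \<open>All coordinates but the third are continuous in \<open>w\<close> and do not depend on
  \<open>z\<close>, so they may be controlled with \<open>z0\<close> in place of \<open>z\<close>;
  \<open>near_root\<close> supplies the third.\<close>

lemma lift_lower_semicontinuous:
  assumes "eventually P (nhds (lift w0 z0))" "z0^2 = radicand w0"
  shows "\<forall>\<^sub>F w in nhds w0. \<exists>z. z^2 = radicand w \<and> P (lift w z)"
proof -
  obtain Q where Q: "\<And>i. eventually (Q i) (nhds (lift w0 z0 $ i))" "\<And>v. (\<And>i. Q i (v $ i)) \<Longrightarrow> P v"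
    using eventually_nhds_vecD [OF assms(1)] by blast
  have "\<forall>\<^sub>F w in nhds w0. i \<noteq> 3 \<longrightarrow> Q i (lift w z0 $ i)" for i
    using eventually_nhds_isCont [OF hol_at_imp_isCont [OF hol_at_lift [OF hol_at_const]] Q(1)]
    by (auto elim: eventually_mono)
  then have "\<forall>\<^sub>F w in nhds w0. \<forall>i. i \<noteq> 3 \<longrightarrow> Q i (lift w z0 $ i)"
    by (rule eventually_all_finite)
  moreover have "\<forall>\<^sub>F t in nhds (radicand w0). \<exists>z. z^2 = t \<and> Q 3 z"
    using near_root [of "Q 3" z0] Q(1) [of 3] assms(2) by simp
  then have "\<forall>\<^sub>F w in nhds w0. \<exists>z. z^2 = radicand w \<and> Q 3 z"
    by (rule eventually_nhds_isCont [OF hol_at_imp_isCont [OF hol_at_radicand]])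
  ultimately show ?thesis
  proof eventually_elim
    case (elim w)
    then obtain z where z: "z^2 = radicand w" "Q 3 z" by blast
    have "lift w z $ i = lift w z0 $ i" if "i \<noteq> 3" for i
      using that by (simp add: lift_def)
    with z elim have "P (lift w z)"
      by (intro Q(2)) (metis lift_nth(3))
    with z(1) show ?case by blast
  qed
qed

text \<open>An ambient germ that is even in \<open>Z3\<close> depends on \<open>v\<close> only
  through \<open>sq 3 v\<close>, and for \<open>v\<close> over \<open>w\<close> this vector is
  \<open>lift w (radicand w)\<close>, which is polynomial in \<open>w\<close>. So the root drops out
  of the pullback.\<close>

lemma space_morphism_over:
  assumes \<phi>: "\<And>w v. w \<in> EE_cone \<Longrightarrow> v \<in> box_cone \<Longrightarrow> over w v \<Longrightarrow> \<phi> (EE_orbit w) = box_orbit v"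
  shows "space_morphism (quotient_space (hol_affine EE_cone) EE_orbit)
    (quotient_space (hol_affine box_cone) box_orbit) \<phi>"
proof (rule space_morphism_hol_quotients [where L = over and S = EE_cone and T = box_cone
      and \<pi> = EE_orbit and \<rho> = box_orbit and \<phi> = \<phi>])
  fix w v assume "w \<in> EE_cone" "v \<in> box_cone" "over w v"
  then show "\<phi> (EE_orbit w) = box_orbit v" by (rule \<phi>)
next
  fix w0 assume w0: "w0 \<in> EE_cone"
  then obtain v0 where v0: "v0 \<in> box_cone" "over w0 v0"
    using ex_over_box by blast
  define z0 where "z0 = v0 $ 3"
  have v0_eq: "v0 = lift w0 z0" and z0: "z0^2 = radicand w0"
    using v0 box_cone_over [OF w0] by (auto simp: over_def z0_def)
  have lsc: "\<forall>\<^sub>F w in nhds w0. w \<in> EE_cone \<longrightarrow> (\<exists>v\<in>box_cone. over w v \<and> P v)"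
    if P: "eventually P (nhds v0)" for P
    using lift_lower_semicontinuous [OF P [unfolded v0_eq] z0]
    by eventually_elim (metis lift_in_box_cone over_lift)
  have "\<exists>k. hol_at k w0 \<and> (\<forall>\<^sub>F w in nhds w0. w \<in> EE_cone \<longrightarrow> f (\<phi> (EE_orbit w)) = k w)"
    if h: "hol_at h v0" and f: "\<forall>\<^sub>F v in nhds v0. v \<in> box_cone \<longrightarrow> f (box_orbit v) = h v" for h f
  proof -
    \<comment> \<open>The average agrees with \<open>h\<close> on \<open>box_cone\<close> because
      \<open>f\<close> is constant on orbits. If \<open>Z3\<close> is nonzero at \<open>v0\<close>,
      the reflection moves \<open>v0\<close> to a point near which nothing is known about
      \<open>h\<close>, and \<open>even_division\<close> asks for no evenness there.\<close>
    define h' where "h' = (if v0 $ 3 = 0 then \<lambda>v. (h v + h (neg 3 v)) / 2 else h)"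
    have n0: "neg 3 v0 = v0" if "v0 $ 3 = 0"
      using that by (simp add: vec_eq_iff neg_nth)
    have h': "hol_at h' v0"
    proof (cases "v0 $ 3 = 0")
      case True
      have "hol_at (\<lambda>v. h (neg 3 v)) v0"
        by (rule hol_at_compose) (simp_all add: n0 [OF True] h hol_at_nth_neg)
      then show ?thesis
        using True h by (simp add: h'_def) (intro hol_at_intros; simp)
    qed (simp add: h'_def h)
    have "\<forall>\<^sub>F v in nhds v0. v \<in> box_cone \<longrightarrow> f (box_orbit v) = h' v"
    proof (cases "v0 $ 3 = 0")
      case True
      have orb: "box_orbit (neg 3 v) = box_orbit v" for v
        by (auto simp: box_orbit_eq box_sigma_eq_neg [symmetric])
      have "\<forall>\<^sub>F v in nhds v0. neg 3 v \<in> box_cone \<longrightarrow> f (box_orbit (neg 3 v)) = h (neg 3 v)"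
        using eventually_nhds_neg [of _ 3 v0] f by (simp add: n0 [OF True])
      with f show ?thesis
      proof eventually_elim
        case (elim v)
        then show ?case
          using box_sigma_in_box_cone [of v] True by (auto simp: h'_def orb box_sigma_eq_neg)
      qed
    qed (use f in \<open>simp add: h'_def\<close>)
    moreover have "h' (neg 3 v) = h' v" if "v0 $ 3 = 0" for v
    proof -
      have "neg 3 (neg 3 v) = v" by (simp add: vec_eq_iff neg_nth)
      with that show ?thesis by (simp add: h'_def)
    qed
    then have "v0 $ 3 = 0 \<Longrightarrow> \<forall>\<^sub>F v in nhds v0. h' (neg 3 v) = h' v"
      by simp
    then obtain A where A: "hol_at A (sq 3 v0)" "\<forall>\<^sub>F v in nhds v0. h' v = A (sq 3 v)"
      by (rule even_division [OF h'])
    ultimately have "\<forall>\<^sub>F v in nhds v0. v \<in> box_cone \<longrightarrow> f (box_orbit v) = A (sq 3 v)"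
      by eventually_elim simp
    from lsc [OF this] have "\<forall>\<^sub>F w in nhds w0. w \<in> EE_cone \<longrightarrow> f (\<phi> (EE_orbit w)) = A (lift w (radicand w))"
    proof eventually_elim
      case (elim w)
      show ?case
      proof
        assume w: "w \<in> EE_cone"
        with elim obtain v where v: "v \<in> box_cone" "over w v" "f (box_orbit v) = A (sq 3 v)" by blast
        have "sq 3 v = lift w ((v $ 3)^2)"
          using v(2) sq_lift unfolding over_def by metis
        then have "sq 3 v = lift w (radicand w)"
          by (simp add: box_cone_over [OF w v(1,2)])
        with v \<phi> [OF w v(1,2)] show "f (\<phi> (EE_orbit w)) = A (lift w (radicand w))" by simp
      qed
    qed
    moreover have "sq 3 v0 = lift w0 (radicand w0)"
      using z0 by (simp add: v0_eq sq_lift)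
    with A(1) have "hol_at A (lift w0 (radicand w0))" by simp
    then have "hol_at (\<lambda>w. A (lift w (radicand w))) w0"
      by (rule hol_at_compose) (intro hol_at_lift hol_at_radicand)
    ultimately show ?thesis by blast
  qed
  with v0 lsc show "\<exists>v0\<in>box_cone. over w0 v0 \<and>
      (\<forall>P. (\<forall>\<^sub>F v in nhds v0. P v) \<longrightarrow> (\<forall>\<^sub>F w in nhds w0. w \<in> EE_cone \<longrightarrow> (\<exists>v\<in>box_cone. over w v \<and> P v))) \<and>
      (\<forall>h f. hol_at h v0 \<longrightarrow> (\<forall>\<^sub>F v in nhds v0. v \<in> box_cone \<longrightarrow> f (box_orbit v) = h v) \<longrightarrow>
        (\<exists>k. hol_at k w0 \<and> (\<forall>\<^sub>F w in nhds w0. w \<in> EE_cone \<longrightarrow> f (\<phi> (EE_orbit w)) = k w)))"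
    by blast
qed

section \<open>The inverse map\<close>

text \<open>The average is taken only if the simultaneous sign change fixes \<open>w0\<close>;
  otherwise the germ at \<open>w0\<close> carries no information about the reflected point.\<close>

definition pair_average :: "'n \<Rightarrow> 'n \<Rightarrow> complex^'n \<Rightarrow> (complex^'n \<Rightarrow> complex) \<Rightarrow> complex^'n \<Rightarrow> complex" where
  "pair_average i j w0 h =
     (if w0 $ i = 0 \<and> w0 $ j = 0 then \<lambda>w. (h w + h (neg j (neg i w))) / 2 else h)"

lemma neg_pair_fixed: "w0 $ i = 0 \<Longrightarrow> w0 $ j = 0 \<Longrightarrow> neg j (neg i w0) = w0"
  by (auto simp: vec_eq_iff neg_nth)

lemma neg_pair_involution: "i \<noteq> j \<Longrightarrow> neg j (neg i (neg j (neg i w))) = w"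
  by (auto simp: vec_eq_iff neg_nth)

lemma eventually_nhds_neg_pair:
  assumes "eventually P (nhds w0)" "w0 $ i = 0" "w0 $ j = 0"
  shows "\<forall>\<^sub>F w in nhds w0. P (neg j (neg i w))"
proof -
  have "\<forall>\<^sub>F w in nhds (neg i w0). P (neg j w)"
    by (rule eventually_nhds_neg) (simp add: neg_pair_fixed assms)
  then show ?thesis by (rule eventually_nhds_neg)
qed

lemma hol_at_pair_average:
  assumes h: "hol_at h w0"
  shows "hol_at (pair_average i j w0 h) w0"
proof (cases "w0 $ i = 0 \<and> w0 $ j = 0")
  case True
  then have "hol_at h (neg j (neg i w0))"
    using h by (simp add: neg_pair_fixed)
  then have "hol_at (\<lambda>w. h (neg j w)) (neg i w0)"
    by (rule hol_at_compose) (rule hol_at_nth_neg)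
  then have "hol_at (\<lambda>w. h (neg j (neg i w))) w0"
    by (rule hol_at_compose) (rule hol_at_nth_neg)
  with h have "hol_at (\<lambda>w. (h w + h (neg j (neg i w))) / 2) w0"
    by (intro hol_at_intros) auto
  with True show ?thesis by (simp add: pair_average_def)
next
  case False
  then have "pair_average i j w0 h = h"
    by (auto simp: pair_average_def)
  with h show ?thesis by simp
qed

lemma pair_average_even:
  assumes "i \<noteq> j" "w0 $ i = 0" "w0 $ j = 0"
  shows "pair_average i j w0 h (neg j (neg i w)) = pair_average i j w0 h w"
  using assms by (simp add: pair_average_def neg_pair_involution add.commute)

lemma eventually_eq_pair_average:
  assumes eq: "\<forall>\<^sub>F w in nhds w0. w \<in> S \<longrightarrow> f w = h w"
    and inv: "\<And>w. w \<in> S \<Longrightarrow> neg j (neg i w) \<in> S \<and> f (neg j (neg i w)) = f w"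
  shows "\<forall>\<^sub>F w in nhds w0. w \<in> S \<longrightarrow> f w = pair_average i j w0 h w"
proof (cases "w0 $ i = 0 \<and> w0 $ j = 0")
  case True
  then have "\<forall>\<^sub>F w in nhds w0. neg j (neg i w) \<in> S \<longrightarrow> f (neg j (neg i w)) = h (neg j (neg i w))"
    using eventually_nhds_neg_pair [OF eq] by blast
  with eq show ?thesis
  proof eventually_elim
    case (elim w)
    show ?case
    proof
      assume "w \<in> S"
      with elim inv [of w] have "h w = f w" "h (neg j (neg i w)) = f w" by auto
      with True show "f w = pair_average i j w0 h w" by (simp add: pair_average_def)
    qed
  qed
next
  case False
  then have "pair_average i j w0 h = h"
    by (auto simp: pair_average_def)
  with eq show ?thesis by simp
qed

text \<open>The coefficients of the division in \<open>i, j\<close> are divided again in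
  \<open>k, l\<close>. They are not known to be even in the second pair, so they are averaged first;
  evenness of \<open>h\<close> ensures that the averaged coefficients still represent it.\<close>

lemma two_even_pairs_division:
  fixes h :: "complex^'n \<Rightarrow> complex"
  assumes h: "hol_at h w0" and dist: "i \<noteq> j" "k \<noteq> l" "k \<noteq> i" "k \<noteq> j" "l \<noteq> i" "l \<noteq> j"
    and even1: "w0 $ i = 0 \<Longrightarrow> w0 $ j = 0 \<Longrightarrow> \<forall>\<^sub>F w in nhds w0. h (neg j (neg i w)) = h w"
    and even2: "w0 $ k = 0 \<Longrightarrow> w0 $ l = 0 \<Longrightarrow> \<forall>\<^sub>F w in nhds w0. h (neg l (neg k w)) = h w"
  defines "z \<equiv> \<lambda>w. sq l (sq k (sq j (sq i w)))"
  shows "\<exists>A B C D. hol_at A (z w0) \<and> hol_at B (z w0) \<and> hol_at C (z w0) \<and> hol_at D (z w0) \<and>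
    (\<forall>\<^sub>F w in nhds w0. h w = A (z w) + w $ i * w $ j * B (z w) + w $ k * w $ l * C (z w) +
      w $ i * w $ j * w $ k * w $ l * D (z w))"
proof -
  define y where "y = (\<lambda>w :: complex^'n. sq j (sq i w))"
  obtain A B where AB: "hol_at A (y w0)" "hol_at B (y w0)"
    "\<forall>\<^sub>F w in nhds w0. h w = A (y w) + w $ i * w $ j * B (y w)"
    unfolding y_def by (rule even_pair_division [OF h dist(1) even1])
  define A' where "A' = pair_average k l (y w0) A"
  define B' where "B' = pair_average k l (y w0) B"
  have y_kl: "y w $ k = w $ k" "y w $ l = w $ l" for w
    using dist by (simp_all add: y_def sq_nth)
  have A'B': "\<forall>\<^sub>F w in nhds w0. h w = A' (y w) + w $ i * w $ j * B' (y w)"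
  proof (cases "w0 $ k = 0 \<and> w0 $ l = 0")
    case True
    have n: "y (neg l (neg k w)) = neg l (neg k (y w))" "neg l (neg k w) $ i = w $ i" "neg l (neg k w) $ j = w $ j" for w
      using dist by (auto simp: vec_eq_iff y_def neg_nth sq_nth)
    have "\<forall>\<^sub>F w in nhds w0. h (neg l (neg k w)) = A (neg l (neg k (y w))) + w $ i * w $ j * B (neg l (neg k (y w)))"
      using eventually_nhds_neg_pair [OF AB(3), of k l] True by (simp add: n)
    moreover have "\<forall>\<^sub>F w in nhds w0. h (neg l (neg k w)) = h w"
      using True even2 by blast
    ultimately show ?thesis
      using AB(3)
    proof eventually_elim
      case (elim w)
      have avg: "2 * A' (y w) = A (y w) + A (neg l (neg k (y w)))"
        "2 * B' (y w) = B (y w) + B (neg l (neg k (y w)))"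
        using True by (simp_all add: A'_def B'_def pair_average_def y_kl)
      have "2 * h w = (A (y w) + A (neg l (neg k (y w)))) + w $ i * w $ j * (B (y w) + B (neg l (neg k (y w))))"
        using elim by (simp add: algebra_simps)
      also have "\<dots> = 2 * (A' (y w) + w $ i * w $ j * B' (y w))"
        unfolding avg [symmetric] by (simp add: algebra_simps)
      finally show ?case unfolding mult_cancel_left by simp
    qed
  next
    case False
    then have "A' = A" "B' = B"
      by (auto simp: A'_def B'_def pair_average_def y_kl)
    with AB(3) show ?thesis by simp
  qed
  obtain A0 A1 where A: "hol_at A0 (z w0)" "hol_at A1 (z w0)"
    "\<forall>\<^sub>F u in nhds (y w0). A' u = A0 (sq l (sq k u)) + u $ k * u $ l * A1 (sq l (sq k u))"
    unfolding A'_def z_def y_def [symmetric]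
    using even_pair_division [OF hol_at_pair_average [OF AB(1), of k l] dist(2)]
      pair_average_even [OF dist(2)] unfolding y_def by (smt (verit, best) always_eventually)
  obtain B0 B1 where B: "hol_at B0 (z w0)" "hol_at B1 (z w0)"
    "\<forall>\<^sub>F u in nhds (y w0). B' u = B0 (sq l (sq k u)) + u $ k * u $ l * B1 (sq l (sq k u))"
    unfolding B'_def z_def y_def [symmetric]
    using even_pair_division [OF hol_at_pair_average [OF AB(2), of k l] dist(2)]
      pair_average_even [OF dist(2)] unfolding y_def by (smt (verit, best) always_eventually)
  have ev: "\<forall>\<^sub>F w in nhds w0. P (y w)" if "eventually P (nhds (y w0))" for P
    using eventually_nhds_sq [OF eventually_nhds_sq [OF that [unfolded y_def]]] by (simp add: y_def)
  have "\<forall>\<^sub>F w in nhds w0. h w = A0 (z w) + w $ i * w $ j * B0 (z w) + w $ k * w $ l * A1 (z w) +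
      w $ i * w $ j * w $ k * w $ l * B1 (z w)"
    using A'B' ev [OF A(3)] ev [OF B(3)]
  proof eventually_elim
    case (elim w)
    have "sq l (sq k (y w)) = z w" by (simp add: z_def y_def)
    with elim show ?case by (simp add: y_kl algebra_simps)
  qed
  with A(1,2) B(1,2) show ?thesis by blast
qed

section \<open>Pairs of square roots with prescribed product\<close>

lemma exact_roots:
  fixes u :: complex
  assumes "m^2 = u * v"
  shows "\<exists>x y. x^2 = u \<and> y^2 = v \<and> x * y = m"
proof -
  obtain x y where xy: "x^2 = u" "y^2 = v"
    by (metis power2_csqrt)
  then have "(x * y)^2 = m^2"
    using assms by (simp add: power_mult_distrib)
  then have "x * y = m \<or> x * (- y) = m"
    by (auto simp: power2_eq_iff)
  with xy show ?thesis
    by (metis power2_minus)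
qed

text \<open>A root \<open>x\<close> of \<open>u\<close> is chosen near \<open>x0\<close>; then
  \<open>y = m / x\<close> is forced. It is close to \<open>y0\<close> by continuity of division,
  and the equation \<open>m^2 = u * v\<close> makes it a root of \<open>v\<close>.\<close>

lemma near_roots_nonzero:
  fixes x0 :: complex
  assumes P: "eventually P (nhds x0)" and Q: "eventually Q (nhds y0)" and x0: "x0 \<noteq> 0"
  shows "\<exists>U M. eventually U (nhds (x0^2)) \<and> eventually M (nhds (x0 * y0)) \<and>
    (\<forall>u m v. U u \<longrightarrow> M m \<longrightarrow> m^2 = u * v \<longrightarrow> (\<exists>x y. x^2 = u \<and> y^2 = v \<and> x * y = m \<and> P x \<and> Q y))"
proof -
  have "\<forall>\<^sub>F p in nhds (x0, x0 * y0). Q (snd p / fst p)"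
  proof (rule eventually_nhds_isCont [where P = Q])
    show "isCont (\<lambda>p. snd p / fst p) (x0, x0 * y0)"
      using x0 by (intro continuous_intros) auto
    show "eventually Q (nhds (snd (x0, x0 * y0) / fst (x0, x0 * y0)))"
      using Q x0 by simp
  qed
  then obtain X M where XM: "eventually X (nhds x0)" "eventually M (nhds (x0 * y0))"
      "\<And>x m. X x \<Longrightarrow> M m \<Longrightarrow> Q (m / x)"
    unfolding nhds_prod eventually_prod_filter by auto
  have "\<forall>\<^sub>F x in nhds x0. P x \<and> X x \<and> x \<noteq> 0"
    by (intro eventually_conj P XM t1_space_nhds x0)
  then have "\<forall>\<^sub>F u in nhds (x0^2). \<exists>x. x^2 = u \<and> P x \<and> X x \<and> x \<noteq> 0"
    by (rule near_root)
  moreover have "\<exists>x y. x^2 = u \<and> y^2 = v \<and> x * y = m \<and> P x \<and> Q y"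
    if u: "\<exists>x. x^2 = u \<and> P x \<and> X x \<and> x \<noteq> 0" and m: "M m" "m^2 = u * v" for u m v
  proof -
    obtain x where x: "x^2 = u" "P x" "X x" "x \<noteq> 0" using u by blast
    have "(m / x)^2 = v" using m(2) x(4) unfolding x(1) [symmetric] by (simp add: power_divide)
    with x m XM(3) show ?thesis by (intro exI [of _ x] exI [of _ "m / x"]) auto
  qed
  ultimately show ?thesis
    using XM(2) by blast
qed

text \<open>Openness of the map from \<open>(x, y)\<close> to \<open>(x^2, x * y, y^2)\<close> onto
  the cone \<open>m^2 = u * v\<close>, including its vertex.\<close>

lemma near_roots:
  fixes x0 :: complex
  assumes P: "eventually P (nhds x0)" and Q: "eventually Q (nhds y0)"
  shows "\<exists>U M V. eventually U (nhds (x0^2)) \<and> eventually M (nhds (x0 * y0)) \<and> eventually V (nhds (y0^2)) \<and>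
    (\<forall>u m v. U u \<longrightarrow> M m \<longrightarrow> V v \<longrightarrow> m^2 = u * v \<longrightarrow>
      (\<exists>x y. x^2 = u \<and> y^2 = v \<and> x * y = m \<and> P x \<and> Q y))"
proof -
  consider "x0 \<noteq> 0" | "y0 \<noteq> 0" | "x0 = 0" "y0 = 0" by blast
  then show ?thesis
  proof cases
    case 1
    obtain U M where "eventually U (nhds (x0^2))" "eventually M (nhds (x0 * y0))"
        "\<forall>u m v. U u \<longrightarrow> M m \<longrightarrow> m^2 = u * v \<longrightarrow> (\<exists>x y. x^2 = u \<and> y^2 = v \<and> x * y = m \<and> P x \<and> Q y)"
      using near_roots_nonzero [OF P Q 1] by blast
    then show ?thesis
      by (intro exI [of _ U] exI [of _ M] exI [of _ "\<lambda>_. True"]) auto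
  next
    case 2
    obtain V M where VM: "eventually V (nhds (y0^2))" "eventually M (nhds (y0 * x0))"
        "\<And>v m u. V v \<Longrightarrow> M m \<Longrightarrow> m^2 = v * u \<Longrightarrow> (\<exists>y x. y^2 = v \<and> x^2 = u \<and> y * x = m \<and> Q y \<and> P x)"
      using near_roots_nonzero [OF Q P 2] by blast
    have "\<exists>x y. x^2 = u \<and> y^2 = v \<and> x * y = m \<and> P x \<and> Q y" if m: "M m" "V v" "m^2 = u * v" for u m v
    proof -
      have "m^2 = v * u" using m(3) by (simp only: mult.commute)
      then obtain y x where "y^2 = v" "x^2 = u" "y * x = m" "Q y" "P x"
        using VM(3) [OF m(2,1)] by blast
      then show ?thesis
        by (intro exI [of _ x] exI [of _ y]) (simp add: mult.commute)
    qed
    with VM(1,2) show ?thesis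
      by (intro exI [of _ "\<lambda>_. True"] exI [of _ M] exI [of _ V]) (simp add: mult.commute)
  next
    \<comment> \<open>At the vertex \<open>m / x\<close> is not controlled. Instead \<open>y\<close>
      is taken so small that \<open>y\<close> and \<open>-y\<close> both satisfy \<open>Q\<close>,
      and its sign is adjusted to give the product \<open>m\<close>.\<close>
    case 3
    have "\<forall>\<^sub>F y in nhds 0. Q (- y)"
      by (rule eventually_nhds_isCont [where P = Q]) (use Q 3 in auto)
    with Q have "\<forall>\<^sub>F y in nhds y0. Q y \<and> Q (- y)"
      unfolding 3 by (rule eventually_conj)
    then have "\<forall>\<^sub>F v in nhds (y0^2). \<exists>y. y^2 = v \<and> Q y \<and> Q (- y)"
      by (rule near_root)
    moreover have "\<forall>\<^sub>F u in nhds (x0^2). \<exists>x. x^2 = u \<and> P x"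
      using P by (rule near_root)
    moreover have "\<exists>x y. x^2 = u \<and> y^2 = v \<and> x * y = m \<and> P x \<and> Q y"
      if u: "\<exists>x. x^2 = u \<and> P x" and v: "\<exists>y. y^2 = v \<and> Q y \<and> Q (- y)" and m: "m^2 = u * v" for u m v
    proof -
      obtain x y where xy: "x^2 = u" "P x" "y^2 = v" "Q y" "Q (- y)" using u v by blast
      then have "(x * y)^2 = m^2"
        using m by (simp add: power_mult_distrib)
      then have "x * y = m \<or> x * (- y) = m"
        by (auto simp: power2_eq_iff)
      with xy show ?thesis
        by (metis power2_minus)
    qed
    ultimately show ?thesis
      by (intro exI [of _ "\<lambda>u. \<exists>x. x^2 = u \<and> P x"] exI [of _ "\<lambda>_. True"]
          exI [of _ "\<lambda>v. \<exists>y. y^2 = v \<and> Q y \<and> Q (- y)"]) simp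
  qed
qed

section \<open>Local factorization of the tensor on the box variety\<close>

definition pt where
  "pt a b c d a' b' c' d' = join (\<chi> i :: 4. if i = 1 then a else if i = 2 then b else if i = 3 then c else d)
     (\<chi> i :: 4. if i = 1 then a' else if i = 2 then b' else if i = 3 then c' else (d' :: complex))"

lemma pt_nth [simp]:
  "pt a b c d a' b' c' d' $ Inl 1 = a" "pt a b c d a' b' c' d' $ Inl 2 = b"
  "pt a b c d a' b' c' d' $ Inl 3 = c" "pt a b c d a' b' c' d' $ Inl 4 = d"
  "pt a b c d a' b' c' d' $ Inr 1 = a'" "pt a b c d a' b' c' d' $ Inr 2 = b'"
  "pt a b c d a' b' c' d' $ Inr 3 = c'" "pt a b c d a' b' c' d' $ Inr 4 = d'"
  by (simp_all add: pt_def)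

lemma forall_4_plus_4:
  "(\<forall>i :: 4 + 4. P i) \<longleftrightarrow> P (Inl 1) \<and> P (Inl 2) \<and> P (Inl 3) \<and> P (Inl 4) \<and>
     P (Inr 1) \<and> P (Inr 2) \<and> P (Inr 3) \<and> P (Inr 4)"
  by (auto simp: forall_4 split_sum_all)

lemma hol_at_pt:
  assumes "hol_at a v" "hol_at b v" "hol_at c v" "hol_at d v" "hol_at a' v" "hol_at b' v" "hol_at c' v" "hol_at d' v"
  shows "hol_at (\<lambda>v. pt (a v) (b v) (c v) (d v) (a' v) (b' v) (c' v) (d' v) $ i) v"
proof -
  have "\<forall>i. hol_at (\<lambda>v. pt (a v) (b v) (c v) (d v) (a' v) (b' v) (c' v) (d' v) $ i) v"
    unfolding forall_4_plus_4 using assms by simp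
  then show ?thesis ..
qed

text \<open>In the notation of the map, \<open>p, q, r, s\<close> are
  \<open>cc', cd', dc', dd'\<close>, and \<open>p * s = q * r\<close> is the relation between
  differences of squares. If all four vanish, so do \<open>Z1, Z2, W1, W2\<close>, and the relations
  then force the remaining coordinates to vanish.\<close>

lemma box_cone_tensor:
  assumes "v \<in> box_cone"
  defines "p \<equiv> (v $ 1 + v $ 2) / 2" and "s \<equiv> (v $ 1 - v $ 2) / 2"
    and "q \<equiv> (v $ 5 + v $ 4) / 2" and "r \<equiv> (v $ 5 - v $ 4) / 2"
  shows "p * s = q * r" "p \<noteq> 0 \<or> q \<noteq> 0 \<or> r \<noteq> 0 \<or> s \<noteq> 0"
    "(v $ 7)^2 = p^2 + q^2 + r^2 + s^2" "(v $ 6)^2 = p^2 - q^2 - r^2 + s^2"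
proof -
  have v: "(v $ 4)^2 + (v $ 5)^2 = (v $ 3)^2" "(v $ 4)^2 + (v $ 6)^2 = (v $ 2)^2"
    "(v $ 5)^2 + (v $ 6)^2 = (v $ 1)^2" "(v $ 4)^2 + (v $ 5)^2 + (v $ 6)^2 = (v $ 7)^2" "v \<noteq> 0"
    using assms(1) by (auto simp: box_cone_def)
  have e: "v $ 1 = p + s" "v $ 2 = p - s" "v $ 5 = q + r" "v $ 4 = q - r"
    by (simp_all add: p_def q_def r_def s_def flip: add_divide_distrib diff_divide_distrib)
  have "(p + s)^2 - (p - s)^2 = (q + r)^2 - (q - r)^2"
    using v(2,3) unfolding e by algebra
  moreover have "(x + y)^2 - (x - y)^2 = 4 * (x * y)" for x y :: complex
    by (simp add: power2_eq_square algebra_simps)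
  ultimately show "p * s = q * r" by simp
  show v7: "(v $ 7)^2 = p^2 + q^2 + r^2 + s^2" and v6: "(v $ 6)^2 = p^2 - q^2 - r^2 + s^2"
    using v(2-4) unfolding e by algebra+
  show "p \<noteq> 0 \<or> q \<noteq> 0 \<or> r \<noteq> 0 \<or> s \<noteq> 0"
  proof (rule ccontr)
    assume "\<not> (p \<noteq> 0 \<or> q \<noteq> 0 \<or> r \<noteq> 0 \<or> s \<noteq> 0)"
    then have z: "p = 0" "q = 0" "r = 0" "s = 0" by auto
    have "(v $ 7)^2 = 0" "(v $ 6)^2 = 0" "(v $ 3)^2 = 0"
      using v(1) unfolding v6 v7 unfolding e z by simp_all
    then have "v = 0"
      using e by (simp add: vec_eq_iff forall_7 z)
    with v(5) show False ..
  qed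
qed

text \<open>The tensor \<open>((cc', cd'), (dc', dd'))\<close> has rank one on the box variety.  A chart is a local
  holomorphic factorization of it.\<close>

definition chart :: "(complex^7 \<Rightarrow> complex) \<Rightarrow> (complex^7 \<Rightarrow> complex) \<Rightarrow> (complex^7 \<Rightarrow> complex) \<Rightarrow>
    (complex^7 \<Rightarrow> complex) \<Rightarrow> complex^7 \<Rightarrow> bool" where
  "chart c d c' d' v \<longleftrightarrow> c v * c' v = (v $ 1 + v $ 2) / 2 \<and> d v * d' v = (v $ 1 - v $ 2) / 2 \<and>
     c v * d' v = (v $ 5 + v $ 4) / 2 \<and> d v * c' v = (v $ 5 - v $ 4) / 2"

text \<open>Some entry of the matrix with rows \<open>(p, q)\<close> and \<open>(r, s)\<close> is
  nonzero at \<open>v0\<close>. The row through it serves as \<open>(c', d')\<close>; the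
  corresponding coordinate of \<open>(c, d)\<close> is 1, and the other is the ratio of the two
  entries in the column of the nonzero entry.\<close>

lemma ex_chart:
  assumes v0: "v0 \<in> box_cone"
  shows "\<exists>c d c' d'. hol_at c v0 \<and> hol_at d v0 \<and> hol_at c' v0 \<and> hol_at d' v0 \<and>
    (\<forall>\<^sub>F v in nhds v0. v \<in> box_cone \<longrightarrow> chart c d c' d' v)"
proof -
  define p where "p = (\<lambda>v :: complex^7. (v $ 1 + v $ 2) / 2)"
  define s where "s = (\<lambda>v :: complex^7. (v $ 1 - v $ 2) / 2)"
  define q where "q = (\<lambda>v :: complex^7. (v $ 5 + v $ 4) / 2)"
  define r where "r = (\<lambda>v :: complex^7. (v $ 5 - v $ 4) / 2)"
  have hol: "hol_at p v0" "hol_at q v0" "hol_at r v0" "hol_at s v0"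
    unfolding p_def q_def r_def s_def by (intro hol_at_intros; simp)+
  have ps: "p v * s v = q v * r v" if "v \<in> box_cone" for v
    using box_cone_tensor(1) [OF that] by (simp add: p_def q_def r_def s_def)
  have chart: "chart c d c' d' v \<longleftrightarrow> c v * c' v = p v \<and> d v * d' v = s v \<and> c v * d' v = q v \<and> d v * c' v = r v"
    for c d c' d' v
    by (simp add: chart_def p_def q_def r_def s_def)
  have nz: "\<forall>\<^sub>F v in nhds v0. g v \<noteq> 0" if "hol_at g v0" "g v0 \<noteq> 0" for g
    by (rule eventually_nhds_isCont [OF hol_at_imp_isCont [OF that(1)], where P = "\<lambda>z. z \<noteq> 0"])
      (rule t1_space_nhds [OF that(2)])
  consider "p v0 \<noteq> 0" | "q v0 \<noteq> 0" | "r v0 \<noteq> 0" | "s v0 \<noteq> 0"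
    using box_cone_tensor(2) [OF v0] unfolding p_def q_def r_def s_def by blast
  then show ?thesis
  proof cases
    case 1
    show ?thesis
    proof (intro exI conjI)
      show "\<forall>\<^sub>F v in nhds v0. v \<in> box_cone \<longrightarrow> chart (\<lambda>v. 1) (\<lambda>v. r v / p v) p q v"
        using nz [OF hol(1) 1] by eventually_elim (auto simp: chart ps field_simps)
    qed (intro hol_at_intros hol 1)+
  next
    case 2
    show ?thesis
    proof (intro exI conjI)
      show "\<forall>\<^sub>F v in nhds v0. v \<in> box_cone \<longrightarrow> chart (\<lambda>v. 1) (\<lambda>v. s v / q v) p q v"
        using nz [OF hol(2) 2] by eventually_elim (auto simp: chart ps field_simps)
    qed (intro hol_at_intros hol 2)+
  next
    case 3
    show ?thesis
    proof (intro exI conjI)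
      show "\<forall>\<^sub>F v in nhds v0. v \<in> box_cone \<longrightarrow> chart (\<lambda>v. p v / r v) (\<lambda>v. 1) r s v"
        using nz [OF hol(3) 3] by eventually_elim (auto simp: chart ps field_simps)
    qed (intro hol_at_intros hol 3)+
  next
    case 4
    show ?thesis
    proof (intro exI conjI)
      show "\<forall>\<^sub>F v in nhds v0. v \<in> box_cone \<longrightarrow> chart (\<lambda>v. q v / s v) (\<lambda>v. 1) r s v"
        using nz [OF hol(4) 4] by eventually_elim (auto simp: chart field_simps dest: ps)
    qed (intro hol_at_intros hol 4)+
  qed
qed

text \<open>These are the relations \<open>m^2 = u * v\<close> under which roots for
  \<open>a, a'\<close> and for \<open>b, b'\<close> with the correct product exist.\<close>

lemma chart_products:
  assumes "v \<in> box_cone" "chart c d c' d' v"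
  shows "(v $ 7)^2 = ((c v)^2 + (d v)^2) * ((c' v)^2 + (d' v)^2)"
    and "(v $ 6)^2 = ((c v)^2 - (d v)^2) * ((c' v)^2 - (d' v)^2)"
proof -
  note ch = assms(2) [unfolded chart_def]
  note v = box_cone_tensor(3,4) [OF assms(1)]
  show "(v $ 7)^2 = ((c v)^2 + (d v)^2) * ((c' v)^2 + (d' v)^2)"
    using v(1) unfolding ch [THEN conjunct1, symmetric] ch [THEN conjunct2, THEN conjunct1, symmetric]
      ch [THEN conjunct2, THEN conjunct2, THEN conjunct1, symmetric]
      ch [THEN conjunct2, THEN conjunct2, THEN conjunct2, symmetric]
    by (simp add: power_mult_distrib algebra_simps)
  show "(v $ 6)^2 = ((c v)^2 - (d v)^2) * ((c' v)^2 - (d' v)^2)"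
    using v(2) unfolding ch [THEN conjunct1, symmetric] ch [THEN conjunct2, THEN conjunct1, symmetric]
      ch [THEN conjunct2, THEN conjunct2, THEN conjunct1, symmetric]
      ch [THEN conjunct2, THEN conjunct2, THEN conjunct2, symmetric]
    by (simp add: power_mult_distrib algebra_simps)
qed

lemma pt_over:
  assumes v: "v \<in> box_cone" and ch: "chart c d c' d' v"
    and a: "a^2 = (c v)^2 + (d v)^2" "a'^2 = (c' v)^2 + (d' v)^2" "a * a' = v $ 7"
    and b: "b^2 = (c v)^2 - (d v)^2" "b'^2 = (c' v)^2 - (d' v)^2" "b * b' = v $ 6"
  defines "w \<equiv> pt a b (c v) (d v) a' b' (c' v) (d' v)"
  shows "w \<in> EE_cone" "over w v"
proof -
  note ch' = ch [unfolded chart_def]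
  have "(c v \<noteq> 0 \<or> d v \<noteq> 0) \<and> (c' v \<noteq> 0 \<or> d' v \<noteq> 0)"
    using box_cone_tensor(2) [OF v] ch' by (metis mult_zero_left mult_zero_right)
  with a b show "w \<in> EE_cone"
    unfolding EE_cone_coordinates w_def by simp
  have half: "(x + y) / 2 + (x - y) / 2 = x" "(x + y) / 2 - (x - y) / 2 = y" for x y :: complex
    by (simp_all add: field_simps)
  have "lift w (v $ 3) $ i = v $ i" for i
  proof -
    have "\<forall>i. lift w (v $ 3) $ i = v $ i"
      unfolding forall_7 lift_nth w_def pt_nth by (simp only: ch' half a(3) b(3) simp_thms)
    then show ?thesis ..
  qed
  then show "over w v"
    by (simp add: over_def vec_eq_iff)
qed

lemma over_nth:
  assumes "over w v"
  shows "v $ 6 = w $ Inl 2 * w $ Inr 2" "v $ 7 = w $ Inl 1 * w $ Inr 1"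
  using assms lift_nth(6,7) unfolding over_def by metis+

lemma EE_orbit_neg:
  "EE_orbit (neg (Inr 1) (neg (Inl 1) w)) = EE_orbit w"
  "EE_orbit (neg (Inr 2) (neg (Inl 2) w)) = EE_orbit w"
proof -
  show "EE_orbit (neg (Inr 1) (neg (Inl 1) w)) = EE_orbit w"
    unfolding EE_orbit_eq_iff
    by (intro exI [of _ 1] exI [of _ "-1"]) (simp add: vec_eq_iff forall_4 neg_nth)
  show "EE_orbit (neg (Inr 2) (neg (Inl 2) w)) = EE_orbit w"
    unfolding EE_orbit_eq_iff
    by (rule exI [of _ 1], rule exI [of _ 1], rule exI [of _ 1], rule exI [of _ "-1"])
      (simp add: vec_eq_iff forall_4 neg_nth)
qed

lemma EE_cone_neg:
  assumes "w \<in> EE_cone"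
  shows "neg (Inr 1) (neg (Inl 1) w) \<in> EE_cone" "neg (Inr 2) (neg (Inl 2) w) \<in> EE_cone"
  using assms unfolding EE_cone_coordinates by (simp_all add: neg_nth)

section \<open>Partners in the square of the elliptic curve\<close>

lemma ex_over_EE:
  assumes v: "v \<in> box_cone"
  shows "\<exists>w\<in>EE_cone. over w v"
proof -
  obtain c d c' d' where "\<forall>\<^sub>F x in nhds v. x \<in> box_cone \<longrightarrow> chart c d c' d' x"
    using ex_chart [OF v] by blast
  then have ch: "chart c d c' d' v"
    using v by (auto dest: eventually_nhds_x_imp_x)
  obtain a a' where "a^2 = (c v)^2 + (d v)^2" "a'^2 = (c' v)^2 + (d' v)^2" "a * a' = v $ 7"
    using exact_roots [OF chart_products(1) [OF v ch]] by blast
  moreover obtain b b' where "b^2 = (c v)^2 - (d v)^2" "b'^2 = (c' v)^2 - (d' v)^2" "b * b' = v $ 6"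
    using exact_roots [OF chart_products(2) [OF v ch]] by blast
  ultimately show ?thesis
    using pt_over [OF v ch] by blast
qed

text \<open>The chart supplies \<open>c, d, c', d'\<close> continuously, and
  \<open>near_roots\<close> supplies the two pairs of roots. That the partner has exactly the chart
  values as coordinates is recorded because the squares of its other coordinates thereby become
  functions of \<open>v\<close>.\<close>

lemma pt_lower_semicontinuous:
  assumes hol: "hol_at c v0" "hol_at d v0" "hol_at c' v0" "hol_at d' v0"
    and ch: "\<forall>\<^sub>F v in nhds v0. v \<in> box_cone \<longrightarrow> chart c d c' d' v"
    and a: "a^2 = (c v0)^2 + (d v0)^2" "a'^2 = (c' v0)^2 + (d' v0)^2" "a * a' = v0 $ 7"
    and b: "b^2 = (c v0)^2 - (d v0)^2" "b'^2 = (c' v0)^2 - (d' v0)^2" "b * b' = v0 $ 6"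
    and P: "eventually P (nhds (pt a b (c v0) (d v0) a' b' (c' v0) (d' v0)))"
  shows "\<forall>\<^sub>F v in nhds v0. v \<in> box_cone \<longrightarrow> (\<exists>w\<in>EE_cone. over w v \<and> P w \<and>
    w $ Inl 3 = c v \<and> w $ Inl 4 = d v \<and> w $ Inr 3 = c' v \<and> w $ Inr 4 = d' v)"
proof -
  obtain Q where Q: "\<And>i. eventually (Q i) (nhds (pt a b (c v0) (d v0) a' b' (c' v0) (d' v0) $ i))"
      "\<And>w. (\<And>i. Q i (w $ i)) \<Longrightarrow> P w"
    using eventually_nhds_vecD [OF P] by blast
  note ev = eventually_nhds_isCont [OF hol_at_imp_isCont]
  have cd: "\<forall>\<^sub>F v in nhds v0. Q (Inl 3) (c v)" "\<forall>\<^sub>F v in nhds v0. Q (Inl 4) (d v)"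
    "\<forall>\<^sub>F v in nhds v0. Q (Inr 3) (c' v)" "\<forall>\<^sub>F v in nhds v0. Q (Inr 4) (d' v)"
    using ev [OF hol(1), of "Q (Inl 3)"] ev [OF hol(2), of "Q (Inl 4)"]
      ev [OF hol(3), of "Q (Inr 3)"] ev [OF hol(4), of "Q (Inr 4)"]
      Q(1) [of "Inl 3"] Q(1) [of "Inl 4"] Q(1) [of "Inr 3"] Q(1) [of "Inr 4"] by simp_all
  have "eventually (Q (Inl 1)) (nhds a)" "eventually (Q (Inr 1)) (nhds a')"
    using Q(1) [of "Inl 1"] Q(1) [of "Inr 1"] by simp_all
  then obtain U M V where UMV: "eventually U (nhds (a^2))" "eventually M (nhds (a * a'))" "eventually V (nhds (a'^2))"
      "\<And>u m v. U u \<Longrightarrow> M m \<Longrightarrow> V v \<Longrightarrow> m^2 = u * v \<Longrightarrow>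
        (\<exists>x y. x^2 = u \<and> y^2 = v \<and> x * y = m \<and> Q (Inl 1) x \<and> Q (Inr 1) y)"
    using near_roots [of "Q (Inl 1)" a "Q (Inr 1)" a'] by blast
  have "eventually (Q (Inl 2)) (nhds b)" "eventually (Q (Inr 2)) (nhds b')"
    using Q(1) [of "Inl 2"] Q(1) [of "Inr 2"] by simp_all
  then obtain U' M' V' where UMV': "eventually U' (nhds (b^2))" "eventually M' (nhds (b * b'))" "eventually V' (nhds (b'^2))"
      "\<And>u m v. U' u \<Longrightarrow> M' m \<Longrightarrow> V' v \<Longrightarrow> m^2 = u * v \<Longrightarrow>
        (\<exists>x y. x^2 = u \<and> y^2 = v \<and> x * y = m \<and> Q (Inl 2) x \<and> Q (Inr 2) y)"
    using near_roots [of "Q (Inl 2)" b "Q (Inr 2)" b'] by blast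
  have "\<forall>\<^sub>F v in nhds v0. U ((c v)^2 + (d v)^2)" "\<forall>\<^sub>F v in nhds v0. V ((c' v)^2 + (d' v)^2)"
    "\<forall>\<^sub>F v in nhds v0. U' ((c v)^2 - (d v)^2)" "\<forall>\<^sub>F v in nhds v0. V' ((c' v)^2 - (d' v)^2)"
    "\<forall>\<^sub>F v in nhds v0. M (v $ 7)" "\<forall>\<^sub>F v in nhds v0. M' (v $ 6)"
    by (rule ev, (intro hol_at_intros hol)[1], use UMV(1-3) UMV'(1-3) a b in simp)+
  then show ?thesis
    using ch cd
  proof eventually_elim
    case (elim v)
    show ?case
    proof
      assume v: "v \<in> box_cone"
      with elim have ch: "chart c d c' d' v" by blast
      obtain x x' where x: "x^2 = (c v)^2 + (d v)^2" "x'^2 = (c' v)^2 + (d' v)^2" "x * x' = v $ 7"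
          "Q (Inl 1) x" "Q (Inr 1) x'"
        using UMV(4) [OF elim(1,5,2) chart_products(1) [OF v ch]] by blast
      obtain y y' where y: "y^2 = (c v)^2 - (d v)^2" "y'^2 = (c' v)^2 - (d' v)^2" "y * y' = v $ 6"
          "Q (Inl 2) y" "Q (Inr 2) y'"
        using UMV'(4) [OF elim(3,6,4) chart_products(2) [OF v ch]] by blast
      let ?w = "pt x y (c v) (d v) x' y' (c' v) (d' v)"
      have "\<forall>i. Q i (?w $ i)"
        unfolding forall_4_plus_4 using x y elim by simp
      then have "P ?w" by (intro Q(2)) blast
      with pt_over [OF v ch x(1-3) y(1-3)]
      show "\<exists>w\<in>EE_cone. over w v \<and> P w \<and> w $ Inl 3 = c v \<and> w $ Inl 4 = d v \<and> w $ Inr 3 = c' v \<and> w $ Inr 4 = d' v"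
        by (intro bexI [of _ ?w]) simp_all
    qed
  qed
qed

text \<open>After averaging over both signs of \<open>H\<close>, a germ is a combination of
  \<open>aa'\<close>, \<open>bb'\<close> and \<open>aa'bb'\<close> with coefficients in the squares.
  The products are coordinates of \<open>v\<close>, and the squares are holomorphic in
  \<open>v\<close> through the chart, so no root remains.\<close>

lemma space_morphism_over_inverse:
  assumes \<psi>: "\<And>w v. w \<in> EE_cone \<Longrightarrow> v \<in> box_cone \<Longrightarrow> over w v \<Longrightarrow> \<psi> (box_orbit v) = EE_orbit w"
  shows "space_morphism (quotient_space (hol_affine box_cone) box_orbit)
    (quotient_space (hol_affine EE_cone) EE_orbit) \<psi>"
proof (rule space_morphism_hol_quotients [where L = "\<lambda>v w. over w v" and S = box_cone and T = EE_cone
      and \<pi> = box_orbit and \<rho> = EE_orbit and \<phi> = \<psi>])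
  fix w v assume "w \<in> EE_cone" "v \<in> box_cone" "over w v"
  then show "\<psi> (box_orbit v) = EE_orbit w" by (rule \<psi>)
next
  fix v0 assume v0: "v0 \<in> box_cone"
  obtain c d c' d' where hol: "hol_at c v0" "hol_at d v0" "hol_at c' v0" "hol_at d' v0"
      and ch: "\<forall>\<^sub>F v in nhds v0. v \<in> box_cone \<longrightarrow> chart c d c' d' v"
    using ex_chart [OF v0] by blast
  have ch0: "chart c d c' d' v0"
    using v0 ch by (auto dest: eventually_nhds_x_imp_x)
  obtain a a' where a: "a^2 = (c v0)^2 + (d v0)^2" "a'^2 = (c' v0)^2 + (d' v0)^2" "a * a' = v0 $ 7"
    using exact_roots [OF chart_products(1) [OF v0 ch0]] by blast
  obtain b b' where b: "b^2 = (c v0)^2 - (d v0)^2" "b'^2 = (c' v0)^2 - (d' v0)^2" "b * b' = v0 $ 6"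
    using exact_roots [OF chart_products(2) [OF v0 ch0]] by blast
  define w0 where "w0 = pt a b (c v0) (d v0) a' b' (c' v0) (d' v0)"
  have w0: "w0 \<in> EE_cone" "over w0 v0"
    unfolding w0_def using pt_over [OF v0 ch0 a b] by blast+
  have lsc: "\<forall>\<^sub>F v in nhds v0. v \<in> box_cone \<longrightarrow> (\<exists>w\<in>EE_cone. over w v \<and> P w \<and>
      w $ Inl 3 = c v \<and> w $ Inl 4 = d v \<and> w $ Inr 3 = c' v \<and> w $ Inr 4 = d' v)"
    if "eventually P (nhds w0)" for P
    by (rule pt_lower_semicontinuous [OF hol ch a b that [unfolded w0_def]])
  \<comment> \<open>This is the value that \<open>sq\<close> in all four root coordinates takes at
    any partner \<open>w\<close> with the chart coordinates, as dictated by the equations of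
    \<open>E\<close>.\<close>
  define \<zeta> where "\<zeta> v = pt ((c v)^2 + (d v)^2) ((c v)^2 - (d v)^2) (c v) (d v)
    ((c' v)^2 + (d' v)^2) ((c' v)^2 - (d' v)^2) (c' v) (d' v)" for v
  define z where "z = (\<lambda>w :: complex^(4 + 4). sq (Inr 2) (sq (Inl 2) (sq (Inr 1) (sq (Inl 1) w))))"
  have z_eq: "z w = \<zeta> v" if "w \<in> EE_cone" "w $ Inl 3 = c v" "w $ Inl 4 = d v" "w $ Inr 3 = c' v" "w $ Inr 4 = d' v"
    for w v
  proof -
    have "\<forall>i. z w $ i = \<zeta> v $ i"
      using that unfolding forall_4_plus_4 EE_cone_coordinates by (simp add: z_def \<zeta>_def sq_nth)
    then show ?thesis by (simp add: vec_eq_iff)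
  qed
  have z0: "z w0 = \<zeta> v0"
    by (rule z_eq [OF w0(1)]) (simp_all add: w0_def)
  have "\<exists>k. hol_at k v0 \<and> (\<forall>\<^sub>F v in nhds v0. v \<in> box_cone \<longrightarrow> f (\<psi> (box_orbit v)) = k v)"
    if h: "hol_at h w0" and f: "\<forall>\<^sub>F w in nhds w0. w \<in> EE_cone \<longrightarrow> f (EE_orbit w) = h w" for h f
  proof -
    define h1 where "h1 = pair_average (Inl 1) (Inr 1) w0 h"
    define h2 where "h2 = pair_average (Inl 2) (Inr 2) w0 h1"
    have h2: "hol_at h2 w0"
      unfolding h2_def h1_def by (intro hol_at_pair_average h)
    have "\<forall>\<^sub>F w in nhds w0. w \<in> EE_cone \<longrightarrow> f (EE_orbit w) = h1 w"
      unfolding h1_def by (rule eventually_eq_pair_average [OF f]) (simp add: EE_orbit_neg EE_cone_neg)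
    then have fh2: "\<forall>\<^sub>F w in nhds w0. w \<in> EE_cone \<longrightarrow> f (EE_orbit w) = h2 w"
      unfolding h2_def by (rule eventually_eq_pair_average) (simp add: EE_orbit_neg EE_cone_neg)
    \<comment> \<open>The second average preserves the symmetry obtained by the first because the
      two sign changes commute.\<close>
    have even1: "h2 (neg (Inr 1) (neg (Inl 1) w)) = h2 w" if "w0 $ Inl 1 = 0" "w0 $ Inr 1 = 0" for w
    proof -
      have h1: "h1 (neg (Inr 1) (neg (Inl 1) w)) = h1 w" for w
        unfolding h1_def by (rule pair_average_even) (simp_all add: that)
      have "neg (Inr 2) (neg (Inl 2) (neg (Inr 1) (neg (Inl 1) w))) =
          neg (Inr 1) (neg (Inl 1) (neg (Inr 2) (neg (Inl 2) w)))" for w :: "complex^(4 + 4)"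
        by (simp add: vec_eq_iff neg_nth)
      then show ?thesis
        unfolding h2_def pair_average_def by (simp add: h1)
    qed
    have even2: "h2 (neg (Inr 2) (neg (Inl 2) w)) = h2 w" if "w0 $ Inl 2 = 0" "w0 $ Inr 2 = 0" for w
      unfolding h2_def by (rule pair_average_even) (simp_all add: that)
    obtain A B C D where hol': "hol_at A (z w0)" "hol_at B (z w0)" "hol_at C (z w0)" "hol_at D (z w0)"
      and ABCD: "\<forall>\<^sub>F w in nhds w0. h2 w = A (z w) + w $ Inl 1 * w $ Inr 1 * B (z w) + w $ Inl 2 * w $ Inr 2 * C (z w) +
        w $ Inl 1 * w $ Inr 1 * w $ Inl 2 * w $ Inr 2 * D (z w)"
      unfolding z_def
      using two_even_pairs_division [OF h2, of "Inl 1" "Inr 1" "Inl 2" "Inr 2"] even1 even2 by auto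
    \<comment> \<open>The normal form of \<open>h2\<close> with \<open>aa'\<close> and
      \<open>bb'\<close> replaced by the coordinates \<open>C\<close> and \<open>W3\<close>, and the
      squares by \<open>\<zeta> v\<close>.\<close>
    define k where "k v = A (\<zeta> v) + v $ 7 * B (\<zeta> v) + v $ 6 * C (\<zeta> v) + v $ 7 * v $ 6 * D (\<zeta> v)" for v
    have "hol_at (\<lambda>v. \<zeta> v $ i) v0" for i
      unfolding \<zeta>_def by (intro hol_at_pt hol_at_intros hol)
    then have \<zeta>: "hol_at (\<lambda>v. g (\<zeta> v)) v0" if "hol_at g (z w0)" for g
      using hol_at_compose that unfolding z0 by blast
    have "hol_at (\<lambda>v. k v) v0"
      unfolding k_def by (intro hol_at_intros \<zeta> hol')
    moreover have "\<forall>\<^sub>F w in nhds w0. w \<in> EE_cone \<longrightarrow> f (EE_orbit w) = A (z w) + w $ Inl 1 * w $ Inr 1 * B (z w) +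
        w $ Inl 2 * w $ Inr 2 * C (z w) + w $ Inl 1 * w $ Inr 1 * w $ Inl 2 * w $ Inr 2 * D (z w)"
      using fh2 ABCD by eventually_elim simp
    from lsc [OF this] have "\<forall>\<^sub>F v in nhds v0. v \<in> box_cone \<longrightarrow> f (\<psi> (box_orbit v)) = k v"
    proof eventually_elim
      case (elim v)
      show ?case
      proof
        assume v: "v \<in> box_cone"
        with elim obtain w where w: "w \<in> EE_cone" "over w v"
          "w $ Inl 3 = c v" "w $ Inl 4 = d v" "w $ Inr 3 = c' v" "w $ Inr 4 = d' v"
          "f (EE_orbit w) = A (z w) + w $ Inl 1 * w $ Inr 1 * B (z w) +
            w $ Inl 2 * w $ Inr 2 * C (z w) + w $ Inl 1 * w $ Inr 1 * w $ Inl 2 * w $ Inr 2 * D (z w)"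
          by blast
        then show "f (\<psi> (box_orbit v)) = k v"
          using \<psi> [OF w(1) v w(2)] z_eq [OF w(1,3-6)] over_nth [OF w(2)]
          by (simp add: k_def mult_ac)
      qed
    qed
    ultimately show ?thesis by blast
  qed
  moreover have "\<forall>\<^sub>F v in nhds v0. v \<in> box_cone \<longrightarrow> (\<exists>w\<in>EE_cone. over w v \<and> P w)"
    if "eventually P (nhds w0)" for P
    using lsc [OF that] by eventually_elim blast
  ultimately show "\<exists>w0\<in>EE_cone. over w0 v0 \<and>
      (\<forall>P. (\<forall>\<^sub>F w in nhds w0. P w) \<longrightarrow> (\<forall>\<^sub>F v in nhds v0. v \<in> box_cone \<longrightarrow> (\<exists>w\<in>EE_cone. over w v \<and> P w))) \<and>
      (\<forall>h f. hol_at h w0 \<longrightarrow> (\<forall>\<^sub>F w in nhds w0. w \<in> EE_cone \<longrightarrow> f (EE_orbit w) = h w) \<longrightarrow>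
        (\<exists>k. hol_at k v0 \<and> (\<forall>\<^sub>F v in nhds v0. v \<in> box_cone \<longrightarrow> f (\<psi> (box_orbit v)) = k v)))"
    using w0 by blast
qed

lemma hol_box_quotient_eq:
  "hol_box_quotient = quotient_space (hol_affine box_cone) box_orbit"
proof -
  have "sigma_orbit \<circ> proj_point = box_orbit"
    by (simp add: fun_eq_iff box_orbit_def)
  then show ?thesis
    by (simp add: hol_box_quotient_def hol_box_def quotient_space_quotient_space)
qed

lemma hol_EE_quotient_eq:
  "hol_EE_quotient = quotient_space (hol_affine EE_cone) EE_orbit"
proof -
  have "H_orbit \<circ> EE_point = EE_orbit"
    by (simp add: fun_eq_iff EE_orbit_def)
  then show ?thesis
    by (simp add: hol_EE_quotient_def hol_EE_def quotient_space_quotient_space)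
qed

section \<open>The algebraic structures\<close>

lemma poly_fun_neg: "-1 \<in> K \<Longrightarrow> F \<in> poly_fun K \<Longrightarrow> (\<lambda>v. - F v) \<in> poly_fun K"
  using poly_fun.mult [OF poly_fun.const [of "-1" K], of F] by simp

lemma poly_fun_diff:
  "-1 \<in> K \<Longrightarrow> F \<in> poly_fun K \<Longrightarrow> G \<in> poly_fun K \<Longrightarrow> (\<lambda>v. F v - G v) \<in> poly_fun K"
  using poly_fun.add [OF _ poly_fun_neg, of F K G] by simp

lemma radicand_poly_fun: "-1 \<in> K \<Longrightarrow> radicand \<in> poly_fun K"
proof -
  assume K: "-1 \<in> K"
  have "(\<lambda>w. radicand w) \<in> poly_fun K"
    unfolding radicand_def power2_eq_square
    by (intro poly_fun.add poly_fun.mult poly_fun_diff poly_fun.coord K)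
  then show ?thesis .
qed

text \<open>Reduction modulo \<open>z^2 = radicand w\<close> to degree at most one in
  \<open>z\<close>. The coefficients stay in \<open>K\<close> because \<open>lift\<close> and
  \<open>radicand\<close> are built from coordinates with sums, differences and products
  only.\<close>

lemma poly_fun_lift:
  assumes K: "0 \<in> K" "1 \<in> K" "-1 \<in> K" and "F \<in> poly_fun K"
  shows "\<exists>P\<in>poly_fun K. \<exists>Q\<in>poly_fun K. \<forall>w z. z^2 = radicand w \<longrightarrow> F (lift w z) = P w + z * Q w"
  using assms(4)
proof induction
  case (const c)
  then show ?case
    using K by (intro bexI [of _ "\<lambda>v. c"] bexI [of _ "\<lambda>v. 0"]) (auto intro: poly_fun.const)
next
  case (coord i)
  have "\<forall>i. \<exists>P\<in>poly_fun K. \<exists>Q\<in>poly_fun K. \<forall>w z. z^2 = radicand w \<longrightarrow> lift w z $ i = P w + z * Q w"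
  proof -
    have *: "\<exists>P\<in>poly_fun K. \<exists>Q\<in>poly_fun K. \<forall>w z. z^2 = radicand w \<longrightarrow> G w = P w + z * Q w"
      if "G \<in> poly_fun K" for G
      using that K by (intro bexI [of _ G] bexI [of _ "\<lambda>v. 0"]) (auto intro: poly_fun.const)
    have z: "\<exists>P\<in>poly_fun K. \<exists>Q\<in>poly_fun K. \<forall>w z. z^2 = radicand w \<longrightarrow> z = P w + z * Q w"
      using K by (intro bexI [of _ "\<lambda>v. 0"] bexI [of _ "\<lambda>v. 1"]) (auto intro: poly_fun.const)
    show ?thesis
      unfolding forall_7 lift_nth
      by (intro conjI * z poly_fun.add poly_fun.mult poly_fun_diff poly_fun.coord K)
  qed
  then show ?case by blast
next
  case (add F G)
  then obtain P Q P' Q' where PQ: "P \<in> poly_fun K" "Q \<in> poly_fun K" "P' \<in> poly_fun K" "Q' \<in> poly_fun K"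
    and eq: "\<And>w z. z^2 = radicand w \<Longrightarrow> F (lift w z) = P w + z * Q w"
      "\<And>w z. z^2 = radicand w \<Longrightarrow> G (lift w z) = P' w + z * Q' w"
    by blast
  show ?case
    by (rule bexI [of _ "\<lambda>w. P w + P' w"], rule bexI [of _ "\<lambda>w. Q w + Q' w"])
      (auto simp: eq algebra_simps intro!: poly_fun.intros PQ)
next
  case (mult F G)
  then obtain P Q P' Q' where PQ: "P \<in> poly_fun K" "Q \<in> poly_fun K" "P' \<in> poly_fun K" "Q' \<in> poly_fun K"
    and eq: "\<And>w z. z^2 = radicand w \<Longrightarrow> F (lift w z) = P w + z * Q w"
      "\<And>w z. z^2 = radicand w \<Longrightarrow> G (lift w z) = P' w + z * Q' w"
    by blast
  have "F (lift w z) * G (lift w z) = P w * P' w + radicand w * (Q w * Q' w) + z * (P w * Q' w + Q w * P' w)"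
    if "z^2 = radicand w" for w z
    unfolding eq [OF that] that [symmetric] by (simp add: algebra_simps power2_eq_square)
  then show ?case
    by (intro bexI [of _ "\<lambda>w. P w * P' w + radicand w * (Q w * Q' w)"] bexI [of _ "\<lambda>w. P w * Q' w + Q w * P' w"])
      (auto intro!: poly_fun.add poly_fun.mult PQ radicand_poly_fun K)
qed

lemma lift_scale: "lift (join (s *s x) (t *s y)) (s * t * z) = (s * t) *s lift (join x y) z"
  by (simp add: vec_eq_iff forall_7 algebra_simps)

lemma radicand_scale: "radicand (join (s *s x) (t *s y)) = (s * t)^2 * radicand (join x y)"
  by (simp add: radicand_def power2_eq_square algebra_simps)

text \<open>The pullback is the part \<open>P\<close> that is even in \<open>Z3\<close>. The
  reduction says nothing about degrees, so bihomogeneity of \<open>P\<close> is derived from that of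
  \<open>F\<close> through \<open>2 * P w = F (lift w z) + F (lift w (- z))\<close>.\<close>

lemma invariant_form_pullback:
  assumes K: "0 \<in> K" "1 \<in> K" "-1 \<in> K" and F: "F \<in> forms K d"
    and inv: "\<forall>v\<in>box_cone. F (box_sigma v) = F v"
  shows "\<exists>P\<in>biforms K (d, d). \<forall>w\<in>EE_cone. \<forall>v\<in>box_cone. over w v \<longrightarrow> F v = P w"
proof -
  have F': "F \<in> poly_fun K" "\<And>s v. F (s *s v) = s ^ d * F v"
    using F by (auto simp: forms_def)
  obtain P Q where PQ: "P \<in> poly_fun K" "Q \<in> poly_fun K"
    "\<And>w z. z^2 = radicand w \<Longrightarrow> F (lift w z) = P w + z * Q w"
    using poly_fun_lift [OF K F'(1)] by blast
  have P: "2 * P w = F (lift w z) + F (lift w (- z))" if "z^2 = radicand w" for w z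
    using PQ(3) [of z w] PQ(3) [of "- z" w] that by simp
  have "P (join (s *s x) (t *s y)) = s ^ d * t ^ d * P (join x y)" for s t x y
  proof -
    \<comment> \<open>A root exists over every pair \<open>x, y\<close>, not only over points of
      \<open>EE_cone\<close>; this matters because \<open>biforms\<close> requires the scaling law
      everywhere.\<close>
    obtain z where z: "z^2 = radicand (join x y)" by (metis power2_csqrt)
    then have "(s * t * z)^2 = radicand (join (s *s x) (t *s y))"
      by (simp add: radicand_scale power_mult_distrib)
    then have "2 * P (join (s *s x) (t *s y)) =
        F (lift (join (s *s x) (t *s y)) (s * t * z)) + F (lift (join (s *s x) (t *s y)) (s * t * (- z)))"
      using P by simp
    also have "\<dots> = s ^ d * t ^ d * (2 * P (join x y))"
      unfolding lift_scale F'(2) P [OF z] by (simp add: algebra_simps power_mult_distrib)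
    finally show ?thesis by simp
  qed
  with PQ(1) have "P \<in> biforms K (d, d)"
    by (simp add: biforms_def)
  moreover have "F v = P w" if w: "w \<in> EE_cone" and v: "v \<in> box_cone" and o: "over w v" for w v
  proof -
    have z: "(v $ 3)^2 = radicand w" by (rule box_cone_over [OF w v o])
    have l: "lift w (v $ 3) = v" using o by (simp add: over_def)
    have "lift w (- v $ 3) $ i = box_sigma (lift w (v $ 3)) $ i" for i
      by (simp add: box_sigma_nth lift_def)
    then have "lift w (- v $ 3) = box_sigma v" by (simp add: vec_eq_iff l)
    then show ?thesis using P [OF z] inv v by (simp add: l)
  qed
  ultimately show ?thesis by blast
qed

lemma sect_alg_space:
  "f \<in> sect (alg_space S q A) U \<longleftrightarrow> (\<forall>p\<in>U. \<exists>N w. \<exists>F\<in>A w. \<exists>G\<in>A w.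
     openin (base (alg_space S q A)) N \<and> p \<in> N \<and> N \<subseteq> U \<and>
     (\<forall>v\<in>S. q v \<in> N \<longrightarrow> G v \<noteq> 0 \<and> f (q v) = F v / G v))"
  by (simp add: alg_space_def Let_def)

text \<open>Invariant forms of degree \<open>d\<close> pull back to forms of weight
  \<open>(d, d)\<close>. This handles the basic open sets and, as numerator and denominator keep
  equal weights, the local fractions.\<close>

lemma space_morphism_algebraic:
  assumes K: "0 \<in> K" "1 \<in> K" "-1 \<in> K"
    and \<phi>: "\<And>w v. w \<in> EE_cone \<Longrightarrow> v \<in> box_cone \<Longrightarrow> over w v \<Longrightarrow> \<phi> (EE_orbit w) = box_orbit v"
  shows "space_morphism (alg_EE_quotient K) (alg_box_quotient K) \<phi>"
proof -
  define A where "A d = {F \<in> forms K d. \<forall>v\<in>box_cone. F (box_sigma v) = F v}" for d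
  define T where "T = topology_generated_by {EE_point ` {w \<in> EE_cone. F w \<noteq> 0} | F e. F \<in> biforms K e}"
  define T' where "T' = topology_generated_by {box_orbit ` {v \<in> box_cone. F v \<noteq> 0} | F d. F \<in> A d}"
  have base_EE: "base (alg_EE K) = T"
    by (simp add: alg_EE_def alg_space_def Let_def T_def)
  have Y: "alg_box_quotient K = alg_space box_cone box_orbit A"
    by (simp add: alg_box_quotient_def A_def [abs_def] box_orbit_def [abs_def])
  have base_Y: "base (alg_box_quotient K) = T'"
    by (simp add: Y alg_space_def Let_def T'_def)
  have base_X: "base (alg_EE_quotient K) = quotient_topology T H_orbit"
    by (simp add: alg_EE_quotient_def quotient_space_def base_EE)
  have topT: "topspace T = EE_point ` EE_cone"
  proof -
    let ?S = "{EE_point ` {w \<in> EE_cone. F w \<noteq> 0} | F e. F \<in> biforms K e}"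
    \<comment> \<open>The constant form of weight zero makes the set of all points a generating open
      set, which identifies the underlying space.\<close>
    have "(\<lambda>w. 1) \<in> biforms K (0, 0)"
      using K(2) by (auto simp: biforms_def intro: poly_fun.const)
    then have "EE_point ` {v \<in> EE_cone. 1 \<noteq> (0::complex)} \<in> ?S"
      by (intro CollectI exI [of _ "\<lambda>w. 1"] exI [of _ "(0, 0)"] conjI refl)
    then have "EE_point ` EE_cone \<in> ?S" by simp
    moreover have "U \<subseteq> EE_point ` EE_cone" if "U \<in> ?S" for U
      using that by blast
    ultimately show ?thesis
      unfolding T_def topology_generated_by_topspace by blast
  qed
  have topT': "topspace T' = box_orbit ` box_cone"
  proof -
    let ?S = "{box_orbit ` {v \<in> box_cone. F v \<noteq> 0} | F d. F \<in> A d}"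
    have "(\<lambda>w. 1) \<in> A 0"
      using K(2) by (auto simp: A_def forms_def intro: poly_fun.const)
    then have "box_orbit ` {v \<in> box_cone. 1 \<noteq> (0::complex)} \<in> ?S"
      by (intro CollectI exI [of _ "\<lambda>w. 1"] exI [of _ "0"] conjI refl)
    then have "box_orbit ` box_cone \<in> ?S" by simp
    moreover have "U \<subseteq> box_orbit ` box_cone" if "U \<in> ?S" for U
      using that by blast
    ultimately show ?thesis
      unfolding T'_def topology_generated_by_topspace by blast
  qed
  have topX: "topspace (quotient_topology T H_orbit) = EE_orbit ` EE_cone"
    by (simp add: topspace_quotient_topology topT image_image EE_orbit_def)
  have pullback: "\<exists>P\<in>biforms K (d, d). \<forall>w\<in>EE_cone. \<forall>v\<in>box_cone. over w v \<longrightarrow> F v = P w" if "F \<in> A d" for F d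
    using that invariant_form_pullback [OF K] by (auto simp: A_def)
  \<comment> \<open>Non-vanishing depends only on the orbit, so membership of an orbit in a basic
    open set can be tested on any representative.\<close>
  have nonzero: "F v' \<noteq> 0" if Fv: "F \<in> A d" "v \<in> box_cone" "F v \<noteq> 0" "box_orbit v = box_orbit v'" for F d v v'
  proof -
    obtain s where "s \<noteq> 0" "v' = s *s v \<or> v' = s *s box_sigma v"
      using Fv(4) unfolding box_orbit_eq_iff by blast
    with Fv(1-3) show ?thesis by (auto simp: A_def forms_def)
  qed
  have cont: "continuous_map (quotient_topology T H_orbit) T' \<phi>"
    unfolding T'_def
  proof (rule continuous_on_generated_topo)
    fix U assume "U \<in> {box_orbit ` {v \<in> box_cone. F v \<noteq> 0} | F d. F \<in> A d}"
    then obtain F d where F: "F \<in> A d" and U: "U = box_orbit ` {v \<in> box_cone. F v \<noteq> 0}" by blast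
    obtain P where P: "P \<in> biforms K (d, d)" "\<And>w v. w \<in> EE_cone \<Longrightarrow> v \<in> box_cone \<Longrightarrow> over w v \<Longrightarrow> F v = P w"
      using pullback [OF F] by blast
    have U_iff: "\<phi> (EE_orbit w) \<in> U \<longleftrightarrow> P w \<noteq> 0" if w: "w \<in> EE_cone" for w
    proof -
      obtain v where v: "v \<in> box_cone" "over w v" using ex_over_box [OF w] by blast
      have "box_orbit v \<in> U \<longleftrightarrow> F v \<noteq> 0"
      proof
        assume "box_orbit v \<in> U"
        then obtain v' where "v' \<in> box_cone" "F v' \<noteq> 0" "box_orbit v' = box_orbit v"
          unfolding U by (elim imageE) auto
        then show "F v \<noteq> 0" by (rule nonzero [OF F])
      next
        assume "F v \<noteq> 0"
        with v(1) show "box_orbit v \<in> U" unfolding U by blast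
      qed
      then show ?thesis by (simp add: \<phi> [OF w v] P(2) [OF w v])
    qed
    have "{p \<in> topspace T. H_orbit p \<in> \<phi> -` U \<inter> topspace (quotient_topology T H_orbit)} = EE_point ` {w \<in> EE_cone. P w \<noteq> 0}"
      unfolding topX unfolding topT using U_iff by (auto simp: EE_orbit_def)
    moreover have "openin T (EE_point ` {w \<in> EE_cone. P w \<noteq> 0})"
      unfolding T_def by (rule topology_generated_by_Basis) (use P(1) in blast)
    ultimately show "openin (quotient_topology T H_orbit) (\<phi> -` U \<inter> topspace (quotient_topology T H_orbit))"
      unfolding openin_quotient_topology by (simp add: topspace_quotient_topology)
  next
    show "\<phi> ` topspace (quotient_topology T H_orbit) \<subseteq> \<Union> {box_orbit ` {v \<in> box_cone. F v \<noteq> 0} | F d. F \<in> A d}"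
    proof -
      have "\<phi> (EE_orbit w) \<in> topspace T'" if "w \<in> EE_cone" for w
        using ex_over_box [OF that] \<phi> [OF that] unfolding topT' by auto
      then show ?thesis
        unfolding topX T'_def topology_generated_by_topspace by blast
    qed
  qed
  have sect: "f \<circ> \<phi> \<in> sect (alg_EE_quotient K) {x \<in> topspace (base (alg_EE_quotient K)). \<phi> x \<in> V}"
    if f: "f \<in> sect (alg_box_quotient K) V" for V f
  proof -
    let ?U = "{p \<in> topspace T. H_orbit p \<in> {x \<in> topspace (base (alg_EE_quotient K)). \<phi> x \<in> V}}"
    have "\<exists>N e. \<exists>P\<in>biforms K e. \<exists>Q\<in>biforms K e. openin T N \<and> p \<in> N \<and> N \<subseteq> ?U \<and>
        (\<forall>w\<in>EE_cone. EE_point w \<in> N \<longrightarrow> Q w \<noteq> 0 \<and> (f \<circ> \<phi> \<circ> H_orbit) (EE_point w) = P w / Q w)"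
      if p: "p \<in> ?U" for p
    proof -
      have "\<phi> (H_orbit p) \<in> V" using p by simp
      then obtain N d F G where FG: "F \<in> A d" "G \<in> A d" and N: "openin T' N" "\<phi> (H_orbit p) \<in> N" "N \<subseteq> V"
        and eq: "\<And>v. v \<in> box_cone \<Longrightarrow> box_orbit v \<in> N \<Longrightarrow> G v \<noteq> 0 \<and> f (box_orbit v) = F v / G v"
        using f unfolding Y sect_alg_space unfolding Y [symmetric] base_Y by metis
      obtain P where P: "P \<in> biforms K (d, d)" "\<And>w v. w \<in> EE_cone \<Longrightarrow> v \<in> box_cone \<Longrightarrow> over w v \<Longrightarrow> F v = P w"
        using pullback [OF FG(1)] by blast
      obtain Q where Q: "Q \<in> biforms K (d, d)" "\<And>w v. w \<in> EE_cone \<Longrightarrow> v \<in> box_cone \<Longrightarrow> over w v \<Longrightarrow> G v = Q w"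
        using pullback [OF FG(2)] by blast
      \<comment> \<open>Open by the continuity just shown. Any partner of a representative of a
        point of \<open>M\<close> has its orbit in \<open>N\<close>, where \<open>f\<close> equals
        \<open>F / G\<close>.\<close>
      define M where "M = {q \<in> topspace T. H_orbit q \<in> {x \<in> topspace (quotient_topology T H_orbit). \<phi> x \<in> N}}"
      have "openin T M"
        using openin_continuous_map_preimage [OF cont N(1)]
        unfolding openin_quotient_topology M_def by blast
      moreover have "p \<in> M" "M \<subseteq> ?U"
        using p N(2,3) by (auto simp: M_def base_X)
      moreover have "Q w \<noteq> 0 \<and> (f \<circ> \<phi> \<circ> H_orbit) (EE_point w) = P w / Q w"
        if w: "w \<in> EE_cone" "EE_point w \<in> M" for w
      proof -
        obtain v where v: "v \<in> box_cone" "over w v" using ex_over_box [OF w(1)] by blast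
        have o: "\<phi> (H_orbit (EE_point w)) = box_orbit v"
          using \<phi> [OF w(1) v] by (simp add: EE_orbit_def)
        then have "box_orbit v \<in> N" using w(2) by (simp add: M_def)
        with eq [OF v(1)] show ?thesis
          by (simp add: o P(2) [OF w(1) v] Q(2) [OF w(1) v])
      qed
      ultimately show ?thesis
        using P(1) Q(1) by blast
    qed
    then have "f \<circ> \<phi> \<circ> H_orbit \<in> sect (alg_EE K) ?U"
      unfolding alg_EE_def sect_alg_space unfolding alg_EE_def [symmetric] base_EE by blast
    then show ?thesis
      unfolding alg_EE_quotient_def quotient_space_def by (simp add: base_EE)
  qed
  show ?thesis
    unfolding space_morphism_def base_X base_Y
    using cont sect by (simp add: base_X)
qed

section \<open>The isomorphism\<close>

theorem mainTheorem13:
  shows "\<exists>\<phi>. space_isomorphism hol_EE_quotient hol_box_quotient \<phi> \<and>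
             space_morphism (alg_EE_quotient gauss_rationals) (alg_box_quotient gauss_rationals) \<phi>"
proof -
  \<comment> \<open>The choice is harmless: by \<open>orbit_eq_iff_over\<close> the orbit obtained
    depends neither on the representative \<open>w\<close> nor on its partner
    \<open>v\<close>.\<close>
  define \<phi> where "\<phi> X = box_orbit (SOME v. v \<in> box_cone \<and> (\<exists>w\<in>EE_cone. X = EE_orbit w \<and> over w v))" for X
  define \<psi> where "\<psi> Y = EE_orbit (SOME w. w \<in> EE_cone \<and> (\<exists>v\<in>box_cone. Y = box_orbit v \<and> over w v))" for Y
  have \<phi>: "\<phi> (EE_orbit w) = box_orbit v" if wv: "w \<in> EE_cone" "v \<in> box_cone" "over w v" for w v
  proof -
    let ?Q = "\<lambda>v. v \<in> box_cone \<and> (\<exists>w'\<in>EE_cone. EE_orbit w = EE_orbit w' \<and> over w' v)"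
    have "?Q v" using wv by blast
    then have "?Q (SOME v. ?Q v)" by (rule someI)
    then show ?thesis
      unfolding \<phi>_def using wv orbit_eq_iff_over by blast
  qed
  have \<psi>: "\<psi> (box_orbit v) = EE_orbit w" if wv: "w \<in> EE_cone" "v \<in> box_cone" "over w v" for w v
  proof -
    let ?Q = "\<lambda>w. w \<in> EE_cone \<and> (\<exists>v'\<in>box_cone. box_orbit v = box_orbit v' \<and> over w v')"
    have "?Q w" using wv by blast
    then have "?Q (SOME w. ?Q w)" by (rule someI)
    then show ?thesis
      unfolding \<psi>_def using wv orbit_eq_iff_over by blast
  qed
  have "space_morphism hol_EE_quotient hol_box_quotient \<phi>"
    unfolding hol_EE_quotient_eq hol_box_quotient_eq by (rule space_morphism_over) (rule \<phi>)
  moreover have "space_morphism hol_box_quotient hol_EE_quotient \<psi>"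
    unfolding hol_EE_quotient_eq hol_box_quotient_eq by (rule space_morphism_over_inverse) (rule \<psi>)
  moreover have "\<psi> (\<phi> X) = X" if X: "X \<in> topspace (base hol_EE_quotient)" for X
  proof -
    obtain w where w: "w \<in> EE_cone" "X = EE_orbit w"
      using X by (auto simp: hol_EE_quotient_eq quotient_space_def topspace_quotient_topology base_hol_affine)
    obtain v where "v \<in> box_cone" "over w v" using ex_over_box [OF w(1)] by blast
    with w show ?thesis by (simp add: \<phi> \<psi>)
  qed
  moreover have "\<phi> (\<psi> Y) = Y" if Y: "Y \<in> topspace (base hol_box_quotient)" for Y
  proof -
    obtain v where v: "v \<in> box_cone" "Y = box_orbit v"
      using Y by (auto simp: hol_box_quotient_eq quotient_space_def topspace_quotient_topology base_hol_affine)
    obtain w where "w \<in> EE_cone" "over w v" using ex_over_EE [OF v(1)] by blast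
    with v show ?thesis by (simp add: \<phi> \<psi>)
  qed
  ultimately have "space_isomorphism hol_EE_quotient hol_box_quotient \<phi>"
    unfolding space_isomorphism_def by blast
  moreover have "space_morphism (alg_EE_quotient gauss_rationals) (alg_box_quotient gauss_rationals) \<phi>"
    by (rule space_morphism_algebraic) (auto simp: gauss_rationals_def \<phi>)
  ultimately show ?thesis by blast
qed

end
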